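(* The functional $\mathcal{E}_4(f_1,f_2,f_3,f_4)$ on $L^2(\mathbb{R}\to\mathbb{C})^4$ is invariant under each of the following actions, applied simultaneously to all $f_k$, $k=1,\dots,4$ (for all $\lambda\in\mathbb{R}$): (i) Fourier transform, $f_k\mapsto\widehat{f}_k$; (ii) modulation, $f_k\mapsto e^{i\lambda}f_k$; (iii) linear modulation, $f_k\mapsto e^{i\lambda x}f_k$; (iv) translation, $f_k\mapsto f_k(\cdot+\lambda)$; (v) Schrödinger with harmonic trapping group, $f_k\mapsto e^{i\lambda H}f_k$.
   Context: $H=-\Delta+x^2$ on $L^2(\mathbb{R})$, and $e^{itH}$ is the unitary propagator of $iu_t+Hu=0$ (so $e^{itH}\phi_n=e^{it(2n+1)}\phi_n$ for the Hermite functions $\phi_n$, $H\phi_n=(2n+1)\phi_n$). The Fourier transform is $\widehat{f}(\xi)=(2\pi)^{-1/2}\int_{\mathbb{R}}e^{-ix\xi}f(x)\,dx$. The functional is $$\mathcal{E}_4(f_1,f_2,f_3,f_4)=\frac{2}{\pi}\int_0^{\pi/2}\int_{\mathbb{R}}(e^{itH}f_1)(e^{itH}f_2)\overline{(e^{itH}f_3)(e^{itH}f_4)}\,dx\,dt.$$ *)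

theory Defs
  imports "HOL-Analysis.Analysis"
begin

text \<open>
  Elements of \<open>L\<^sup>2(\<real> \<rightarrow> \<complex>)\<close> are handled through Borel representatives; operators on it
  are functions on representatives, and identities between them hold almost everywhere.
\<close>

definition L2 :: "(real \<Rightarrow> complex) set" where
  "L2 = {f \<in> borel_measurable borel. integrable lborel (\<lambda>x. (norm (f x))\<^sup>2)}"

definition L2_norm :: "(real \<Rightarrow> complex) \<Rightarrow> real" where
  "L2_norm f = sqrt (LBINT x. (norm (f x))\<^sup>2)"

text \<open>
  The Bochner integral of a non-integrable function is \<open>0\<close>, so membership in \<open>L2\<close> is part of
  the notion of convergence.
\<close>

definition L2_tendsto ::
    "('i \<Rightarrow> real \<Rightarrow> complex) \<Rightarrow> (real \<Rightarrow> complex) \<Rightarrow> 'i filter \<Rightarrow> bool" where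
  "L2_tendsto g f F \<longleftrightarrow> f \<in> L2 \<and> (\<forall>\<^sub>F i in F. g i \<in> L2) \<and>
     ((\<lambda>i. L2_norm (\<lambda>x. g i x - f x)) \<longlongrightarrow> 0) F"

text \<open>
  The Fourier transform on \<open>L\<^sup>2\<close>: the defining integral converges absolutely only for
  \<open>f \<in> L\<^sup>1\<close>, so it is taken as the limit in the mean of the truncated integrals (Plancherel).
\<close>

definition fourier_L2 :: "(real \<Rightarrow> complex) \<Rightarrow> real \<Rightarrow> complex" where
  "fourier_L2 f = (SOME g. L2_tendsto
     (\<lambda>R \<xi>. complex_of_real (1 / sqrt (2 * pi)) *
        (LBINT x:{-R..R}. exp (- (\<i> * complex_of_real x * complex_of_real \<xi>)) * f x))
     g at_top)"

definition nth_vector_derivative :: "nat \<Rightarrow> (real \<Rightarrow> complex) \<Rightarrow> real \<Rightarrow> complex" where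
  "nth_vector_derivative n = (\<lambda>f x. vector_derivative f (at x)) ^^ n"

definition schwartz :: "(real \<Rightarrow> complex) set" where
  "schwartz = {f. (\<forall>n x. nth_vector_derivative n f differentiable (at x)) \<and>
     (\<forall>k n. bounded (range (\<lambda>x. x ^ k *\<^sub>R nth_vector_derivative n f x)))}"

definition harmonic_op :: "(real \<Rightarrow> complex) \<Rightarrow> real \<Rightarrow> complex" where
  "harmonic_op f x = - nth_vector_derivative 2 f x + complex_of_real (x\<^sup>2) * f x"

definition unitary_group :: "(real \<Rightarrow> (real \<Rightarrow> complex) \<Rightarrow> real \<Rightarrow> complex) \<Rightarrow> bool" where
  "unitary_group U \<longleftrightarrow>
     (\<forall>t. \<forall>f\<in>L2. U t f \<in> L2 \<and> L2_norm (U t f) = L2_norm f) \<and>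
     (\<forall>t a b. \<forall>f\<in>L2. \<forall>g\<in>L2.
        AE x in lborel. U t (\<lambda>y. a * f y + b * g y) x = a * U t f x + b * U t g x) \<and>
     (\<forall>f\<in>L2. AE x in lborel. U 0 f x = f x) \<and>
     (\<forall>s t. \<forall>f\<in>L2. AE x in lborel. U (s + t) f x = U s (U t f) x) \<and>
     (\<forall>f\<in>L2. L2_tendsto (\<lambda>t. U t f) f (at 0))"

text \<open>
  The group generated by \<open>\<i>H\<close>: since \<open>H\<close> is essentially self-adjoint on the Schwartz space,
  a unitary group is determined (almost everywhere) by requiring, for Schwartz initial data \<open>f\<close>,
  that \<open>u(t) = U t f\<close> be differentiable in \<open>L\<^sup>2\<close> at \<open>t = 0\<close> with \<open>\<i> u'(0) + H f = 0\<close>; by the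
  group law the equation then holds at all times.
\<close>

definition harmonic_propagator ::
    "(real \<Rightarrow> (real \<Rightarrow> complex) \<Rightarrow> real \<Rightarrow> complex) \<Rightarrow> bool" where
  "harmonic_propagator U \<longleftrightarrow> unitary_group U \<and>
     (\<forall>f\<in>schwartz. L2_tendsto
        (\<lambda>t x. \<i> * ((U t f x - f x) / complex_of_real t) + harmonic_op f x) (\<lambda>x. 0) (at 0))"

definition exp_itH :: "real \<Rightarrow> (real \<Rightarrow> complex) \<Rightarrow> real \<Rightarrow> complex" where
  "exp_itH = (SOME U. harmonic_propagator U)"

text \<open>
  The inner integral depends only on the \<open>L\<^sup>2\<close> classes of the \<open>f\<^sub>k\<close>, and by the Strichartz
  estimates it converges absolutely for almost every \<open>t\<close>, with an integrable result.
\<close>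

definition E4 ::
    "(real \<Rightarrow> complex) \<Rightarrow> (real \<Rightarrow> complex) \<Rightarrow> (real \<Rightarrow> complex) \<Rightarrow> (real \<Rightarrow> complex) \<Rightarrow> complex" where
  "E4 f1 f2 f3 f4 = complex_of_real (2 / pi) *
     (LBINT t:{0..pi/2}. (LBINT x.
        exp_itH t f1 x * exp_itH t f2 x * cnj (exp_itH t f3 x * exp_itH t f4 x)))"

end

theory Submission
  imports Defs "HOL-Probability.Levy"
begin

text \<open>
  Everything is read off the coherent states \<open>G\<^sub>z(x) = exp (-x\<^sup>2/2 + 2xz - z\<^sup>2)\<close>, whose span is
  dense in \<open>L\<^sup>2\<close> because the Fourier transform is injective on \<open>L\<^sup>1\<close>. Since
  \<open>\<langle>G\<^sub>z, G\<^sub>w\<rangle> = \<surd>\<pi> e\<^bsup>2z cnj w\<^esup>\<close>, the map \<open>G\<^sub>z \<mapsto> e\<^bsup>it\<^esup> G\<^bsub>exp(2it)z\<^esub>\<close> extends to a unitary group, which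
  is shown to be the unique propagator of \<open>\<i>u\<^sub>t + Hu = 0\<close>. Checking the action on coherent states gives
  three facts: the Fourier transform is \<open>e\<^bsup>i\<pi>/4\<^esup> e\<^bsup>-i(\<pi>/4)H\<^esup>\<close>; \<open>e\<^bsup>i(\<pi>/2)H\<^esup> f(x) = \<i> f(-x)\<close>; and \<open>e\<^bsup>itH\<^esup>\<close>
  carries translations and linear modulations to combinations of the two. The phases created in this
  way cancel in the quartic integrand. Thus the inner integral is \<open>\<pi>/2\<close>-periodic in \<open>t\<close>, which gives
  invariance under \<open>e\<^bsup>i\<lambda>H\<^esup>\<close>, and translations and modulations leave it unchanged for every \<open>t\<close>.
\<close>

section \<open>The Hilbert space of square-integrable functions\<close>

text \<open>Coherent states replace the Hermite basis because one Gaussian integral yields all their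
  inner products, and because \<open>H\<close> acts on them as the first-order operator 1 + 2 z d/dz
  in the parameter, which the rotation of z by \<open>cis (2 * t)\<close> with the phase
  \<open>cis t\<close> integrates explicitly. The obstacle is that \<open>exp_itH\<close> and
  \<open>fourier_L2\<close> are arbitrary choices of an object with a prescribed property: each
  property has to be satisfiable and has to determine the result modulo null sets. For
  \<open>exp_itH\<close> the property demands a norm derivative at every Schwartz function, whereas
  only coherent states evolve explicitly. Symmetry of \<open>H\<close> converts their derivative
  into a weak derivative for Schwartz data, and strong continuity upgrades the weak derivative to
  one in norm. The quartic integrals are compared only through integrands that agree almost
  everywhere, affine changes of variable and a splitting of the time interval; all these steps
  respect the default value 0 of a divergent integral.\<close>

lemma L2_measurable: "f \<in> L2 \<Longrightarrow> f \<in> borel_measurable borel"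
  by (simp add: L2_def)

lemma L2_integrable_norm_sq: "f \<in> L2 \<Longrightarrow> integrable lborel (\<lambda>x. (norm (f x))\<^sup>2)"
  by (simp add: L2_def)

lemma L2_zero: "(\<lambda>x. 0) \<in> L2"
  by (simp add: L2_def)

lemma L2_cmult: "f \<in> L2 \<Longrightarrow> (\<lambda>x. c * f x) \<in> L2"
  by (auto simp: L2_def norm_mult power_mult_distrib)

lemma L2_add:
  assumes "f \<in> L2" "g \<in> L2"
  shows "(\<lambda>x. f x + g x) \<in> L2"
proof -
  have [measurable]: "f \<in> borel_measurable borel" "g \<in> borel_measurable borel"
    using assms by (auto simp: L2_def)
  have "integrable lborel (\<lambda>x. (norm (f x + g x))\<^sup>2)"
  proof (rule Bochner_Integration.integrable_bound)
    show "integrable lborel (\<lambda>x. 2 * (norm (f x))\<^sup>2 + 2 * (norm (g x))\<^sup>2)"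
      using assms by (auto simp: L2_def)
    show "AE x in lborel. norm ((norm (f x + g x))\<^sup>2)
        \<le> norm (2 * (norm (f x))\<^sup>2 + 2 * (norm (g x))\<^sup>2)"
    proof (intro AE_I2)
      fix x
      have "(norm (f x + g x))\<^sup>2 \<le> (norm (f x) + norm (g x))\<^sup>2"
        by (intro power_mono norm_triangle_ineq) auto
      also have "\<dots> \<le> 2 * (norm (f x))\<^sup>2 + 2 * (norm (g x))\<^sup>2"
        using sum_squares_bound[of "norm (f x)" "norm (g x)"]
        by (simp add: power2_sum)
      finally show "norm ((norm (f x + g x))\<^sup>2) \<le> norm (2 * (norm (f x))\<^sup>2 + 2 * (norm (g x))\<^sup>2)"
        by simp
    qed
  qed simp
  then show ?thesis by (simp add: L2_def)
qed

lemma L2_scaleR: "f \<in> L2 \<Longrightarrow> (\<lambda>x. r *\<^sub>R f x) \<in> L2"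
  using L2_cmult[of f "complex_of_real r"] by (simp add: scaleR_conv_of_real)

lemma L2_minus: "f \<in> L2 \<Longrightarrow> (\<lambda>x. - f x) \<in> L2"
  using L2_cmult[of f "-1"] by simp

lemma L2_diff: "f \<in> L2 \<Longrightarrow> g \<in> L2 \<Longrightarrow> (\<lambda>x. f x - g x) \<in> L2"
  using L2_add[of f "\<lambda>x. - g x"] L2_minus by simp

lemma L2_integrable_mult:
  assumes "f \<in> L2" "g \<in> L2"
  shows "integrable lborel (\<lambda>x. f x * g x)"
proof (rule Bochner_Integration.integrable_bound)
  have [measurable]: "f \<in> borel_measurable borel" "g \<in> borel_measurable borel"
    using assms by (auto simp: L2_def)
  show "integrable lborel (\<lambda>x. (norm (f x))\<^sup>2 + (norm (g x))\<^sup>2)"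
    using assms by (auto simp: L2_def)
  show "(\<lambda>x. f x * g x) \<in> borel_measurable lborel"
    by simp
  have "norm (f x * g x) \<le> norm ((norm (f x))\<^sup>2 + (norm (g x))\<^sup>2)" for x
  proof -
    have "0 \<le> norm (f x) * norm (g x)" by simp
    then have "norm (f x) * norm (g x) \<le> (norm (f x))\<^sup>2 + (norm (g x))\<^sup>2"
      using sum_squares_bound[of "norm (f x)" "norm (g x)"] by linarith
    then show ?thesis by (simp add: norm_mult)
  qed
  then show "AE x in lborel. norm (f x * g x) \<le> norm ((norm (f x))\<^sup>2 + (norm (g x))\<^sup>2)"
    by simp
qed

lemma L2_cnj: "f \<in> L2 \<Longrightarrow> (\<lambda>x. cnj (f x)) \<in> L2"
  using borel_measurable_continuous_onI[OF continuous_on_cnj[OF continuous_on_id]]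
  by (auto simp: L2_def intro: measurable_compose)

lemma inner_complex_eq_Re: "inner a b = Re (a * cnj b)" for a b :: complex
  by (simp add: inner_complex_def)

lemma L2_integrable_inner:
  assumes "f \<in> L2" "g \<in> L2"
  shows "integrable lborel (\<lambda>x. inner (f x) (g x))"
  unfolding inner_complex_eq_Re
  using L2_integrable_mult[OF assms(1) L2_cnj[OF assms(2)]] by (rule integrable_Re)

\<comment> \<open>Square-integrable functions modulo null sets as a complete inner product
  space\<close>
quotient_type L2_class = "real \<Rightarrow> complex" / partial:
  "\<lambda>f g. f \<in> L2 \<and> g \<in> L2 \<and> (AE x in lborel. f x = g x)"
proof (rule part_equivpI)
  show "\<exists>f. f \<in> L2 \<and> f \<in> L2 \<and> (AE x in lborel. f x = f x)"
    using L2_zero by auto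
  show "symp (\<lambda>f g. f \<in> L2 \<and> g \<in> L2 \<and> (AE x in lborel. f x = g x))"
    by (auto intro!: sympI)
  show "transp (\<lambda>f g. f \<in> L2 \<and> g \<in> L2 \<and> (AE x in lborel. f x = g x))"
    by (auto intro!: transpI)
qed

lemma L2_integral_inner_cong:
  assumes "f \<in> L2" "f' \<in> L2" "AE x in lborel. f x = f' x"
    "g \<in> L2" "g' \<in> L2" "AE x in lborel. g x = g' x"
  shows "(LBINT x. inner (f x) (g x)) = (LBINT x. inner (f' x) (g' x))"
proof (rule integral_cong_AE)
  show "(\<lambda>x. inner (f x) (g x)) \<in> borel_measurable lborel"
    "(\<lambda>x. inner (f' x) (g' x)) \<in> borel_measurable lborel"
    using assms by (simp_all only: borel_measurable_integrable L2_integrable_inner)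
  show "AE x in lborel. inner (f x) (g x) = inner (f' x) (g' x)"
    using assms(3,6) by eventually_elim simp
qed

instantiation L2_class :: real_vector
begin

lift_definition zero_L2_class :: L2_class is "\<lambda>x. 0" by (simp add: L2_zero)
lift_definition plus_L2_class :: "L2_class \<Rightarrow> L2_class \<Rightarrow> L2_class" is "\<lambda>f g x. f x + g x"
  by (auto intro: L2_add elim!: AE_mp)
lift_definition minus_L2_class :: "L2_class \<Rightarrow> L2_class \<Rightarrow> L2_class" is "\<lambda>f g x. f x - g x"
  by (auto intro: L2_diff elim!: AE_mp)
lift_definition uminus_L2_class :: "L2_class \<Rightarrow> L2_class" is "\<lambda>f x. - f x"
  by (auto intro: L2_minus elim!: AE_mp)
lift_definition scaleR_L2_class :: "real \<Rightarrow> L2_class \<Rightarrow> L2_class" is "\<lambda>r f x. r *\<^sub>R f x"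
  by (auto intro: L2_scaleR elim!: AE_mp)

instance
  by standard (transfer; auto simp: algebra_simps intro!: L2_add L2_diff L2_minus L2_scaleR L2_zero)+

end

instantiation L2_class :: real_inner
begin

lift_definition inner_L2_class :: "L2_class \<Rightarrow> L2_class \<Rightarrow> real"
  is "\<lambda>f g. LBINT x. inner (f x) (g x)"
  by (auto intro: L2_integral_inner_cong)

definition norm_L2_class :: "L2_class \<Rightarrow> real" where "norm_L2_class a = sqrt (inner a a)"
definition sgn_L2_class :: "L2_class \<Rightarrow> L2_class" where "sgn_L2_class a = a /\<^sub>R norm a"
definition dist_L2_class :: "L2_class \<Rightarrow> L2_class \<Rightarrow> real" where "dist_L2_class a b = norm (a - b)"
definition uniformity_L2_class :: "(L2_class \<times> L2_class) filter"
  where "uniformity_L2_class = (INF e\<in>{0<..}. principal {(x, y). dist x y < e})"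
definition open_L2_class :: "L2_class set \<Rightarrow> bool"
  where "open_L2_class S = (\<forall>x\<in>S. \<forall>\<^sub>F (x', y) in uniformity. x' = x \<longrightarrow> y \<in> S)"

instance
proof
  fix a b c :: L2_class and r :: real
  show "inner a b = inner b a"
    by transfer (simp add: inner_commute)
  show "inner (a + b) c = inner a c + inner b c"
    by transfer (simp add: inner_add_left L2_integrable_inner)
  show "inner (r *\<^sub>R a) b = r * inner a b"
    by transfer simp
  show "0 \<le> inner a a"
    by transfer simp
  show "inner a a = 0 \<longleftrightarrow> a = 0"
  proof transfer
    fix f :: "real \<Rightarrow> complex"
    assume "f \<in> L2 \<and> f \<in> L2 \<and> (AE x in lborel. f x = f x)"
    then have f: "f \<in> L2" by simp
    have "(LBINT x. inner (f x) (f x)) = 0 \<longleftrightarrow> (AE x in lborel. inner (f x) (f x) = 0)"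
      by (intro integral_nonneg_eq_0_iff_AE L2_integrable_inner f) simp
    then show "(LBINT x. inner (f x) (f x)) = 0 \<longleftrightarrow>
        f \<in> L2 \<and> (\<lambda>x. 0) \<in> L2 \<and> (AE x in lborel. f x = 0)"
      using f L2_zero by simp
  qed
qed (simp_all add: norm_L2_class_def sgn_L2_class_def dist_L2_class_def
    uniformity_L2_class_def open_L2_class_def)

end

text \<open>The class \<open>real_inner\<close> provides real scalars and only the real part of the
  Hermitian product. Multiplication by complex numbers is therefore a separate family of operators,
  and complex statements are recovered by testing against \<open>cscale c\<close>.\<close>

lift_definition cscale :: "complex \<Rightarrow> L2_class \<Rightarrow> L2_class" is "\<lambda>c f x. c * f x"
  by (auto intro: L2_cmult elim!: AE_mp)

abbreviation L2_abs :: "(real \<Rightarrow> complex) \<Rightarrow> L2_class" where "L2_abs \<equiv> abs_L2_class"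
abbreviation L2_rep :: "L2_class \<Rightarrow> real \<Rightarrow> complex" where "L2_rep \<equiv> rep_L2_class"

lemma L2_abs_eq_iff:
  assumes "f \<in> L2" "g \<in> L2"
  shows "L2_abs f = L2_abs g \<longleftrightarrow> (AE x in lborel. f x = g x)"
  using Quotient_rel[OF Quotient_L2_class, of f g] assms by auto

lemma L2_rep_in [simp]: "L2_rep a \<in> L2"
  using Quotient_rep_reflp[OF Quotient_L2_class, of a] by simp

lemma L2_abs_rep [simp]: "L2_abs (L2_rep a) = a"
  using Quotient_abs_rep[OF Quotient_L2_class] .

lemma L2_abs_add: "f \<in> L2 \<Longrightarrow> g \<in> L2 \<Longrightarrow> L2_abs f + L2_abs g = L2_abs (\<lambda>x. f x + g x)"
  by (rule plus_L2_class.abs_eq) auto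

lemma L2_abs_diff: "f \<in> L2 \<Longrightarrow> g \<in> L2 \<Longrightarrow> L2_abs f - L2_abs g = L2_abs (\<lambda>x. f x - g x)"
  by (rule minus_L2_class.abs_eq) auto

lemma L2_abs_cscale: "f \<in> L2 \<Longrightarrow> cscale c (L2_abs f) = L2_abs (\<lambda>x. c * f x)"
  by (rule cscale.abs_eq) auto

lemma L2_abs_zero: "L2_abs (\<lambda>x. 0) = 0"
  by (simp add: zero_L2_class_def)

lemma inner_L2_abs:
  "f \<in> L2 \<Longrightarrow> g \<in> L2 \<Longrightarrow> inner (L2_abs f) (L2_abs g) = (LBINT x. inner (f x) (g x))"
  by (rule inner_L2_class.abs_eq) auto

lemma norm_L2_abs: "f \<in> L2 \<Longrightarrow> norm (L2_abs f) = L2_norm f"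
  by (simp add: norm_eq_sqrt_inner inner_L2_abs L2_norm_def power2_norm_eq_inner)

lemma norm_eq_L2_norm_rep: "norm a = L2_norm (L2_rep a)"
  using norm_L2_abs[of "L2_rep a"] by simp

lemma L2_norm_diff: "f \<in> L2 \<Longrightarrow> g \<in> L2 \<Longrightarrow> L2_norm (\<lambda>x. f x - g x) = norm (L2_abs f - L2_abs g)"
  by (simp add: L2_abs_diff norm_L2_abs L2_diff)

lemma cscale_linear: "linear (cscale c)"
proof
  show "cscale c (a + b) = cscale c a + cscale c b" for a b
    by transfer (auto simp: algebra_simps intro!: L2_cmult L2_add)
  show "cscale c (r *\<^sub>R a) = r *\<^sub>R cscale c a" for r a
    by transfer (auto simp: algebra_simps intro!: L2_cmult L2_scaleR)
qed

lemma norm_cscale: "norm (cscale c a) = norm c * norm a"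
proof -
  have "inner (cscale c a) (cscale c a) = (norm c)\<^sup>2 * inner a a"
    by transfer (simp add: power2_norm_eq_inner[symmetric] norm_mult power_mult_distrib)
  then show ?thesis
    by (simp add: norm_eq_sqrt_inner[of "cscale c a"] norm_eq_sqrt_inner[of a] real_sqrt_mult)
qed

lemma cscale_cscale: "cscale c (cscale d a) = cscale (c * d) a"
  by transfer (auto simp: algebra_simps intro!: L2_cmult)

lemma cscale_1: "cscale 1 a = a"
  by transfer auto

lemma cscale_of_real: "cscale (complex_of_real r) a = r *\<^sub>R a"
  by transfer (auto simp: scaleR_conv_of_real intro!: L2_cmult)

lemma inner_cscale_left: "inner (cscale c a) b = inner a (cscale (cnj c) b)"
  by transfer (simp add: inner_complex_def algebra_simps)

lemma inner_L2_abs_cscale: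
  assumes "f \<in> L2" "g \<in> L2"
  shows "inner (L2_abs f) (cscale c (L2_abs g)) = Re (cnj c * (LBINT x. f x * cnj (g x)))"
proof -
  have "inner (L2_abs f) (cscale c (L2_abs g)) = (LBINT x. inner (f x) (c * g x))"
    using assms by (simp add: L2_abs_cscale inner_L2_abs L2_cmult)
  also have "\<dots> = (LBINT x. Re (cnj c * (f x * cnj (g x))))"
    by (simp add: inner_complex_eq_Re mult_ac)
  also have "\<dots> = Re (LBINT x. cnj c * (f x * cnj (g x)))"
    using assms by (intro integral_Re integrable_mult_right L2_integrable_mult L2_cnj)
  finally show ?thesis by simp
qed

text \<open>The real inner product shows only a real part: c = 1 recovers the real part of the
  integral, c = \<i> its imaginary part.\<close>

lemma integral_mult_cnj_eq_if_inner_eq: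
  assumes "f \<in> L2" "g \<in> L2" "f' \<in> L2" "g' \<in> L2"
    and "\<And>c. inner (L2_abs f) (cscale c (L2_abs g)) = inner (L2_abs f') (cscale c (L2_abs g'))"
  shows "(LBINT x. f x * cnj (g x)) = (LBINT x. f' x * cnj (g' x))"
  using assms(5)[of 1] assms(5)[of \<i>] assms(1-4)
  by (simp add: inner_L2_abs_cscale complex_eq_iff)

text \<open>Riesz-Fischer along a fast sequence. The squared increments have integral at most 16^-n,
  so even with the weight 4^n their sum is integrable and hence finite almost everywhere. This
  bounds the pointwise increments by a multiple of 2^-n and gives a pointwise limit, which Fatou's
  lemma turns into a limit in norm.\<close>

lemma L2_class_Cauchy_geometric:
  fixes X :: "nat \<Rightarrow> L2_class"
  assumes fast: "\<And>n. norm (X (Suc n) - X n) \<le> (1/4) ^ n"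
    and "Cauchy X"
  shows "convergent X"
proof -
  define f where "f n = L2_rep (X n)" for n
  have f: "f n \<in> L2" for n by (simp add: f_def)
  have [measurable]: "f n \<in> borel_measurable borel" for n
    using f by (rule L2_measurable)
  have X: "X n = L2_abs (f n)" for n by (simp add: f_def)
  have norm_X: "(\<integral>\<^sup>+x. ennreal ((norm (f m x - f n x))\<^sup>2) \<partial>lborel) = ennreal ((norm (X m - X n))\<^sup>2)" for m n
  proof -
    have "(\<integral>\<^sup>+x. ennreal ((norm (f m x - f n x))\<^sup>2) \<partial>lborel) = ennreal (LBINT x. (norm (f m x - f n x))\<^sup>2)"
      using L2_diff[OF f f, of m n] by (intro nn_integral_eq_integral) (auto simp: L2_def)
    also have "(LBINT x. (norm (f m x - f n x))\<^sup>2) = (norm (X m - X n))\<^sup>2"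
      by (simp add: X L2_abs_diff f norm_L2_abs L2_diff) (simp add: L2_norm_def)
    finally show ?thesis .
  qed
  have "(\<integral>\<^sup>+x. (\<Sum>n. ennreal (4 ^ n * (norm (f (Suc n) x - f n x))\<^sup>2)) \<partial>lborel)
      = (\<Sum>n. \<integral>\<^sup>+x. ennreal (4 ^ n * (norm (f (Suc n) x - f n x))\<^sup>2) \<partial>lborel)"
    by (rule nn_integral_suminf) simp
  also have "\<dots> = (\<Sum>n. ennreal (4 ^ n * (norm (X (Suc n) - X n))\<^sup>2))"
    by (simp add: ennreal_mult nn_integral_cmult norm_X)
  also have "\<dots> \<le> (\<Sum>n. ennreal ((1/4) ^ n))"
  proof (intro suminf_le ennreal_leI)
    fix n
    have "4 ^ n * (norm (X (Suc n) - X n))\<^sup>2 \<le> 4 ^ n * ((1/4) ^ n)\<^sup>2"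
      using fast[of n] by (intro mult_left_mono power_mono) auto
    also have "\<dots> = (4 * (1/4 * (1/4))) ^ n"
      by (simp only: power2_eq_square power_mult_distrib)
    finally show "4 ^ n * (norm (X (Suc n) - X n))\<^sup>2 \<le> (1/4::real) ^ n" by simp
  qed auto
  also have "\<dots> = ennreal (\<Sum>n. (1/4) ^ n)"
    by (intro suminf_ennreal2 summable_geometric) auto
  finally have "(\<integral>\<^sup>+x. (\<Sum>n. ennreal (4 ^ n * (norm (f (Suc n) x - f n x))\<^sup>2)) \<partial>lborel) \<noteq> \<infinity>"
    by (auto simp: top_unique)
  then have "AE x in lborel. (\<Sum>n. ennreal (4 ^ n * (norm (f (Suc n) x - f n x))\<^sup>2)) \<noteq> \<infinity>"
    by (intro nn_integral_PInf_AE) auto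
  then have conv: "AE x in lborel. convergent (\<lambda>n. f n x)"
  proof eventually_elim
    fix x assume "(\<Sum>n. ennreal (4 ^ n * (norm (f (Suc n) x - f n x))\<^sup>2)) \<noteq> \<infinity>"
    then have "summable (\<lambda>n. 4 ^ n * (norm (f (Suc n) x - f n x))\<^sup>2)"
      by (intro summable_suminf_not_top) auto
    then have "Bseq (\<lambda>n. 4 ^ n * (norm (f (Suc n) x - f n x))\<^sup>2)"
      by (intro convergent_imp_Bseq convergentI[OF summable_LIMSEQ_zero])
    then obtain K where K: "K > 0" "\<And>n. norm (4 ^ n * (norm (f (Suc n) x - f n x))\<^sup>2) \<le> K"
      by (auto simp: Bseq_def)
    have "norm (f (Suc n) x - f n x) \<le> sqrt K * (1/2) ^ n" for n
    proof -
      have "(2 ^ n * norm (f (Suc n) x - f n x))\<^sup>2 \<le> K"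
        using K(2)[of n] by (simp add: power_mult_distrib power_mult[symmetric] mult.commute[of n] power_mult)
      then have "2 ^ n * norm (f (Suc n) x - f n x) \<le> sqrt K"
        by (rule real_le_rsqrt)
      then show ?thesis by (simp add: field_simps power_divide)
    qed
    moreover have "summable (\<lambda>n. sqrt K * (1/2) ^ n)"
      by (intro summable_mult summable_geometric) simp
    ultimately have "summable (\<lambda>n. f (Suc n) x - f n x)"
      using summable_comparison_test'[of "\<lambda>n. sqrt K * (1/2) ^ n" 0 "\<lambda>n. f (Suc n) x - f n x"] by blast
    then have "convergent (\<lambda>n. \<Sum>k<n. f (Suc k) x - f k x)"
      by (simp add: summable_iff_convergent)
    then have "convergent (\<lambda>n. (f n x - f 0 x) + f 0 x)"
      by (intro convergent_add convergent_const) (simp add: sum_lessThan_telescope[of "\<lambda>n. f n x"])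
    then show "convergent (\<lambda>n. f n x)" by simp
  qed
  define g where "g x = lim (\<lambda>n. f n x)" for x
  have [measurable]: "g \<in> borel_measurable borel"
    unfolding g_def by (rule borel_measurable_lim_metric) simp
  have lim: "AE x in lborel. (\<lambda>n. f n x) \<longlonglongrightarrow> g x"
    using conv by eventually_elim (simp add: g_def convergent_LIMSEQ_iff)
  have fatou: "(\<integral>\<^sup>+x. ennreal ((norm (f m x - g x))\<^sup>2) \<partial>lborel) \<le> ennreal (e\<^sup>2)"
    if e: "e \<ge> 0" "\<And>n. n \<ge> m \<Longrightarrow> norm (X m - X n) \<le> e" for m e
  proof -
    have "(\<integral>\<^sup>+x. ennreal ((norm (f m x - g x))\<^sup>2) \<partial>lborel)
        = (\<integral>\<^sup>+x. liminf (\<lambda>n. ennreal ((norm (f m x - f n x))\<^sup>2)) \<partial>lborel)"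
    proof (rule nn_integral_cong_AE)
      show "AE x in lborel. ennreal ((norm (f m x - g x))\<^sup>2) = liminf (\<lambda>n. ennreal ((norm (f m x - f n x))\<^sup>2))"
        using lim
      proof eventually_elim
        fix x assume "(\<lambda>n. f n x) \<longlonglongrightarrow> g x"
        then have "(\<lambda>n. ennreal ((norm (f m x - f n x))\<^sup>2)) \<longlonglongrightarrow> ennreal ((norm (f m x - g x))\<^sup>2)"
          by (intro tendsto_ennrealI tendsto_intros)
        then show "ennreal ((norm (f m x - g x))\<^sup>2) = liminf (\<lambda>n. ennreal ((norm (f m x - f n x))\<^sup>2))"
          by (rule lim_imp_Liminf[OF sequentially_bot, symmetric])
      qed
    qed
    also have "\<dots> \<le> liminf (\<lambda>n. \<integral>\<^sup>+x. ennreal ((norm (f m x - f n x))\<^sup>2) \<partial>lborel)"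
      by (rule nn_integral_liminf) simp
    also have "\<dots> = liminf (\<lambda>n. ennreal ((norm (X m - X n))\<^sup>2))"
      by (simp add: norm_X)
    also have "\<dots> \<le> ennreal (e\<^sup>2)"
    proof (rule Liminf_le)
      show "\<forall>\<^sub>F n in sequentially. ennreal ((norm (X m - X n))\<^sup>2) \<le> ennreal (e\<^sup>2)"
        using eventually_ge_at_top[of m]
        by eventually_elim (use e in \<open>auto intro!: ennreal_leI power_mono\<close>)
    qed simp
    finally show ?thesis .
  qed
  have diff_L2: "(\<lambda>x. f m x - g x) \<in> L2 \<and> L2_norm (\<lambda>x. f m x - g x) \<le> e"
    if e: "e \<ge> 0" "\<And>n. n \<ge> m \<Longrightarrow> norm (X m - X n) \<le> e" for m e
  proof -
    have le: "(\<integral>\<^sup>+x. ennreal ((norm (f m x - g x))\<^sup>2) \<partial>lborel) \<le> ennreal (e\<^sup>2)"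
      using e by (rule fatou)
    then have int: "integrable lborel (\<lambda>x. (norm (f m x - g x))\<^sup>2)"
      by (intro integrableI_nonneg) (auto intro: order.strict_trans1)
    moreover have "(LBINT x. (norm (f m x - g x))\<^sup>2) \<le> e\<^sup>2"
      using le nn_integral_eq_integral[OF int] by simp
    ultimately show ?thesis
      using e by (auto simp: L2_def L2_norm_def intro!: real_le_lsqrt)
  qed
  have Cauchy: "\<exists>M. \<forall>m\<ge>M. \<forall>n\<ge>M. norm (X m - X n) < e" if "e > 0" for e
    using CauchyD[OF \<open>Cauchy X\<close> that] .
  have gL2: "g \<in> L2"
  proof -
    obtain M where "\<forall>m\<ge>M. \<forall>n\<ge>M. norm (X m - X n) < 1"
      using Cauchy[of 1] by auto
    then have "(\<lambda>x. f M x - g x) \<in> L2"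
      using diff_L2[of 1 M] by (simp add: less_imp_le)
    then have "(\<lambda>x. f M x - (f M x - g x)) \<in> L2"
      using L2_diff[OF f[of M]] by blast
    then show ?thesis by simp
  qed
  have "X \<longlonglongrightarrow> L2_abs g"
  proof (rule LIMSEQ_I)
    fix e :: real assume "e > 0"
    then obtain M where M: "\<forall>m\<ge>M. \<forall>n\<ge>M. norm (X m - X n) < e / 2"
      using Cauchy[of "e/2"] by auto
    have "norm (X m - L2_abs g) < e" if "m \<ge> M" for m
    proof -
      have "norm (X m - L2_abs g) \<le> e / 2"
        using diff_L2[of "e/2" m] M that \<open>e > 0\<close>
        by (simp add: X L2_norm_diff[OF f gL2, symmetric] less_imp_le)
      then show ?thesis using \<open>e > 0\<close> by simp
    qed
    then show "\<exists>M. \<forall>m\<ge>M. norm (X m - L2_abs g) < e" by blast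
  qed
  then show ?thesis by (rule convergentI)
qed

instance L2_class :: complete_space
proof
  fix X :: "nat \<Rightarrow> L2_class"
  assume C: "Cauchy X"
  have "\<exists>N. \<forall>m\<ge>N. \<forall>k\<ge>N. dist (X m) (X k) < (1/4) ^ n" for n
    using C by (auto simp: Cauchy_def)
  then obtain N where N: "\<And>n m k. m \<ge> N n \<Longrightarrow> k \<ge> N n \<Longrightarrow> dist (X m) (X k) < (1/4) ^ n"
    by metis
  \<comment> \<open>Summing all earlier \<open>N i\<close> makes \<open>r n\<close> dominate
    \<open>N n\<close>; the extra n makes \<open>r\<close> strictly increasing.\<close>
  define r where "r n = (\<Sum>i\<le>n. N i) + n" for n
  have r: "strict_mono r"
    by (rule strict_monoI_Suc) (simp add: r_def)
  have rN: "r n \<ge> N n" for n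
    unfolding r_def by (rule trans_le_add1) (simp add: member_le_sum)
  have rN': "r (Suc n) \<ge> N n" for n
    using rN[of n] strict_monoD[OF r, of n "Suc n"] by simp
  have "convergent (X \<circ> r)"
  proof (rule L2_class_Cauchy_geometric)
    show "norm ((X \<circ> r) (Suc n) - (X \<circ> r) n) \<le> (1/4) ^ n" for n
      using N[OF rN' rN, of n] by (simp add: dist_norm)
    show "Cauchy (X \<circ> r)" using C r by (rule Cauchy_subseq_Cauchy)
  qed
  then obtain l where "(X \<circ> r) \<longlonglongrightarrow> l" by (auto simp: convergent_def)
  then show "convergent X"
    using C r by (metis Cauchy_converges_subseq convergent_def)
qed

section \<open>Density and extension of isometries\<close>

lemma subspace_closure:
  fixes S :: "'a::real_normed_vector set"
  assumes "subspace S"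
  shows "subspace (closure S)"
proof (rule subspaceI)
  show "0 \<in> closure S"
    using subspace_0[OF assms] closure_subset by blast
next
  fix x y assume "x \<in> closure S" "y \<in> closure S"
  then obtain f g where "\<And>n. f n \<in> S" "f \<longlonglongrightarrow> x" "\<And>n. g n \<in> S" "g \<longlonglongrightarrow> y"
    unfolding closure_sequential by blast
  then show "x + y \<in> closure S"
    unfolding closure_sequential
    by (intro exI[of _ "\<lambda>n. f n + g n"]) (auto intro!: tendsto_add subspace_add assms)
next
  fix x c assume "x \<in> closure S"
  then obtain f where "\<And>n. f n \<in> S" "f \<longlonglongrightarrow> x"
    unfolding closure_sequential by blast
  then show "c *\<^sub>R x \<in> closure S"
    unfolding closure_sequential
    by (intro exI[of _ "\<lambda>n. c *\<^sub>R f n"]) (auto intro!: tendsto_scaleR subspace_scale assms)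
qed

lemma parallelogram:
  fixes u v :: "'a::real_inner"
  shows "(norm (u - v))\<^sup>2 + (norm (u + v))\<^sup>2 = 2 * (norm u)\<^sup>2 + 2 * (norm v)\<^sup>2"
  by (simp add: power2_norm_eq_inner algebra_simps inner_commute)

text \<open>The midpoint of two points of M stays in M, so its distance from x is at least
  \<open>d\<close>; by the parallelogram law this forces every minimising sequence to be
  Cauchy.\<close>

lemma closed_subspace_nearest_point:
  fixes M :: "'a::{real_inner, complete_space} set"
  assumes "subspace M" "closed M"
  obtains y where "y \<in> M" "\<And>z. z \<in> M \<Longrightarrow> norm (x - y) \<le> norm (x - z)"
proof -
  define d where "d = (INF z\<in>M. norm (x - z))"
  have bdd: "bdd_below ((\<lambda>z. norm (x - z)) ` M)"
    by (rule bdd_belowI[of _ 0]) auto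
  have ne: "M \<noteq> {}" using subspace_0[OF assms(1)] by auto
  have d: "d \<le> norm (x - z)" if "z \<in> M" for z
    unfolding d_def using bdd that by (rule cINF_lower)
  have d0: "0 \<le> d" unfolding d_def using ne by (intro cINF_greatest) auto
  have "\<exists>z\<in>M. norm (x - z) < d + inverse (real (Suc n))" for n
    using cInf_less_iff[of "(\<lambda>z. norm (x - z)) ` M" "d + inverse (real (Suc n))"] ne bdd
    by (auto simp: d_def)
  then obtain y where yM: "\<And>n. y n \<in> M" and y: "\<And>n. norm (x - y n) < d + inverse (real (Suc n))"
    by metis
  have close: "(norm (y m - y n))\<^sup>2 \<le> 2 * (d + inverse (real (Suc m)))\<^sup>2 + 2 * (d + inverse (real (Suc n)))\<^sup>2 - 4 * d\<^sup>2" for m n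
  proof -
    have "(1/2) *\<^sub>R (y m + y n) \<in> M"
      using yM by (intro subspace_scale subspace_add assms(1))
    from d[OF this] have "2 * d \<le> norm (2 *\<^sub>R (x - (1/2) *\<^sub>R (y m + y n)))" by simp
    also have "2 *\<^sub>R (x - (1/2) *\<^sub>R (y m + y n)) = (x - y n) + (x - y m)"
      by (simp add: algebra_simps scaleR_2)
    finally have "(2 * d)\<^sup>2 \<le> (norm ((x - y n) + (x - y m)))\<^sup>2"
      using d0 by (intro power_mono) auto
    moreover have "(norm (x - y n))\<^sup>2 \<le> (d + inverse (real (Suc n)))\<^sup>2" for n
      using y[of n] by (intro power_mono) auto
    from this[of m] this[of n]
    have "(norm (x - y m))\<^sup>2 \<le> (d + inverse (real (Suc m)))\<^sup>2"
      "(norm (x - y n))\<^sup>2 \<le> (d + inverse (real (Suc n)))\<^sup>2" by auto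
    ultimately show ?thesis
      using parallelogram[of "x - y n" "x - y m"] by (simp add: power_mult_distrib)
  qed
  have lim: "(\<lambda>n. d + inverse (real (Suc n))) \<longlonglongrightarrow> d"
    using tendsto_add[OF tendsto_const LIMSEQ_inverse_real_of_nat] by simp
  have "Cauchy y"
  proof (rule CauchyI)
    fix e :: real assume "e > 0"
    have "(\<lambda>n. (d + inverse (real (Suc n)))\<^sup>2) \<longlonglongrightarrow> d\<^sup>2"
      using lim by (rule tendsto_power)
    moreover have "d\<^sup>2 < d\<^sup>2 + e\<^sup>2 / 4"
      using \<open>e > 0\<close> by simp
    ultimately have "\<forall>\<^sub>F n in sequentially. (d + inverse (real (Suc n)))\<^sup>2 < d\<^sup>2 + e\<^sup>2 / 4"
      by (rule order_tendstoD(2))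
    then obtain N where N: "\<And>n. n \<ge> N \<Longrightarrow> (d + inverse (real (Suc n)))\<^sup>2 < d\<^sup>2 + e\<^sup>2 / 4"
      by (auto simp: eventually_sequentially)
    have "norm (y m - y n) < e" if "m \<ge> N" "n \<ge> N" for m n
    proof -
      have "(norm (y m - y n))\<^sup>2 < e\<^sup>2"
        using close[of m n] N[OF that(1)] N[OF that(2)] by linarith
      then show ?thesis using \<open>e > 0\<close> by (simp add: power2_less_imp_less)
    qed
    then show "\<exists>N. \<forall>m\<ge>N. \<forall>n\<ge>N. norm (y m - y n) < e" by blast
  qed
  then obtain l where l: "y \<longlonglongrightarrow> l" by (auto simp: Cauchy_convergent_iff convergent_def)
  have "l \<in> M" using \<open>closed M\<close> yM l by (rule closed_sequentially)
  moreover have "norm (x - l) \<le> d"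
  proof (rule LIMSEQ_le)
    show "(\<lambda>n. norm (x - y n)) \<longlonglongrightarrow> norm (x - l)" by (intro tendsto_intros l)
    show "\<exists>N. \<forall>n\<ge>N. norm (x - y n) \<le> d + inverse (real (Suc n))" using y by (auto intro: less_imp_le)
  qed (rule lim)
  ultimately show ?thesis using d by (intro that[of l]) force+
qed

text \<open>The error of the best approximation from the closed span is orthogonal to
  \<open>A\<close>, hence zero.\<close>

lemma dense_span_if_orthogonal_trivial:
  fixes A :: "'a::{real_inner, complete_space} set"
  assumes "\<And>v. (\<And>a. a \<in> A \<Longrightarrow> inner v a = 0) \<Longrightarrow> v = 0"
  shows "closure (span A) = UNIV"
proof (intro equalityI subsetI UNIV_I)
  fix x
  have sub: "subspace (closure (span A))" by (intro subspace_closure subspace_span)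
  obtain y where y: "y \<in> closure (span A)" "\<And>z. z \<in> closure (span A) \<Longrightarrow> norm (x - y) \<le> norm (x - z)"
    using closed_subspace_nearest_point[OF sub closed_closure] by blast
  have "x - y = 0"
  proof (rule assms)
    fix a assume "a \<in> A"
    then have a: "a \<in> closure (span A)" using span_base closure_subset by blast
    show "inner (x - y) a = 0"
    proof (cases "a = 0")
      case False
      \<comment> \<open>The multiple of a that minimises the distance along the line; it would lower
        the squared distance by \<open>(inner (x - y) a)\<^sup>2 / inner a a\<close>, so minimality
        of y forces this quantity to vanish.\<close>
      define c where "c = inner (x - y) a / inner a a"
      have "norm (x - y) \<le> norm (x - (y + c *\<^sub>R a))"
        using y a by (intro y(2) subspace_add subspace_scale sub)
      then have "inner (x - y) (x - y) \<le> inner (x - y - c *\<^sub>R a) (x - y - c *\<^sub>R a)"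
        by (simp add: norm_le diff_diff_eq)
      also have "\<dots> = inner (x - y) (x - y) - 2 * c * inner (x - y) a + c * c * inner a a"
        by (simp add: inner_diff_left inner_diff_right inner_commute algebra_simps)
      also have "\<dots> = inner (x - y) (x - y) - (inner (x - y) a)\<^sup>2 / inner a a"
        using False by (simp add: c_def power2_eq_square)
      finally have "(inner (x - y) a)\<^sup>2 / inner a a \<le> 0" by simp
      moreover have "0 < inner a a" using False by simp
      ultimately have "(inner (x - y) a)\<^sup>2 \<le> 0" by (simp add: divide_le_0_iff not_le)
      then show ?thesis by simp
    qed simp
  qed
  with y(1) show "x \<in> closure (span A)" by simp
qed

text \<open>The operator is built as a graph, the closure of the span of the pairs
  \<open>(e i, e' i)\<close>. Equal Gram matrices give both coordinates the same norm there, so the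
  first determines the second even if the \<open>e i\<close> are linearly dependent. Density and
  completeness make the graph cover the whole space.\<close>

lemma isometry_extension:
  fixes e e' :: "'i \<Rightarrow> 'a::{real_inner, complete_space}"
  assumes inner_eq: "\<And>i j. inner (e' i) (e' j) = inner (e i) (e j)"
    and dense: "closure (span (range e)) = UNIV"
  obtains T where "linear T" "\<And>a. norm (T a) = norm a" "\<And>i. T (e i) = e' i"
proof -
  define S where "S = span (range (\<lambda>i. (e i, e' i)))"
  have sub: "subspace (closure S)"
    unfolding S_def by (intro subspace_closure subspace_span)
  have inner1: "inner (snd v) (e' i) = inner (fst v) (e i)" if "v \<in> S" for v i
    using that unfolding S_def
    by (induction rule: span_induct) (auto intro!: subspaceI simp: inner_eq inner_add_left)
  have inner2: "inner (snd v) (snd w) = inner (fst v) (fst w)" if v: "v \<in> S" and w: "w \<in> S" for v w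
    using w unfolding S_def
    by (induction rule: span_induct)
      (auto intro!: subspaceI simp: inner1[OF v] inner_add_right)
  have norm_S: "norm (snd v) = norm (fst v)" if "v \<in> S" for v
    using inner2[OF that that] by (simp add: norm_eq_sqrt_inner)
  have "closed {v :: 'a \<times> 'a. norm (snd v) = norm (fst v)}"
    by (intro closed_Collect_eq continuous_intros)
  then have norm_cl: "norm (snd v) = norm (fst v)" if "v \<in> closure S" for v
    using closure_minimal[of S "{v. norm (snd v) = norm (fst v)}"] norm_S that by blast
  have ex: "\<exists>b. (a, b) \<in> closure S" for a
  proof -
    have "fst ` S = span (range e)"
      unfolding S_def using span_linear_image[OF linear_fst, of "range (\<lambda>i. (e i, e' i))"]
      by (simp add: image_image)
    then have "a \<in> closure (fst ` S)" using dense by simp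
    then obtain f where f: "\<And>n. f n \<in> fst ` S" "f \<longlonglongrightarrow> a"
      unfolding closure_sequential by blast
    then have "\<forall>n. \<exists>b. (f n, b) \<in> S" by force
    then obtain g where g: "\<And>n. (f n, g n) \<in> S" by metis
    have eq: "norm (g m - g n) = norm (f m - f n)" for m n
    proof -
      have "(f m, g m) - (f n, g n) \<in> S"
        using g unfolding S_def by (intro span_diff)
      from norm_S[OF this] show ?thesis by simp
    qed
    have "Cauchy f" using f(2) by (rule LIMSEQ_imp_Cauchy)
    then have "Cauchy g" by (simp add: Cauchy_def dist_norm eq)
    then obtain b where "g \<longlonglongrightarrow> b" by (auto simp: Cauchy_convergent_iff convergent_def)
    then have "(\<lambda>n. (f n, g n)) \<longlonglongrightarrow> (a, b)" by (intro tendsto_Pair f)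
    then have "(a, b) \<in> closure S"
      unfolding closure_sequential using g by (intro exI[of _ "\<lambda>n. (f n, g n)"]) simp
    then show ?thesis ..
  qed
  then obtain T where T: "\<And>a. (a, T a) \<in> closure S" by metis
  \<comment> \<open>The difference of two points over the same a is a point of the graph with first
    coordinate 0, so its second coordinate has norm 0.\<close>
  have uniq: "b = T a" if "(a, b) \<in> closure S" for a b
    using norm_cl[OF subspace_diff[OF sub that T[of a]]] by simp
  show ?thesis
  proof
    show "linear T"
    proof
      show "T (a + b) = T a + T b" for a b
        using subspace_add[OF sub T[of a] T[of b]] uniq[of "a + b"] by simp
      show "T (r *\<^sub>R a) = r *\<^sub>R T a" for r a
        using subspace_scale[OF sub T[of a], of r] uniq[of "r *\<^sub>R a"] by simp
    qed
    show "norm (T a) = norm a" for a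
      using norm_cl[OF T[of a]] by simp
    show "T (e i) = e' i" for i
    proof -
      have "(e i, e' i) \<in> closure S"
        unfolding S_def by (intro subsetD[OF closure_subset] span_base) auto
      then show ?thesis using uniq by simp
    qed
  qed
qed

lemma bounded_linear_eq_on_dense:
  assumes "bounded_linear f" "bounded_linear g" "closure (span A) = UNIV"
    and "\<And>a. a \<in> A \<Longrightarrow> f a = g a"
  shows "f v = g v"
proof -
  interpret f: bounded_linear f by fact
  interpret g: bounded_linear g by fact
  have "f a = g a" if "a \<in> span A" for a
    using linear_eq_on[OF f.linear g.linear that] assms(4) by blast
  moreover have "closed {a. f a = g a}"
    by (intro closed_Collect_eq linear_continuous_on assms)
  ultimately have "closure (span A) \<subseteq> {a. f a = g a}"
    by (intro closure_minimal) auto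
  then show ?thesis using assms(3) by auto
qed

lemma linear_isometry_bounded_linear:
  assumes "linear T" "\<And>a. norm (T a) = norm a"
  shows "bounded_linear T"
  using assms by (simp add: bounded_linear_def bounded_linear_axioms_def) (metis mult_1 mult.commute order_refl)

lemma linear_isometry_inner:
  fixes T :: "'a::real_inner \<Rightarrow> 'a"
  assumes "linear T" "\<And>a. norm (T a) = norm a"
  shows "inner (T a) (T b) = inner a b"
proof -
  have "norm (T (a + b)) = norm (a + b)" by (rule assms)
  then show ?thesis
    using assms(2)[of a] assms(2)[of b]
    by (simp add: linear_add[OF assms(1)] norm_eq algebra_simps inner_commute)
qed

section \<open>Coherent states\<close>

lemma has_bochner_integral_cmult:
  fixes f :: "real \<Rightarrow> complex"
  assumes "has_bochner_integral lborel f x"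
  shows "has_bochner_integral lborel (\<lambda>x. c * f x) (c * x)"
  using assms by (rule has_bochner_integral_mult_right)

text \<open>This is the characteristic function of the standard normal distribution with the
  normalising factor cleared.\<close>

lemma has_bochner_integral_gaussian_iexp:
  "has_bochner_integral lborel (\<lambda>x. exp (- (complex_of_real x)\<^sup>2 / 2 + \<i> * t * x))
     (complex_of_real (sqrt (2 * pi)) * exp (- (complex_of_real t)\<^sup>2 / 2))"
proof -
  have eq: "std_normal_density x *\<^sub>R iexp (t * x)
      = complex_of_real (1 / sqrt (2 * pi)) * exp (- (complex_of_real x)\<^sup>2 / 2 + \<i> * t * x)" for x
    by (simp add: std_normal_density_def scaleR_conv_of_real exp_of_real[symmetric] exp_add[symmetric] mult_ac)
  have int: "integrable lborel (\<lambda>x. std_normal_density x *\<^sub>R iexp (t * x))"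
  proof (rule Bochner_Integration.integrable_bound[OF integrable_std_normal_moment[of 0]])
    show "AE x in lborel. norm (std_normal_density x *\<^sub>R iexp (t * x)) \<le> norm (std_normal_density x * x ^ 0)"
      by (simp del: of_real_mult)
  qed simp
  have "(LBINT x. std_normal_density x *\<^sub>R iexp (t * x)) = char std_normal_distribution t"
    unfolding char_def by (subst integral_density) auto
  then have "has_bochner_integral lborel (\<lambda>x. std_normal_density x *\<^sub>R iexp (t * x)) (exp (- (complex_of_real t)\<^sup>2 / 2))"
    using int by (simp add: has_bochner_integral_iff char_std_normal_distribution exp_of_real[symmetric])
  from has_bochner_integral_cmult[OF this, of "complex_of_real (sqrt (2 * pi))"]
  moreover have "complex_of_real (sqrt (2 * pi)) * (std_normal_density x *\<^sub>R iexp (t * x))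
      = exp (- (complex_of_real x)\<^sup>2 / 2 + \<i> * t * x)" for x
    unfolding eq by (simp add: mult.assoc[symmetric])
  ultimately show ?thesis by (simp only:)
qed

text \<open>The real translation x to p + x, with \<open>p = Re b\<close>, cancels the real part of
  the linear term. It leaves the constant \<open>k\<close> and the purely imaginary coefficient
  treated before, so no contour has to be moved.\<close>

lemma has_bochner_integral_gaussian:
  fixes b :: complex
  shows "has_bochner_integral lborel (\<lambda>x. exp (- (complex_of_real x)\<^sup>2 / 2 + b * x))
     (complex_of_real (sqrt (2 * pi)) * exp (b\<^sup>2 / 2))"
proof -
  define p q where "p = Re b" and "q = Im b"
  have b: "b = complex_of_real p + \<i> * complex_of_real q"
    by (simp add: p_def q_def complex_eq)
  define k where "k = exp ((complex_of_real p)\<^sup>2 / 2 + \<i> * p * q)"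
  have "has_bochner_integral lborel (\<lambda>x. k * exp (- (complex_of_real x)\<^sup>2 / 2 + \<i> * q * x))
      (k * (complex_of_real (sqrt (2 * pi)) * exp (- (complex_of_real q)\<^sup>2 / 2)))"
    by (intro has_bochner_integral_cmult has_bochner_integral_gaussian_iexp)
  moreover have "k * exp (- (complex_of_real x)\<^sup>2 / 2 + \<i> * q * x)
      = exp (- (complex_of_real (p + 1 * x))\<^sup>2 / 2 + b * complex_of_real (p + 1 * x))" for x
    unfolding k_def exp_add[symmetric] b
    by (rule arg_cong[of _ _ exp]) (simp add: field_simps power2_eq_square)
  moreover have "k * (complex_of_real (sqrt (2 * pi)) * exp (- (complex_of_real q)\<^sup>2 / 2))
      = complex_of_real (sqrt (2 * pi)) * exp (b\<^sup>2 / 2)"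
  proof -
    have "k * exp (- (complex_of_real q)\<^sup>2 / 2) = exp (b\<^sup>2 / 2)"
      unfolding k_def exp_add[symmetric] b
      by (rule arg_cong[of _ _ exp]) (simp add: field_simps power2_eq_square)
    then show ?thesis by (simp add: mult_ac)
  qed
  ultimately have "has_bochner_integral lborel
      (\<lambda>x. exp (- (complex_of_real (p + 1 * x))\<^sup>2 / 2 + b * complex_of_real (p + 1 * x)))
      ((complex_of_real (sqrt (2 * pi)) * exp (b\<^sup>2 / 2)) /\<^sub>R \<bar>1\<bar>)"
    by (simp only: abs_one inverse_1 scaleR_one)
  then show ?thesis
    by (subst lborel_has_bochner_integral_real_affine_iff[of 1 _ _ p]) auto
qed

text \<open>The generating function of the Hermite functions: \<open>coherent z\<close> is
  \<open>\<Sum>n. z\<^sup>n / n! \<cdot> H\<^sub>n(x) e\<^bsup>-x\<^sup>2/2\<^esup>\<close>, so \<open>e\<^bsup>itH\<^esup>\<close> maps it to \<open>e\<^bsup>it\<^esup>\<close> times the one at \<open>e\<^bsup>2it\<^esup>z\<close>.\<close>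

definition coherent :: "complex \<Rightarrow> real \<Rightarrow> complex" where
  "coherent z x = exp (- (complex_of_real x)\<^sup>2 / 2 + 2 * x * z - z\<^sup>2)"

lemma coherent_measurable [measurable]: "coherent z \<in> borel_measurable borel"
  unfolding coherent_def[abs_def] by (intro borel_measurable_continuous_onI continuous_intros) simp

lemma cnj_coherent: "cnj (coherent z x) = coherent (cnj z) x"
  by (simp add: coherent_def exp_cnj)

text \<open>Kept bilinear, without conjugation: by \<open>cnj_coherent\<close> the Hermitian
  products are the values at \<open>cnj w\<close>.\<close>

lemma has_bochner_integral_coherent_mult:
  "has_bochner_integral lborel (\<lambda>x. coherent z x * coherent w x)
     (complex_of_real (sqrt pi) * exp (2 * z * w))"
proof -
  \<comment> \<open>The dilation by sqrt 2 turns -x^2/2 into the exponent -x^2 of the product;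
    \<open>b\<close> is the coefficient that becomes 2 (z + w) under it.\<close>
  define b where "b = complex_of_real (sqrt 2) * (z + w)"
  have s2: "complex_of_real (sqrt 2) * complex_of_real (sqrt 2) = 2"
    by (simp flip: of_real_mult)
  have s: "(complex_of_real (0 + sqrt 2 * x))\<^sup>2 = 2 * (complex_of_real x)\<^sup>2"
    "b * complex_of_real (0 + sqrt 2 * x) = 2 * (z + w) * x" "b\<^sup>2 = 2 * (z + w)\<^sup>2" for x
    using s2 by (simp_all add: b_def power2_eq_square) (simp_all add: mult_ac mult.assoc[symmetric])
  have "has_bochner_integral lborel (\<lambda>x. exp (- (complex_of_real (0 + sqrt 2 * x))\<^sup>2 / 2 + b * complex_of_real (0 + sqrt 2 * x)))
     ((complex_of_real (sqrt (2 * pi)) * exp (b\<^sup>2 / 2)) /\<^sub>R \<bar>sqrt 2\<bar>)"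
    using has_bochner_integral_gaussian
    by (subst lborel_has_bochner_integral_real_affine_iff[symmetric]) auto
  from has_bochner_integral_cmult[OF this, of "exp (- (z\<^sup>2) - w\<^sup>2)"]
  have "has_bochner_integral lborel (\<lambda>x. exp (- (z\<^sup>2) - w\<^sup>2) * exp (- (complex_of_real (0 + sqrt 2 * x))\<^sup>2 / 2 + b * complex_of_real (0 + sqrt 2 * x)))
     (exp (- (z\<^sup>2) - w\<^sup>2) * ((complex_of_real (sqrt (2 * pi)) * exp (b\<^sup>2 / 2)) /\<^sub>R \<bar>sqrt 2\<bar>))" by simp
  moreover have "exp (- (z\<^sup>2) - w\<^sup>2) * exp (- (complex_of_real (0 + sqrt 2 * x))\<^sup>2 / 2 + b * complex_of_real (0 + sqrt 2 * x))
      = coherent z x * coherent w x" for x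
    unfolding coherent_def exp_add[symmetric] s
    by (rule arg_cong[of _ _ exp]) (simp add: field_simps)
  moreover have "exp (- (z\<^sup>2) - w\<^sup>2) * ((complex_of_real (sqrt (2 * pi)) * exp (b\<^sup>2 / 2)) /\<^sub>R \<bar>sqrt 2\<bar>)
      = complex_of_real (sqrt pi) * exp (2 * z * w)"
  proof -
    have "exp (- (z\<^sup>2) - w\<^sup>2) * exp (b\<^sup>2 / 2) = exp (2 * z * w)"
      unfolding exp_add[symmetric] s
      by (rule arg_cong[of _ _ exp]) (simp add: power2_eq_square algebra_simps)
    moreover have "complex_of_real (sqrt (2 * pi)) /\<^sub>R \<bar>sqrt 2\<bar> = complex_of_real (sqrt pi)"
      by (simp add: scaleR_conv_of_real real_sqrt_mult)
    ultimately show ?thesis by (simp add: scaleR_conv_of_real mult_ac)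
  qed
  ultimately show ?thesis by simp
qed

lemma coherent_L2: "coherent z \<in> L2"
proof -
  have "integrable lborel (\<lambda>x. coherent z x * cnj (coherent z x))"
    unfolding cnj_coherent using has_bochner_integral_coherent_mult by (rule integrable.intros)
  then have "integrable lborel (\<lambda>x. Re (coherent z x * cnj (coherent z x)))"
    by (rule integrable_Re)
  then show ?thesis by (simp add: L2_def complex_norm_square[symmetric] del: of_real_power)
qed

lemma coherent_integrable: "integrable lborel (coherent z)"
  using integrable.intros[OF has_bochner_integral_cmult[OF has_bochner_integral_gaussian[of "2 * z"], of "exp (- (z\<^sup>2))"]]
  by (simp add: coherent_def[abs_def] exp_add[symmetric] algebra_simps)

text \<open>The scalar belongs to the index, so that the real span of the family is already a
  complex subspace and the oscillator group maps the family into itself.\<close>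

definition coherent_state :: "complex \<times> complex \<Rightarrow> L2_class" where
  "coherent_state p = L2_abs (\<lambda>x. fst p * coherent (snd p) x)"

lemma coherent_state_cscale: "coherent_state (c, z) = cscale c (L2_abs (coherent z))"
  by (simp add: coherent_state_def L2_abs_cscale coherent_L2)

lemma inner_coherent_state:
  "inner (coherent_state (c, z)) (coherent_state (d, w))
     = Re (c * cnj d * complex_of_real (sqrt pi) * exp (2 * z * cnj w))"
proof -
  have "inner (coherent_state (c, z)) (coherent_state (d, w)) = (LBINT x. inner (c * coherent z x) (d * coherent w x))"
    by (simp add: coherent_state_def inner_L2_abs L2_cmult coherent_L2)
  also have "\<dots> = (LBINT x. Re (c * cnj d * (coherent z x * coherent (cnj w) x)))"
    by (simp add: inner_complex_eq_Re cnj_coherent mult_ac)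
  also have "\<dots> = Re (LBINT x. c * cnj d * (coherent z x * coherent (cnj w) x))"
    by (intro integral_Re integrable_mult_right integrable.intros[OF has_bochner_integral_coherent_mult])
  also have "\<dots> = Re (c * cnj d * (complex_of_real (sqrt pi) * exp (2 * z * cnj w)))"
    by (simp add: has_bochner_integral_integral_eq[OF has_bochner_integral_coherent_mult])
  finally show ?thesis by (simp add: mult_ac)
qed

text \<open>The positive and negative parts of h have the same mass (a = 0). Normalised by it they
  are densities of two probability measures with equal characteristic functions, which coincide by
  Levy's uniqueness theorem.\<close>

lemma AE_zero_if_fourier_zero_real:
  fixes h :: "real \<Rightarrow> real"
  assumes int: "integrable lborel h"
    and zero: "\<And>a. (LBINT x. complex_of_real (h x) * iexp (a * x)) = 0"
  shows "AE x in lborel. h x = 0"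
proof -
  define hp where "hp x = max 0 (h x)" for x
  define hm where "hm x = max 0 (- h x)" for x
  have [measurable]: "h \<in> borel_measurable borel"
    using borel_measurable_integrable[OF int] by simp
  have [measurable]: "hp \<in> borel_measurable borel" "hm \<in> borel_measurable borel"
    by (auto simp: hp_def[abs_def] hm_def[abs_def])
  have hp: "integrable lborel hp" and hm: "integrable lborel hm"
    using int by (auto simp: hp_def[abs_def] hm_def[abs_def])
  have h: "h x = hp x - hm x" for x by (auto simp: hp_def hm_def)
  have nn: "0 \<le> hp x" "0 \<le> hm x" for x by (auto simp: hp_def hm_def)
  have int_iexp: "integrable lborel (\<lambda>x. complex_of_real (g x) * iexp (a * x))"
    if "integrable lborel g" for g a
  proof (rule Bochner_Integration.integrable_bound[OF that])
    show "(\<lambda>x. complex_of_real (g x) * iexp (a * x)) \<in> borel_measurable lborel"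
      using borel_measurable_integrable[OF that] by simp
  qed (simp add: norm_mult del: of_real_mult)
  have eq: "(LBINT x. complex_of_real (hp x) * iexp (a * x)) = (LBINT x. complex_of_real (hm x) * iexp (a * x))" for a
  proof -
    have "0 = (LBINT x. complex_of_real (hp x) * iexp (a * x) - complex_of_real (hm x) * iexp (a * x))"
      using zero[of a] by (simp add: h algebra_simps)
    also have "\<dots> = (LBINT x. complex_of_real (hp x) * iexp (a * x)) - (LBINT x. complex_of_real (hm x) * iexp (a * x))"
      by (intro Bochner_Integration.integral_diff int_iexp hp hm)
    finally show ?thesis by simp
  qed
  define m where "m = (LBINT x. hp x)"
  have m': "m = (LBINT x. hm x)"
    using eq[of 0] by (simp add: m_def)
  have m0: "m \<ge> 0" unfolding m_def by (simp add: nn)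
  show ?thesis
  \<comment> \<open>Mass 0 cannot be normalised, but then both parts vanish almost
    everywhere.\<close>
  proof (cases "m = 0")
    case True
    have "(LBINT x. hp x) = 0" "(LBINT x. hm x) = 0"
      using True m_def m' by auto
    then have "AE x in lborel. hp x = 0" "AE x in lborel. hm x = 0"
      using hp hm nn by (simp_all add: integral_nonneg_eq_0_iff_AE)
    then show ?thesis by eventually_elim (simp add: h)
  next
    case False
    with m0 have m: "m > 0" by simp
    define D where "D g = density lborel (\<lambda>x. ennreal (g x / m))" for g :: "real \<Rightarrow> real"
    have D: "real_distribution (D g) \<and> char (D g) a = (LBINT x. complex_of_real (g x) * iexp (a * x)) / m"
      if g: "integrable lborel g" "\<And>x. 0 \<le> g x" "m = (LBINT x. g x)" for g a
    proof
      have [measurable]: "g \<in> borel_measurable borel"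
        using borel_measurable_integrable[OF g(1)] by simp
      have "(\<integral>\<^sup>+ x. ennreal (g x / m) \<partial>lborel) = ennreal (LBINT x. g x / m)"
        using g m by (intro nn_integral_eq_integral) auto
      also have "(LBINT x. g x / m) = 1" using g(3) m by simp
      finally have "prob_space (D g)"
        by (intro prob_spaceI) (simp add: D_def emeasure_density)
      then show "real_distribution (D g)"
        by (simp add: real_distribution_def real_distribution_axioms_def D_def)
      have "char (D g) a = (LBINT x. (g x / m) *\<^sub>R iexp (a * x))"
        unfolding char_def D_def using g m by (intro integral_density) auto
      also have "\<dots> = (LBINT x. (complex_of_real (g x) * iexp (a * x)) / complex_of_real m)"
        by (simp add: scaleR_conv_of_real)
      finally show "char (D g) a = (LBINT x. complex_of_real (g x) * iexp (a * x)) / m"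
        by simp
    qed
    have "char (D hp) = char (D hm)"
      using D[OF hp nn(1) m_def] D[OF hm nn(2) m'] eq by (intro ext) simp
    then have "D hp = D hm"
      using D[OF hp nn(1) m_def] D[OF hm nn(2) m'] Levy_uniqueness by blast
    then have "AE x in lborel. ennreal (hp x / m) = ennreal (hm x / m)"
      unfolding D_def by (subst (asm) sigma_finite_measure.density_unique_iff[OF sigma_finite_lborel]) auto
    then show ?thesis
      by eventually_elim (use m nn in \<open>simp add: h\<close>)
  qed
qed

text \<open>Conjugation reflects the frequency, so the transform of the conjugate of h vanishes as
  well, and with it those of the real and imaginary parts.\<close>

lemma AE_zero_if_fourier_zero:
  fixes h :: "real \<Rightarrow> complex"
  assumes int: "integrable lborel h"
    and zero: "\<And>a. (LBINT x. h x * iexp (a * x)) = 0"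
  shows "AE x in lborel. h x = 0"
proof -
  have bd: "integrable lborel (\<lambda>x. k x * iexp (a * x))" if "integrable lborel k" for k :: "real \<Rightarrow> complex" and a
  proof (rule Bochner_Integration.integrable_bound[OF that])
    show "(\<lambda>x. k x * iexp (a * x)) \<in> borel_measurable lborel"
      using borel_measurable_integrable[OF that] by simp
  qed (simp add: norm_mult del: of_real_mult)
  have cnj0: "(LBINT x. cnj (h x) * iexp (a * x)) = 0" for a
  proof -
    have "cnj (h x) * iexp (a * x) = cnj (h x * iexp (- a * x))" for x
      by (simp add: exp_cnj)
    then have "(LBINT x. cnj (h x) * iexp (a * x)) = cnj (LBINT x. h x * iexp (- a * x))"
      using Bochner_Integration.integral_cnj[of lborel "\<lambda>x. h x * iexp (- a * x)"] by (simp only:)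
    then show ?thesis using zero[of "- a"] by simp
  qed
  have cnj: "integrable lborel (\<lambda>x. cnj (h x))" using int by simp
  have Re: "AE x in lborel. Re (h x) = 0"
  proof (rule AE_zero_if_fourier_zero_real)
    show "integrable lborel (\<lambda>x. Re (h x))" using int by simp
    fix a
    have *: "complex_of_real (Re z) = (z + cnj z) / 2" for z
      by (simp add: complex_add_cnj)
    have "(LBINT x. complex_of_real (Re (h x)) * iexp (a * x))
        = (LBINT x. (h x * iexp (a * x) + cnj (h x) * iexp (a * x)) / 2)"
      by (intro Bochner_Integration.integral_cong refl) (simp only: * distrib_right[symmetric] times_divide_eq_left)
    also have "\<dots> = (LBINT x. h x * iexp (a * x) + cnj (h x) * iexp (a * x)) / 2" by simp
    also have "\<dots> = 0"
      by (subst Bochner_Integration.integral_add) (use int cnj zero cnj0 in \<open>auto intro!: bd simp del: of_real_mult\<close>)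
    finally show "(LBINT x. complex_of_real (Re (h x)) * iexp (a * x)) = 0" .
  qed
  have Im: "AE x in lborel. Im (h x) = 0"
  proof (rule AE_zero_if_fourier_zero_real)
    show "integrable lborel (\<lambda>x. Im (h x))" using int by simp
    fix a
    have *: "complex_of_real (Im z) = (z - cnj z) / (2 * \<i>)" for z
      by (simp add: complex_diff_cnj field_simps)
    have "(LBINT x. complex_of_real (Im (h x)) * iexp (a * x))
        = (LBINT x. (h x * iexp (a * x) - cnj (h x) * iexp (a * x)) / (2 * \<i>))"
      by (intro Bochner_Integration.integral_cong refl) (simp only: * left_diff_distrib[symmetric] times_divide_eq_left)
    also have "\<dots> = (LBINT x. h x * iexp (a * x) - cnj (h x) * iexp (a * x)) / (2 * \<i>)" by (rule integral_divide_zero)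
    also have "\<dots> = 0"
      by (subst Bochner_Integration.integral_diff) (use int cnj zero cnj0 in \<open>auto intro!: bd simp del: of_real_mult\<close>)
    finally show "(LBINT x. complex_of_real (Im (h x)) * iexp (a * x)) = 0" .
  qed
  show ?thesis using Re Im by eventually_elim (simp add: complex_eq_iff)
qed

text \<open>Up to a constant, \<open>coherent 0 x * iexp (a * x)\<close> is a coherent state with
  the imaginary parameter i a/2, so orthogonality says that the Fourier transform of q times the
  Gaussian vanishes. Only this product is assumed integrable: the lemma is later applied to a
  Fourier integral that is so far known only to be bounded.\<close>

lemma AE_zero_if_orthogonal_coherent:
  assumes int: "integrable lborel (\<lambda>x. q x * coherent 0 x)"
    and zero: "\<And>z. (LBINT x. q x * cnj (coherent z x)) = 0"
  shows "AE x in lborel. q x = 0"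
proof -
  have "AE x in lborel. q x * coherent 0 x = 0"
  proof (rule AE_zero_if_fourier_zero[OF int])
    fix a :: real
    have *: "coherent 0 x * iexp (a * x) = exp ((\<i> * a / 2)\<^sup>2) * cnj (coherent (- \<i> * a / 2) x)" for x
      unfolding cnj_coherent unfolding coherent_def exp_add[symmetric]
      by (rule arg_cong[of _ _ exp]) simp
    have "q x * coherent 0 x * iexp (a * x) = exp ((\<i> * a / 2)\<^sup>2) * (q x * cnj (coherent (- \<i> * a / 2) x))" for x
      using *[of x] by algebra
    then have "(LBINT x. q x * coherent 0 x * iexp (a * x)) = exp ((\<i> * a / 2)\<^sup>2) * (LBINT x. q x * cnj (coherent (- \<i> * a / 2) x))"
      by (simp only: integral_mult_right_zero)
    then show "(LBINT x. q x * coherent 0 x * iexp (a * x)) = 0" by (simp add: zero)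
  qed
  then show ?thesis by (simp add: coherent_def)
qed

lemma coherent_state_dense: "closure (span (range coherent_state)) = UNIV"
proof (rule dense_span_if_orthogonal_trivial)
  fix v :: L2_class
  assume orth: "\<And>a. a \<in> range coherent_state \<Longrightarrow> inner v a = 0"
  have "AE x in lborel. L2_rep v x = 0"
  proof (rule AE_zero_if_orthogonal_coherent)
    show "integrable lborel (\<lambda>x. L2_rep v x * coherent 0 x)"
      by (intro L2_integrable_mult coherent_L2) simp
    have "(LBINT x. L2_rep v x * cnj (coherent z x)) = (LBINT x. 0 * cnj (coherent z x))" for z
      by (rule integral_mult_cnj_eq_if_inner_eq)
        (auto simp: coherent_L2 L2_zero orth L2_abs_zero coherent_state_cscale[symmetric])
    then show "(LBINT x. L2_rep v x * cnj (coherent z x)) = 0" for z by simp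
  qed
  then have "L2_abs (L2_rep v) = L2_abs (\<lambda>x. 0)"
    by (subst L2_abs_eq_iff) (auto simp: L2_zero)
  then show "v = 0" by (simp add: L2_abs_zero)
qed

section \<open>The oscillator group\<close>

definition L2_isometry :: "((real \<Rightarrow> complex) \<Rightarrow> real \<Rightarrow> complex) \<Rightarrow> bool" where
  "L2_isometry A \<longleftrightarrow> (\<forall>f\<in>L2. A f \<in> L2 \<and> L2_norm (A f) = L2_norm f) \<and>
     (\<forall>a b. \<forall>f\<in>L2. \<forall>g\<in>L2.
        AE x in lborel. A (\<lambda>y. a * f y + b * g y) x = a * A f x + b * A g x)"

definition L2_lift :: "((real \<Rightarrow> complex) \<Rightarrow> real \<Rightarrow> complex) \<Rightarrow> L2_class \<Rightarrow> L2_class" where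
  "L2_lift A a = L2_abs (A (L2_rep a))"

lemma L2_isometry_in: "L2_isometry A \<Longrightarrow> f \<in> L2 \<Longrightarrow> A f \<in> L2"
  by (simp add: L2_isometry_def)

lemma L2_isometry_abs_lincomb:
  assumes A: "L2_isometry A" and f: "f \<in> L2" and g: "g \<in> L2"
  shows "L2_abs (A (\<lambda>y. a * f y + b * g y)) = cscale a (L2_abs (A f)) + cscale b (L2_abs (A g))"
proof -
  have "L2_abs (A (\<lambda>y. a * f y + b * g y)) = L2_abs (\<lambda>x. a * A f x + b * A g x)"
    using A f g unfolding L2_isometry_def
    by (subst L2_abs_eq_iff) (auto intro!: L2_add L2_cmult)
  then show ?thesis
    using L2_isometry_in[OF A] f g by (simp add: L2_abs_cscale L2_abs_add L2_cmult)
qed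

text \<open>The definition of \<open>L2_isometry\<close> does not mention almost everywhere equal
  arguments. That they have equal images follows from linearity and norm preservation, applied to f
  - g, which has norm 0.\<close>

lemma L2_isometry_abs_cong:
  assumes A: "L2_isometry A" and f: "f \<in> L2" and g: "g \<in> L2" and eq: "L2_abs f = L2_abs g"
  shows "L2_abs (A f) = L2_abs (A g)"
proof -
  have d: "(\<lambda>y. 1 * f y + (-1) * g y) \<in> L2"
    using f g by (intro L2_add L2_cmult)
  have "norm (L2_abs (A f) - L2_abs (A g)) = norm (L2_abs (A (\<lambda>y. 1 * f y + (-1) * g y)))"
    unfolding L2_isometry_abs_lincomb[OF A f g]
    using cscale_of_real[of "-1"] by (simp add: cscale_1)
  also have "\<dots> = L2_norm (\<lambda>y. f y - g y)"
    using A d by (simp add: norm_L2_abs L2_isometry_def)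
  also have "\<dots> = norm (L2_abs f - L2_abs g)"
    by (rule L2_norm_diff[OF f g])
  finally have "norm (L2_abs (A f) - L2_abs (A g)) = 0" unfolding eq by simp
  then show ?thesis by simp
qed

lemma L2_lift_abs:
  assumes "L2_isometry A" "f \<in> L2"
  shows "L2_lift A (L2_abs f) = L2_abs (A f)"
  unfolding L2_lift_def by (rule L2_isometry_abs_cong[OF assms(1) L2_rep_in assms(2)]) simp

lemma L2_lift_cscale:
  assumes A: "L2_isometry A"
  shows "L2_lift A (cscale c a) = cscale c (L2_lift A a)"
proof -
  \<comment> \<open>Linearity is stated for combinations of two functions, hence the second term
    with coefficient 0.\<close>
  have "cscale c a = L2_abs (\<lambda>x. c * L2_rep a x + 0 * L2_rep a x)"
    using L2_abs_cscale[of "L2_rep a" c] by simp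
  then have "L2_lift A (cscale c a) = cscale c (L2_abs (A (L2_rep a))) + cscale 0 (L2_abs (A (L2_rep a)))"
    by (simp only: L2_lift_abs[OF A] L2_add L2_cmult L2_rep_in L2_isometry_abs_lincomb[OF A])
  then show ?thesis using cscale_of_real[of 0] by (simp add: L2_lift_def)
qed

lemma L2_lift_linear:
  assumes A: "L2_isometry A"
  shows "linear (L2_lift A)"
proof
  show "L2_lift A (a + b) = L2_lift A a + L2_lift A b" for a b
  proof -
    have "a + b = L2_abs (\<lambda>x. 1 * L2_rep a x + 1 * L2_rep b x)"
      using L2_abs_add[of "L2_rep a" "L2_rep b"] by simp
    then have "L2_lift A (a + b) = cscale 1 (L2_abs (A (L2_rep a))) + cscale 1 (L2_abs (A (L2_rep b)))"
      by (simp only: L2_lift_abs[OF A] L2_add L2_cmult L2_rep_in L2_isometry_abs_lincomb[OF A])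
    then show ?thesis by (simp add: L2_lift_def cscale_1)
  qed
  show "L2_lift A (r *\<^sub>R a) = r *\<^sub>R L2_lift A a" for r a
    using L2_lift_cscale[OF A, of "complex_of_real r"] by (simp add: cscale_of_real)
qed

lemma norm_L2_lift:
  assumes "L2_isometry A"
  shows "norm (L2_lift A a) = norm a"
  using assms unfolding L2_lift_def
  by (simp add: norm_L2_abs L2_isometry_def norm_eq_L2_norm_rep[of a])

lemma bounded_linear_L2_lift: "L2_isometry A \<Longrightarrow> bounded_linear (L2_lift A)"
  by (intro linear_isometry_bounded_linear L2_lift_linear norm_L2_lift)

lemma bounded_linear_cscale: "bounded_linear (cscale c)"
proof -
  interpret linear "cscale c" by (rule cscale_linear)
  show ?thesis
    by standard (auto simp: norm_cscale mult.commute intro!: exI[of _ "norm c"])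
qed

text \<open>Both phases are unimodular and cancel in the Gram matrix, which depends only on
  \<open>c * cnj d\<close> and \<open>z * cnj w\<close>; so \<open>isometry_extension\<close>
  applies.\<close>

lemma ex_oscillator_group:
  "\<exists>T. linear T \<and> (\<forall>a. norm (T a) = norm a) \<and>
     (\<forall>c z. T (coherent_state (c, z)) = coherent_state (cis t * c, cis (2 * t) * z))"
proof -
  define e' where "e' p = coherent_state (cis t * fst p, cis (2 * t) * snd p)" for p
  have cis: "cis s * cnj (cis s) = 1" for s
    by (simp add: cis_cnj cis_mult)
  have "inner (e' p) (e' q) = inner (coherent_state p) (coherent_state q)" for p q
  proof -
    have "cis t * fst p * cnj (cis t * fst q) = fst p * cnj (fst q)"
      "2 * (cis (2 * t) * snd p) * cnj (cis (2 * t) * snd q) = 2 * snd p * cnj (snd q)"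
      using cis[of t] cis[of "2 * t"] unfolding complex_cnj_mult by algebra+
    then show ?thesis
      unfolding e'_def by (cases p; cases q) (simp only: inner_coherent_state fst_conv snd_conv)
  qed
  from isometry_extension[of e' coherent_state, OF this coherent_state_dense]
  obtain T where "linear T" "\<And>a. norm (T a) = norm a" "\<And>p. T (coherent_state p) = e' p" by metis
  then show ?thesis by (intro exI[of _ T]) (simp add: e'_def)
qed

definition oscillator_group :: "real \<Rightarrow> L2_class \<Rightarrow> L2_class" where
  "oscillator_group t = (SOME T. linear T \<and> (\<forall>a. norm (T a) = norm a) \<and>
     (\<forall>c z. T (coherent_state (c, z)) = coherent_state (cis t * c, cis (2 * t) * z)))"

lemma oscillator_group_linear: "linear (oscillator_group t)"
  and norm_oscillator_group: "norm (oscillator_group t a) = norm a"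
  and oscillator_group_coherent:
    "oscillator_group t (coherent_state (c, z)) = coherent_state (cis t * c, cis (2 * t) * z)"
  using someI_ex[OF ex_oscillator_group[of t]] unfolding oscillator_group_def by blast+

lemma bounded_linear_oscillator_group: "bounded_linear (oscillator_group t)"
  by (intro linear_isometry_bounded_linear oscillator_group_linear norm_oscillator_group)

text \<open>Reduces every operator identity below to a computation with coherent states.\<close>

lemma bounded_linear_eq_on_coherent:
  assumes "bounded_linear S" "bounded_linear T"
    and "\<And>c z. S (coherent_state (c, z)) = T (coherent_state (c, z))"
  shows "S a = T a"
proof (rule bounded_linear_eq_on_dense[OF assms(1,2) coherent_state_dense])
  show "S p = T p" if "p \<in> range coherent_state" for p
    using that assms(3) by auto
qed

lemma oscillator_group_add:
  "oscillator_group (s + t) a = oscillator_group s (oscillator_group t a)"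
proof (rule bounded_linear_eq_on_coherent[where T = "\<lambda>a. oscillator_group s (oscillator_group t a)"])
  show "bounded_linear (\<lambda>a. oscillator_group s (oscillator_group t a))"
    by (rule bounded_linear_compose[OF bounded_linear_oscillator_group bounded_linear_oscillator_group])
qed (simp_all add: bounded_linear_oscillator_group oscillator_group_coherent
    mult.assoc[symmetric] cis_mult distrib_left)

lemma oscillator_group_0: "oscillator_group 0 a = a"
  by (rule bounded_linear_eq_on_coherent[where T = "\<lambda>a. a"])
    (simp_all add: bounded_linear_oscillator_group bounded_linear_ident oscillator_group_coherent)

lemma oscillator_group_cscale: "oscillator_group t (cscale c a) = cscale c (oscillator_group t a)"
proof (rule bounded_linear_eq_on_coherent[where a = a])
  show "bounded_linear (\<lambda>a. oscillator_group t (cscale c a))"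
    "bounded_linear (\<lambda>a. cscale c (oscillator_group t a))"
    by (rule bounded_linear_compose[OF bounded_linear_oscillator_group bounded_linear_cscale]
        bounded_linear_compose[OF bounded_linear_cscale bounded_linear_oscillator_group])+
  have "cscale c (coherent_state (d, z)) = coherent_state (c * d, z)" for d z
    by (simp add: coherent_state_cscale cscale_cscale)
  then show "oscillator_group t (cscale c (coherent_state (d, z)))
      = cscale c (oscillator_group t (coherent_state (d, z)))" for d z
    by (simp add: oscillator_group_coherent mult_ac)
qed

lemma inner_oscillator_group:
  "inner (oscillator_group t a) (oscillator_group t b) = inner a b"
  by (intro linear_isometry_inner oscillator_group_linear norm_oscillator_group)

lemma inner_oscillator_group_left:
  "inner (oscillator_group t a) b = inner a (oscillator_group (- t) b)"
  using inner_oscillator_group[of "- t" "oscillator_group t a" b]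
  by (simp add: oscillator_group_add[symmetric] oscillator_group_0)

text \<open>For an isometry the squared displacement is twice the squared norm minus twice an inner
  product, and here that inner product is an explicit continuous function of t.\<close>

lemma oscillator_group_tendsto_coherent:
  "((\<lambda>t. oscillator_group t (coherent_state (c, z))) \<longlongrightarrow> coherent_state (c, z)) (at 0)"
proof -
  define p where "p = coherent_state (c, z)"
  have eq: "(norm (oscillator_group t p - p))\<^sup>2 = 2 * (norm p)\<^sup>2
      - 2 * Re (cis t * c * cnj c * complex_of_real (sqrt pi) * exp (2 * (cis (2 * t) * z) * cnj z))" for t
  proof -
    have "(norm (oscillator_group t p - p))\<^sup>2 = (norm (oscillator_group t p))\<^sup>2 + (norm p)\<^sup>2 - 2 * inner (oscillator_group t p) p"
      by (simp add: power2_norm_eq_inner inner_diff_left inner_diff_right inner_commute)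
    then show ?thesis
      by (simp add: norm_oscillator_group)
        (simp add: p_def oscillator_group_coherent inner_coherent_state)
  qed
  define r where "r t = 2 * (norm p)\<^sup>2
      - 2 * Re (cis t * c * cnj c * complex_of_real (sqrt pi) * exp (2 * (cis (2 * t) * z) * cnj z))" for t
  have "(r \<longlongrightarrow> r 0) (at 0)"
    unfolding r_def cis_conv_exp by (intro tendsto_intros)
  moreover have "r = (\<lambda>t. (norm (oscillator_group t p - p))\<^sup>2)"
    by (simp add: r_def eq fun_eq_iff)
  ultimately have "((\<lambda>t. (norm (oscillator_group t p - p))\<^sup>2) \<longlongrightarrow> 0) (at 0)"
    by (simp only: oscillator_group_0) simp
  then have "((\<lambda>t. sqrt ((norm (oscillator_group t p - p))\<^sup>2)) \<longlongrightarrow> sqrt 0) (at 0)"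
    by (rule tendsto_real_sqrt)
  then show ?thesis
    by (simp add: p_def tendsto_norm_zero_iff LIM_zero_iff)
qed

text \<open>Continuity passes from the dense span to all vectors because the operators are
  isometries: an approximation error e/3 stays e/3 under the evolution.\<close>

lemma oscillator_group_tendsto: "((\<lambda>t. oscillator_group t a) \<longlongrightarrow> a) (at 0)"
proof (rule tendstoI)
  fix e :: real assume e: "e > 0"
  have span: "((\<lambda>t. oscillator_group t b) \<longlongrightarrow> b) (at 0)" if "b \<in> span (range coherent_state)" for b
    using that
  proof (induction rule: span_induct)
    show "subspace {b. ((\<lambda>t. oscillator_group t b) \<longlongrightarrow> b) (at 0)}"
      by (auto intro!: subspaceI tendsto_add tendsto_scaleR
          simp: linear_0[OF oscillator_group_linear] linear_add[OF oscillator_group_linear]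
            linear_cmul[OF oscillator_group_linear])
  qed (auto intro!: oscillator_group_tendsto_coherent)
  have "a \<in> closure (span (range coherent_state))" by (simp add: coherent_state_dense)
  then obtain b where b: "b \<in> span (range coherent_state)" "dist b a < e / 3"
    using e by (auto simp: closure_approachable dest!: spec[of _ "e/3"])
  have "\<forall>\<^sub>F t in at 0. dist (oscillator_group t b) b < e / 3"
    using tendstoD[OF span[OF b(1)], of "e/3"] e by simp
  then show "\<forall>\<^sub>F t in at 0. dist (oscillator_group t a) a < e"
  proof eventually_elim
    fix t assume t: "dist (oscillator_group t b) b < e / 3"
    have "dist (oscillator_group t a) (oscillator_group t b) = dist a b"
      unfolding dist_norm linear_diff[OF oscillator_group_linear, symmetric] norm_oscillator_group ..
    then show "dist (oscillator_group t a) a < e"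
      using t b(2) dist_triangle[of "oscillator_group t a" a "oscillator_group t b"]
        dist_triangle[of "oscillator_group t b" a b]
      by (simp add: dist_commute)
  qed
qed

section \<open>Schwartz functions\<close>

lemma nth_vector_derivative_0 [simp]: "nth_vector_derivative 0 f = f"
  by (simp add: nth_vector_derivative_def)

lemma nth_vector_derivative_Suc:
  "nth_vector_derivative (Suc n) f x = vector_derivative (nth_vector_derivative n f) (at x)"
  by (simp add: nth_vector_derivative_def)

lemma schwartz_has_vector_derivative:
  assumes "f \<in> schwartz"
  shows "(nth_vector_derivative n f has_vector_derivative nth_vector_derivative (Suc n) f x) (at x)"
  using assms by (simp add: schwartz_def nth_vector_derivative_Suc vector_derivative_works[symmetric])

lemma schwartz_continuous:
  assumes "f \<in> schwartz"
  shows "continuous_on A (nth_vector_derivative n f)"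
  using has_vector_derivative_continuous[OF schwartz_has_vector_derivative[OF assms]]
  by (simp add: continuous_at_imp_continuous_on)

lemma schwartz_bound:
  assumes "f \<in> schwartz"
  obtains C where "\<And>x. \<bar>x\<bar> ^ k * norm (nth_vector_derivative n f x) \<le> C"
proof -
  have "bounded (range (\<lambda>x. x ^ k *\<^sub>R nth_vector_derivative n f x))"
    using assms by (simp add: schwartz_def)
  then show ?thesis by (auto simp: bounded_iff power_abs intro: that)
qed

lemma integrable_lborel_inverse_1_plus_square: "integrable lborel (\<lambda>x::real. inverse (1 + x\<^sup>2))"
proof -
  have "einterval (-\<infinity>) \<infinity> = UNIV" by (auto simp: einterval_def)
  then show ?thesis using Sinc_Integral.integrable_inverse_1_plus_square by (simp add: set_integrable_def)
qed

text \<open>In the square of |g|, one factor is at most B and the other at most (B + C)/(1 +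
  x^2).\<close>

lemma L2_if_decay:
  assumes [measurable]: "g \<in> borel_measurable borel"
    and B: "\<And>x. norm (g x) \<le> B" "\<And>x. x\<^sup>2 * norm (g x) \<le> C"
  shows "g \<in> L2"
proof -
  have "integrable lborel (\<lambda>x. (norm (g x))\<^sup>2)"
  proof (rule Bochner_Integration.integrable_bound)
    show "integrable lborel (\<lambda>x. B * (B + C) * inverse (1 + x\<^sup>2))"
      by (intro integrable_mult_right integrable_lborel_inverse_1_plus_square)
    have "(norm (g x))\<^sup>2 \<le> B * (B + C) * inverse (1 + x\<^sup>2)" for x
    proof -
      have pos: "0 < 1 + x\<^sup>2" by (simp add: add_pos_nonneg)
      have "norm (g x) * (1 + x\<^sup>2) \<le> B + C"
        using B[of x] by (simp add: algebra_simps)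
      then have "norm (g x) \<le> (B + C) * inverse (1 + x\<^sup>2)"
        using pos by (simp add: field_simps)
      then have "norm (g x) * norm (g x) \<le> B * ((B + C) * inverse (1 + x\<^sup>2))"
        using B(1)[of x] by (intro mult_mono) (auto intro: order_trans[OF norm_ge_zero])
      then show ?thesis by (simp add: power2_eq_square mult_ac)
    qed
    then show "AE x in lborel. norm ((norm (g x))\<^sup>2) \<le> norm (B * (B + C) * inverse (1 + x\<^sup>2))"
      by (intro AE_I2) (simp, metis abs_ge_self order_trans)
  qed simp
  then show ?thesis by (simp add: L2_def)
qed

lemma schwartz_mult_L2:
  assumes f: "f \<in> schwartz"
  shows "(\<lambda>x. complex_of_real (x ^ k) * nth_vector_derivative n f x) \<in> L2"
proof -
  obtain B where B: "\<And>x. \<bar>x\<bar> ^ k * norm (nth_vector_derivative n f x) \<le> B"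
    using schwartz_bound[OF f] by blast
  obtain C where C: "\<And>x. \<bar>x\<bar> ^ (k + 2) * norm (nth_vector_derivative n f x) \<le> C"
    using schwartz_bound[OF f] by blast
  show ?thesis
  proof (rule L2_if_decay)
    show "(\<lambda>x. complex_of_real (x ^ k) * nth_vector_derivative n f x) \<in> borel_measurable borel"
      by (intro borel_measurable_continuous_onI continuous_intros schwartz_continuous f)
    show "norm (complex_of_real (x ^ k) * nth_vector_derivative n f x) \<le> B" for x
      using B[of x] by (simp add: norm_mult norm_power)
    show "x\<^sup>2 * norm (complex_of_real (x ^ k) * nth_vector_derivative n f x) \<le> C" for x
      using C[of x] by (simp add: norm_mult norm_power power2_eq_square mult_ac)
  qed
qed

lemma schwartz_deriv_L2: "f \<in> schwartz \<Longrightarrow> nth_vector_derivative n f \<in> L2"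
  using schwartz_mult_L2[of f 0 n] by simp

lemma schwartz_L2: "f \<in> schwartz \<Longrightarrow> f \<in> L2"
  using schwartz_deriv_L2[of f 0] by simp

lemma harmonic_op_L2:
  assumes "f \<in> schwartz"
  shows "harmonic_op f \<in> L2"
  unfolding harmonic_op_def[abs_def]
  using L2_add[OF L2_minus[OF schwartz_deriv_L2[OF assms, of 2]] schwartz_mult_L2[OF assms, of 2 0]]
  by simp

lemma schwartz_tendsto_0:
  assumes f: "f \<in> schwartz"
  shows "(nth_vector_derivative n f \<longlongrightarrow> 0) at_infinity"
proof -
  obtain C where C: "\<And>x. \<bar>x\<bar> ^ 1 * norm (nth_vector_derivative n f x) \<le> C"
    using schwartz_bound[OF f] by blast
  have "((\<lambda>x::real. C * norm (inverse x)) \<longlongrightarrow> C * norm (0::real)) at_infinity"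
    by (rule tendsto_mult[OF tendsto_const tendsto_norm[OF tendsto_inverse_0]])
  then have "((\<lambda>x::real. C * norm (inverse x)) \<longlongrightarrow> 0) at_infinity" by simp
  moreover have "\<forall>\<^sub>F x in at_infinity. norm (nth_vector_derivative n f x) \<le> C * norm (inverse x)"
    unfolding eventually_at_infinity
  proof (intro exI[of _ 1] allI impI)
    fix x :: real assume "1 \<le> norm x"
    then have "0 < \<bar>x\<bar>" by simp
    then show "norm (nth_vector_derivative n f x) \<le> C * norm (inverse x)"
      using C[of x] by (simp add: field_simps)
  qed
  ultimately show ?thesis by (rule Lim_null_comparison[rotated])
qed

text \<open>Green's identity: the Wronskian \<open>W\<close> tends to 0 at both ends, so its
  derivative \<open>w\<close> has integral 0, while multiplication by x^2 is symmetric
  pointwise.\<close>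

lemma harmonic_op_symmetric:
  assumes f: "f \<in> schwartz" and g: "g \<in> schwartz"
  shows "inner (L2_abs (harmonic_op f)) (L2_abs g) = inner (L2_abs f) (L2_abs (harmonic_op g))"
proof -
  define f' f'' where "f' = nth_vector_derivative 1 f" and "f'' = nth_vector_derivative 2 f"
  define g' g'' where "g' = nth_vector_derivative 1 g" and "g'' = nth_vector_derivative 2 g"
  have 2: "2 = Suc 1" by simp
  have fd: "(f has_vector_derivative f' x) (at x)" "(f' has_vector_derivative f'' x) (at x)"
    and gd: "(g has_vector_derivative g' x) (at x)" "(g' has_vector_derivative g'' x) (at x)" for x
    using schwartz_has_vector_derivative[OF f, of 0] schwartz_has_vector_derivative[OF f, of 1]
      schwartz_has_vector_derivative[OF g, of 0] schwartz_has_vector_derivative[OF g, of 1]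
    by (simp_all add: f'_def f''_def g'_def g''_def 2)
  define W where "W x = inner (f x) (g' x) - inner (f' x) (g x)" for x
  define w where "w x = inner (f x) (g'' x) - inner (f'' x) (g x)" for x
  have Ww: "(W has_vector_derivative w x) (at x)" for x
  proof -
    have "((\<lambda>x. inner (f x) (g' x)) has_vector_derivative (inner (f x) (g'' x) + inner (f' x) (g' x))) (at x)"
      "((\<lambda>x. inner (f' x) (g x)) has_vector_derivative (inner (f' x) (g' x) + inner (f'' x) (g x))) (at x)"
      by (rule bounded_bilinear.has_vector_derivative[OF bounded_bilinear_inner] fd gd)+
    from has_vector_derivative_diff[OF this] show ?thesis
      by (simp add: W_def[abs_def] w_def)
  qed
  have cont: "continuous_on UNIV w"
    unfolding w_def[abs_def] f''_def g''_def
    using schwartz_continuous[OF f, of UNIV 0] schwartz_continuous[OF g, of UNIV 0]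
    by (intro continuous_intros schwartz_continuous f g) auto
  have int: "integrable lborel (\<lambda>x. inner (f x) (g'' x))" "integrable lborel (\<lambda>x. inner (f'' x) (g x))"
    unfolding f''_def g''_def
    using L2_integrable_inner[OF schwartz_L2[OF f] schwartz_deriv_L2[OF g, of 2]]
      L2_integrable_inner[OF schwartz_deriv_L2[OF f, of 2] schwartz_L2[OF g]] by auto
  then have intw: "integrable lborel w"
    by (simp add: w_def[abs_def])
  have "((\<lambda>x. inner (f x) (g' x) - inner (f' x) (g x)) \<longlongrightarrow> inner 0 0 - inner 0 0) at_infinity"
    using tendsto_diff[OF tendsto_inner[OF schwartz_tendsto_0[OF f, of 0] schwartz_tendsto_0[OF g, of 1]]
        tendsto_inner[OF schwartz_tendsto_0[OF f, of 1] schwartz_tendsto_0[OF g, of 0]]]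
    by (simp add: f'_def g'_def)
  then have lim: "(W \<longlongrightarrow> 0) at_infinity" by (simp add: W_def[abs_def])
  have U: "einterval (-\<infinity>) \<infinity> = UNIV" by (auto simp: einterval_def)
  have "(LBINT x=-\<infinity>..\<infinity>. w x) = 0 - 0"
  proof (rule interval_integral_FTC_integrable)
    show "isCont w x" for x using cont by (simp add: continuous_on_eq_continuous_at)
    show "set_integrable lborel (einterval (-\<infinity>) \<infinity>) w"
      using intw by (simp add: U set_integrable_def)
    show "((W \<circ> real_of_ereal) \<longlongrightarrow> 0) (at_right (- \<infinity>))" "((W \<circ> real_of_ereal) \<longlongrightarrow> 0) (at_left \<infinity>)"
      unfolding ereal_tendsto_simps
      using lim by (auto intro: filterlim_mono[OF _ order_refl] at_top_le_at_infinity at_bot_le_at_infinity)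
  qed (auto intro: Ww)
  then have "(LBINT x. w x) = 0"
    by (simp add: interval_lebesgue_integral_def U set_lebesgue_integral_def)
  then have eq: "(LBINT x. inner (f x) (g'' x)) = (LBINT x. inner (f'' x) (g x))"
    using int by (simp add: w_def[abs_def])
  have x2: "(\<lambda>x. complex_of_real (x\<^sup>2) * f x) \<in> L2" "(\<lambda>x. complex_of_real (x\<^sup>2) * g x) \<in> L2"
    using schwartz_mult_L2[OF f, of 2 0] schwartz_mult_L2[OF g, of 2 0] by simp_all
  have i1: "(LBINT x. inner (harmonic_op f x) (g x))
      = (LBINT x. inner (complex_of_real (x\<^sup>2) * f x) (g x)) - (LBINT x. inner (f'' x) (g x))"
  proof -
    have "inner (harmonic_op f x) (g x) = inner (complex_of_real (x\<^sup>2) * f x) (g x) - inner (f'' x) (g x)" for x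
      by (simp add: harmonic_op_def f''_def inner_add_left inner_diff_left del: of_real_power)
    then show ?thesis
      using int L2_integrable_inner[OF x2(1) schwartz_L2[OF g]] by simp
  qed
  have i2: "(LBINT x. inner (f x) (harmonic_op g x))
      = (LBINT x. inner (f x) (complex_of_real (x\<^sup>2) * g x)) - (LBINT x. inner (f x) (g'' x))"
  proof -
    have "inner (f x) (harmonic_op g x) = inner (f x) (complex_of_real (x\<^sup>2) * g x) - inner (f x) (g'' x)" for x
      by (simp add: harmonic_op_def g''_def inner_add_right inner_diff_right del: of_real_power)
    then show ?thesis
      using int L2_integrable_inner[OF schwartz_L2[OF f] x2(2)] by simp
  qed
  have "inner (complex_of_real (x\<^sup>2) * f x) (g x) = inner (f x) (complex_of_real (x\<^sup>2) * g x)" for x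
    by (simp add: inner_complex_def)
  then show ?thesis
    using i1 i2 eq by (simp add: inner_L2_abs harmonic_op_L2 schwartz_L2 f g)
qed

section \<open>Coherent states are Schwartz functions, and the action of the oscillator on
  them\<close>

lemma coherent_has_vector_derivative:
  "(coherent z has_vector_derivative (2 * z - x) * coherent z x) (at x)"
proof -
  have "((\<lambda>w. exp (- w\<^sup>2 / 2 + 2 * w * z - z\<^sup>2)) has_field_derivative
      (2 * z - x) * coherent z x) (at (complex_of_real x))"
    unfolding coherent_def by (auto intro!: derivative_eq_intros)
  from has_vector_derivative_real_field[OF this] show ?thesis
    by (simp add: coherent_def[abs_def])
qed

text \<open>Polynomial multiples of one coherent state are closed under differentiation;
  \<open>[:2 * z, -1:]\<close> is the logarithmic derivative 2 z - x.\<close>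

lemma coherent_poly_deriv:
  "((\<lambda>x. poly p (complex_of_real x) * coherent z x) has_vector_derivative
     poly (pderiv p + p * [:2 * z, -1:]) (complex_of_real x) * coherent z x) (at x)"
proof -
  have "((\<lambda>x. poly p (complex_of_real x)) has_vector_derivative poly (pderiv p) (complex_of_real x)) (at x)"
    using has_vector_derivative_real_field[OF poly_DERIV] .
  from has_vector_derivative_mult[OF this coherent_has_vector_derivative[of z x]]
  show ?thesis by (simp add: algebra_simps)
qed

lemma coherent_poly_nth_derivative:
  "\<exists>q. nth_vector_derivative n (\<lambda>x. poly p (complex_of_real x) * coherent z x)
     = (\<lambda>x. poly q (complex_of_real x) * coherent z x)"
proof (induction n)
  case 0
  then show ?case by auto
next
  case (Suc n)
  then obtain q where q: "nth_vector_derivative n (\<lambda>x. poly p (complex_of_real x) * coherent z x)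
     = (\<lambda>x. poly q (complex_of_real x) * coherent z x)" by auto
  show ?case
    by (intro exI[of _ "pderiv q + q * [:2 * z, -1:]"] ext)
      (unfold nth_vector_derivative_Suc q, rule vector_derivative_at, rule coherent_poly_deriv)
qed

text \<open>One term of the exponential series bounds |x|^k by k! e^|x|. The remaining linear
  exponent (2 r + 1) |x| is absorbed by -x^2/2 at the cost of (2 r + 1)^2/2.\<close>

lemma coherent_power_bounded: "bounded (range (\<lambda>x. complex_of_real x ^ k * coherent z x))"
proof -
  define r where "r = norm z"
  have "norm (complex_of_real x ^ k * coherent z x) \<le> fact k * exp ((2 * r + 1)\<^sup>2 / 2 + r\<^sup>2)" for x
  proof -
    have "(\<Sum>n\<in>{k}. \<bar>x\<bar> ^ n /\<^sub>R fact n) \<le> exp \<bar>x\<bar>"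
      unfolding exp_def by (intro sum_le_suminf summable_exp_generic) auto
    then have 1: "\<bar>x\<bar> ^ k \<le> fact k * exp \<bar>x\<bar>"
      by (simp add: field_simps)
    have "x * Re z \<le> \<bar>x\<bar> * r"
      using abs_ge_self[of "x * Re z"] mult_left_mono[OF abs_Re_le_cmod[of z] abs_ge_zero[of x]]
      by (simp add: abs_mult r_def)
    moreover have "- Re (z\<^sup>2) \<le> r\<^sup>2"
      using abs_Re_le_cmod[of "z\<^sup>2"] by (simp add: r_def norm_power)
    moreover have "0 \<le> (\<bar>x\<bar> - (2 * r + 1))\<^sup>2" by simp
    then have "\<bar>x\<bar> * (2 * r + 1) \<le> x\<^sup>2 / 2 + (2 * r + 1)\<^sup>2 / 2"
      by (simp add: power2_diff)
    ultimately have "\<bar>x\<bar> + Re (- (complex_of_real x)\<^sup>2 / 2 + 2 * x * z - z\<^sup>2) \<le> (2 * r + 1)\<^sup>2 / 2 + r\<^sup>2"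
      by (simp add: algebra_simps)
    then have "exp \<bar>x\<bar> * norm (coherent z x) \<le> exp ((2 * r + 1)\<^sup>2 / 2 + r\<^sup>2)"
      by (simp add: coherent_def exp_add[symmetric])
    then have "fact k * (exp \<bar>x\<bar> * norm (coherent z x)) \<le> fact k * exp ((2 * r + 1)\<^sup>2 / 2 + r\<^sup>2)"
      by simp
    moreover have "\<bar>x\<bar> ^ k * norm (coherent z x) \<le> fact k * exp \<bar>x\<bar> * norm (coherent z x)"
      using 1 by (intro mult_right_mono) auto
    ultimately have "\<bar>x\<bar> ^ k * norm (coherent z x) \<le> fact k * exp ((2 * r + 1)\<^sup>2 / 2 + r\<^sup>2)"
      by (simp only: mult.assoc order_trans)
    then show ?thesis by (simp add: norm_mult norm_power)
  qed
  then show ?thesis unfolding bounded_iff by blast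
qed

lemma coherent_poly_bounded: "bounded (range (\<lambda>x. poly p (complex_of_real x) * coherent z x))"
proof -
  \<comment> \<open>The free power of x makes the induction go through: \<open>pCons\<close>
    multiplies the smaller polynomial by x, which raises k by one.\<close>
  have "bounded (range (\<lambda>x. complex_of_real x ^ k * (poly p (complex_of_real x) * coherent z x)))" for k
  proof (induction p arbitrary: k)
    case 0
    then show ?case by simp
  next
    case (pCons a p)
    have "bounded ((\<lambda>w. a * w) ` range (\<lambda>x. complex_of_real x ^ k * coherent z x))"
      by (intro bounded_linear_image coherent_power_bounded bounded_linear_mult_right)
    from bounded_plus_comp[OF this[unfolded image_image] pCons.IH[of "Suc k"]]
    show ?case by (simp add: algebra_simps)
  qed
  from this[of 0] show ?thesis by simp
qed

lemma coherent_schwartz: "(\<lambda>x. c * coherent z x) \<in> schwartz"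
  unfolding schwartz_def
proof (intro CollectI conjI allI)
  have c: "(\<lambda>x. c * coherent z x) = (\<lambda>x. poly [:c:] (complex_of_real x) * coherent z x)" by simp
  fix n
  obtain q where q: "nth_vector_derivative n (\<lambda>x. c * coherent z x)
     = (\<lambda>x. poly q (complex_of_real x) * coherent z x)"
    using coherent_poly_nth_derivative[of n "[:c:]" z] by auto
  show "nth_vector_derivative n (\<lambda>x. c * coherent z x) differentiable at x" for x
    unfolding q using coherent_poly_deriv by (rule differentiableI_vector)
  show "bounded (range (\<lambda>x. x ^ k *\<^sub>R nth_vector_derivative n (\<lambda>x. c * coherent z x) x))" for k
    using coherent_poly_bounded[of "monom 1 k * q" z]
    unfolding q by (simp add: poly_monom scaleR_conv_of_real mult.assoc)
qed

text \<open>The factor is what 1 + 2 z d/dz produces on \<open>coherent z\<close>; this is the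
  infinitesimal form of the rotation that defines \<open>oscillator_group\<close>.\<close>

lemma harmonic_op_coherent:
  "harmonic_op (\<lambda>x. c * coherent z x) x = (1 + 4 * complex_of_real x * z - 4 * z\<^sup>2) * (c * coherent z x)"
proof -
  have 1: "nth_vector_derivative 1 (\<lambda>x. c * coherent z x) = (\<lambda>x. poly [:2 * c * z, -c:] (complex_of_real x) * coherent z x)"
  proof
    show "nth_vector_derivative 1 (\<lambda>x. c * coherent z x) x = poly [:2 * c * z, -c:] (complex_of_real x) * coherent z x" for x
      using coherent_poly_deriv[of "[:c:]" z x] nth_vector_derivative_Suc[of 0 "\<lambda>x. c * coherent z x" x]
      by (simp add: vector_derivative_at algebra_simps)
  qed
  have "nth_vector_derivative 2 (\<lambda>x. c * coherent z x) x
      = poly (pderiv [:2 * c * z, -c:] + [:2 * c * z, -c:] * [:2 * z, -1:]) (complex_of_real x) * coherent z x"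
    using nth_vector_derivative_Suc[of 1 "\<lambda>x. c * coherent z x" x] coherent_poly_deriv[of "[:2 * c * z, -c:]" z x]
    unfolding 1 by (simp only: Suc_1 vector_derivative_at)
  also have "\<dots> = ((2 * z - x)\<^sup>2 - 1) * (c * coherent z x)"
    by (simp add: pderiv_pCons algebra_simps power2_eq_square)
  finally have "nth_vector_derivative 2 (\<lambda>x. c * coherent z x) x = ((2 * z - x)\<^sup>2 - 1) * (c * coherent z x)" .
  then show ?thesis unfolding harmonic_op_def
    by (simp add: algebra_simps power2_eq_square)
qed

section \<open>The propagator: existence and uniqueness\<close>

lemma has_vector_derivative_quotient_tendsto:
  assumes "(f has_vector_derivative d) (at x)"
  shows "((\<lambda>h. (f (x + h) - f x) /\<^sub>R h) \<longlongrightarrow> d) (at 0)"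
proof -
  have "((\<lambda>h. norm (f (x + h) - f x - h *\<^sub>R d) / norm h) \<longlongrightarrow> 0) (at 0)"
    using assms by (simp add: has_vector_derivative_def has_derivative_at)
  moreover have "\<forall>\<^sub>F h in at 0. norm (f (x + h) - f x - h *\<^sub>R d) / norm h
      = norm ((f (x + h) - f x) /\<^sub>R h - d)"
  proof (rule eventually_at_filter[THEN iffD2], intro always_eventually allI impI)
    fix h :: real assume "h \<noteq> 0"
    then have "(f (x + h) - f x) /\<^sub>R h - d = (f (x + h) - f x - h *\<^sub>R d) /\<^sub>R h"
      by (simp add: scaleR_diff_right)
    then show "norm (f (x + h) - f x - h *\<^sub>R d) / norm h = norm ((f (x + h) - f x) /\<^sub>R h - d)"
      by (simp add: divide_inverse mult.commute)
  qed
  ultimately have "((\<lambda>h. norm ((f (x + h) - f x) /\<^sub>R h - d)) \<longlongrightarrow> 0) (at 0)"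
    by (rule Lim_transform_eventually)
  then show ?thesis by (simp add: tendsto_norm_zero_iff LIM_zero_iff)
qed

lemma cis_has_vector_derivative:
  "((\<lambda>s. cis (k * s)) has_vector_derivative (\<i> * k * cis (k * s))) (at s)"
proof -
  have "((\<lambda>w. exp (\<i> * (k * w))) has_field_derivative (\<i> * k * cis (k * s))) (at (complex_of_real s))"
    by (auto intro!: derivative_eq_intros simp: cis_conv_exp)
  from has_vector_derivative_real_field[OF this] show ?thesis
    by (simp add: cis_conv_exp)
qed

text \<open>Compared with \<open>harmonic_op_coherent\<close> at \<open>cis (2 * s) * z\<close>,
  this is the equation u' = i H u, pointwise in x.\<close>

lemma coherent_evolution_has_vector_derivative:
  "((\<lambda>s. cis s * c * coherent (cis (2 * s) * z) x) has_vector_derivative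
     \<i> * (1 + 4 * complex_of_real x * (cis (2 * s) * z) - 4 * (cis (2 * s) * z)\<^sup>2) * (cis s * c * coherent (cis (2 * s) * z) x)) (at s)"
proof -
  have 1: "((\<lambda>s. cis s * c) has_vector_derivative \<i> * cis s * c) (at s)"
    using bounded_linear.has_vector_derivative[OF bounded_linear_mult_left cis_has_vector_derivative[of 1 s]] by simp
  have 2: "((\<lambda>s. cis (2 * s) * z) has_vector_derivative 2 * \<i> * cis (2 * s) * z) (at s)"
    using bounded_linear.has_vector_derivative[OF bounded_linear_mult_left[of z] cis_has_vector_derivative[of 2 s]]
    by (simp add: mult_ac)
  have "((\<lambda>w. coherent w x) has_field_derivative ((2 * x - 2 * w) * coherent w x)) (at w)" for w :: complex
    unfolding coherent_def by (auto intro!: derivative_eq_intros)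
  from field_vector_diff_chain_at[OF 2 this]
  have "((\<lambda>s. coherent (cis (2 * s) * z) x) has_vector_derivative
      2 * \<i> * cis (2 * s) * z * ((2 * x - 2 * (cis (2 * s) * z)) * coherent (cis (2 * s) * z) x)) (at s)"
    by (simp add: comp_def)
  from has_vector_derivative_mult[OF 1 this]
  show ?thesis by (simp add: algebra_simps power2_eq_square)
qed

text \<open>A majorant independent of s, for dominated convergence. With r = |z|, the polynomial
  factor is at most exp (4 |x| r + 4 r^2) by 1 + u \<le> e^u, and the coherent state at most exp
  (-x^2/2 + 2 |x| r + r^2). The resulting linear term 6 |x| r is that of the coherent states at 3 r
  and -3 r, according to the sign of x; these carry exp (-9 r^2), whence 14 = 5 + 9.\<close>

lemma coherent_evolution_derivative_bound:
  fixes x s :: real and z c w :: complex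
  defines "w \<equiv> cis (2 * s) * z"
  shows "norm (\<i> * (1 + 4 * complex_of_real x * w - 4 * w\<^sup>2) * (cis s * c * coherent w x))
    \<le> norm c * (exp (14 * (norm z)\<^sup>2) * (norm (coherent (3 * norm z) x) + norm (coherent (- 3 * norm z) x)))"
proof -
  define r where "r = norm z"
  define y where "y = \<bar>x\<bar>"
  have w: "norm w = r" by (simp add: w_def r_def norm_mult)
  have y0: "0 \<le> y" by (simp add: y_def)
  have "norm (1 + 4 * complex_of_real x * w - 4 * w\<^sup>2) \<le> norm (1 + 4 * complex_of_real x * w) + norm (4 * w\<^sup>2)"
    by (rule norm_triangle_ineq4)
  also have "norm (1 + 4 * complex_of_real x * w) \<le> norm (1::complex) + norm (4 * complex_of_real x * w)"
    by (rule norm_triangle_ineq)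
  finally have "norm (1 + 4 * complex_of_real x * w - 4 * w\<^sup>2) \<le> 1 + (4 * y * r + 4 * r\<^sup>2)"
    by (simp add: norm_mult norm_power w y_def)
  also have "\<dots> \<le> exp (4 * y * r + 4 * r\<^sup>2)"
    by (rule exp_ge_add_one_self)
  finally have 1: "norm (1 + 4 * complex_of_real x * w - 4 * w\<^sup>2) \<le> exp (4 * y * r + 4 * r\<^sup>2)" .
  have "x * Re w \<le> y * r"
    using abs_ge_self[of "x * Re w"] mult_left_mono[OF abs_Re_le_cmod[of w] y0]
    by (simp add: abs_mult w y_def)
  moreover have "- Re (w\<^sup>2) \<le> r\<^sup>2"
    using abs_Re_le_cmod[of "w\<^sup>2"] by (simp add: w norm_power)
  ultimately have "norm (coherent w x) \<le> exp (- x\<^sup>2 / 2 + 2 * y * r + r\<^sup>2)"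
    by (simp add: coherent_def)
  then have "norm (1 + 4 * complex_of_real x * w - 4 * w\<^sup>2) * norm (coherent w x)
      \<le> exp (4 * y * r + 4 * r\<^sup>2) * exp (- x\<^sup>2 / 2 + 2 * y * r + r\<^sup>2)"
    using 1 by (intro mult_mono) auto
  also have "\<dots> = exp (- x\<^sup>2 / 2 + 6 * y * r + 5 * r\<^sup>2)"
    by (simp add: exp_add[symmetric])
  also have "\<dots> \<le> exp (14 * r\<^sup>2) * (norm (coherent (3 * r) x) + norm (coherent (- 3 * r) x))"
  proof -
    have n: "norm (coherent (complex_of_real a) x) = exp (- x\<^sup>2 / 2 + 2 * x * a - a\<^sup>2)" for a
      by (simp add: coherent_def)
    have "exp (- x\<^sup>2 / 2 + 6 * y * r + 5 * r\<^sup>2) = exp (14 * r\<^sup>2) * exp (- x\<^sup>2 / 2 + 2 * y * (3 * r) - (3 * r)\<^sup>2)"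
      by (simp add: exp_add[symmetric] power2_eq_square)
    also have "exp (- x\<^sup>2 / 2 + 2 * y * (3 * r) - (3 * r)\<^sup>2)
        \<le> norm (coherent (complex_of_real (3 * r)) x) + norm (coherent (complex_of_real (- 3 * r)) x)"
      unfolding n by (cases "x \<ge> 0") (simp_all add: y_def)
    finally show ?thesis by simp
  qed
  finally have "norm c * (norm (1 + 4 * complex_of_real x * w - 4 * w\<^sup>2) * norm (coherent w x))
      \<le> norm c * (exp (14 * r\<^sup>2) * (norm (coherent (3 * r) x) + norm (coherent (- 3 * r) x)))"
    by (rule mult_left_mono) simp
  then show ?thesis by (simp add: norm_mult r_def mult_ac)
qed

text \<open>The derivative is placed on the explicit coherent state, where dominated convergence
  applies. Symmetry of \<open>H\<close> then moves it to f, and since multiplication by i is skew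
  for the real inner product, a minus sign appears.\<close>

lemma inner_coherent_evolution_DERIV_0:
  assumes f: "f \<in> schwartz"
  shows "((\<lambda>s. inner (L2_abs f) (oscillator_group s (coherent_state (c, z)))) has_real_derivative
     - inner (cscale \<i> (L2_abs (harmonic_op f))) (coherent_state (c, z))) (at 0)"
proof -
  define u where "u s x = cis s * c * coherent (cis (2 * s) * z) x" for s x
  define u' where "u' s x = \<i> * (1 + 4 * complex_of_real x * (cis (2 * s) * z) - 4 * (cis (2 * s) * z)\<^sup>2) * u s x" for s x
  define m where "m x = norm c * (exp (14 * (norm z)\<^sup>2) *
      (norm (coherent (3 * norm z) x) + norm (coherent (- 3 * norm z) x)))" for x
  have deriv: "((\<lambda>s. u s x) has_vector_derivative u' s x) (at s)" for s x
    unfolding u_def u'_def by (rule coherent_evolution_has_vector_derivative)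
  have bound: "norm (u' s x) \<le> m x" for s x
    unfolding u_def u'_def m_def by (rule coherent_evolution_derivative_bound)
  have uL2: "u s \<in> L2" for s
    unfolding u_def[abs_def] by (intro L2_cmult coherent_L2)
  have [measurable]: "f \<in> borel_measurable borel" "u s \<in> borel_measurable borel" for s
    by (auto intro: L2_measurable schwartz_L2 f uL2)
  obtain B where B: "\<And>x. \<bar>x\<bar> ^ 0 * norm (nth_vector_derivative 0 f x) \<le> B"
    using schwartz_bound[OF f] by blast
  \<comment> \<open>The constant 3 is 2 for the variation of the derivative along the segment plus 1
    for the derivative at 0.\<close>
  have quotient_bound: "norm (u h x - u 0 x) \<le> \<bar>h\<bar> * (3 * m x)" for h x
  proof -
    have "norm (u h x - u 0 x - (h - 0) *\<^sub>R u' 0 x) \<le> norm (h - 0) * (2 * m x)"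
    proof (rule vector_differentiable_bound_linearization[where S = UNIV and f = "\<lambda>s. u s x" and f' = "\<lambda>s. u' s x"])
      show "((\<lambda>s. u s x) has_vector_derivative u' s x) (at s within UNIV)" for s
        using deriv by simp
      show "norm (u' s x - u' 0 x) \<le> 2 * m x" for s
        using norm_triangle_ineq4[of "u' s x" "u' 0 x"] bound[of s x] bound[of 0 x] by simp
    qed auto
    moreover have "norm (h *\<^sub>R u' 0 x) \<le> \<bar>h\<bar> * m x"
      using bound[of 0 x] by (simp add: mult_left_mono)
    ultimately have "norm (u h x - u 0 x - h *\<^sub>R u' 0 x) + norm (h *\<^sub>R u' 0 x) \<le> \<bar>h\<bar> * (3 * m x)"
      by (simp add: algebra_simps)
    then show ?thesis
      using norm_triangle_ineq[of "u h x - u 0 x - h *\<^sub>R u' 0 x" "h *\<^sub>R u' 0 x"] by simp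
  qed
  define \<phi> where "\<phi> s = (LBINT x. inner (f x) (u s x))" for s
  have \<phi>: "inner (L2_abs f) (oscillator_group s (coherent_state (c, z))) = \<phi> s" for s
    unfolding oscillator_group_coherent unfolding coherent_state_def \<phi>_def
    using uL2[of s] by (simp add: inner_L2_abs schwartz_L2 f u_def[abs_def])
  have u'_0: "u' 0 x = harmonic_op (\<lambda>x. (\<i> * c) * coherent z x) x" for x
    unfolding harmonic_op_coherent by (simp add: u'_def u_def mult_ac)
  have limit: "(LBINT x. inner (f x) (u' 0 x)) = - inner (cscale \<i> (L2_abs (harmonic_op f))) (coherent_state (c, z))"
  proof -
    have "(LBINT x. inner (f x) (u' 0 x)) = inner (L2_abs f) (L2_abs (harmonic_op (\<lambda>x. (\<i> * c) * coherent z x)))"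
      unfolding u'_0 by (simp only: inner_L2_abs schwartz_L2 f harmonic_op_L2 coherent_schwartz)
    also have "\<dots> = inner (L2_abs (harmonic_op f)) (coherent_state (\<i> * c, z))"
      by (simp add: harmonic_op_symmetric[OF f coherent_schwartz] coherent_state_def)
    also have "\<dots> = inner (L2_abs (harmonic_op f)) (cscale \<i> (coherent_state (c, z)))"
      by (simp add: coherent_state_cscale cscale_cscale)
    also have "cscale \<i> (coherent_state (c, z)) = - cscale (cnj \<i>) (coherent_state (c, z))"
      using cscale_of_real[of "-1" "cscale \<i> (coherent_state (c, z))"] by (simp add: cscale_cscale)
    finally show ?thesis
      unfolding inner_cscale_left by simp
  qed
  have "((\<lambda>h. (\<phi> (0 + h) - \<phi> 0) / h) \<longlongrightarrow> (LBINT x. inner (f x) (u' 0 x))) (at 0)"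
    unfolding tendsto_at_iff_sequentially
  proof (intro allI impI)
    fix X :: "nat \<Rightarrow> real"
    assume X0: "\<forall>i. X i \<in> UNIV - {0}" and X: "X \<longlonglongrightarrow> 0"
    have "(\<lambda>i. LBINT x. inner (f x) ((u (X i) x - u 0 x) /\<^sub>R X i)) \<longlonglongrightarrow> (LBINT x. inner (f x) (u' 0 x))"
    proof (rule integral_dominated_convergence[where w = "\<lambda>x. B * (3 * m x)"])
      show "integrable lborel (\<lambda>x. B * (3 * m x))"
        unfolding m_def
        by (intro integrable_mult_right Bochner_Integration.integrable_add integrable_norm coherent_integrable)
      show lim: "AE x in lborel. (\<lambda>i. inner (f x) ((u (X i) x - u 0 x) /\<^sub>R X i)) \<longlonglongrightarrow> inner (f x) (u' 0 x)"
      proof (intro AE_I2 tendsto_inner tendsto_const)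
        fix x
        have "((\<lambda>h. (u h x - u 0 x) /\<^sub>R h) \<longlongrightarrow> u' 0 x) (at 0)"
          using has_vector_derivative_quotient_tendsto[OF deriv[where s = 0 and x = x]] by simp
        then show "(\<lambda>i. (u (X i) x - u 0 x) /\<^sub>R X i) \<longlonglongrightarrow> u' 0 x"
          using X0 X unfolding tendsto_at_iff_sequentially comp_def by blast
      qed
      have "u' 0 \<in> borel_measurable borel"
        unfolding u'_0[abs_def] by (intro L2_measurable harmonic_op_L2 coherent_schwartz)
      then show "(\<lambda>x. inner (f x) (u' 0 x)) \<in> borel_measurable lborel" by simp
      show "AE x in lborel. norm (inner (f x) ((u (X i) x - u 0 x) /\<^sub>R X i)) \<le> B * (3 * m x)" for i
      proof (rule AE_I2)
        fix x
        have Xi: "0 < \<bar>X i\<bar>" using X0 by simp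
        have "norm ((u (X i) x - u 0 x) /\<^sub>R X i) = norm (u (X i) x - u 0 x) / \<bar>X i\<bar>"
          by (simp only: norm_scaleR) (simp add: divide_inverse mult.commute)
        also have "\<dots> \<le> 3 * m x"
          using quotient_bound[of "X i" x] Xi by (simp add: pos_divide_le_eq mult.commute)
        finally have "norm ((u (X i) x - u 0 x) /\<^sub>R X i) \<le> 3 * m x" .
        then have "norm (f x) * norm ((u (X i) x - u 0 x) /\<^sub>R X i) \<le> B * (3 * m x)"
          using B[of x] by (intro mult_mono) (auto intro: order_trans[OF norm_ge_zero])
        then show "norm (inner (f x) ((u (X i) x - u 0 x) /\<^sub>R X i)) \<le> B * (3 * m x)"
          using Cauchy_Schwarz_ineq2[of "f x" "(u (X i) x - u 0 x) /\<^sub>R X i"] by simp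
      qed
    qed simp
    moreover have "(LBINT x. inner (f x) ((u (X i) x - u 0 x) /\<^sub>R X i)) = (\<phi> (0 + X i) - \<phi> 0) / X i" for i
    proof -
      have "(LBINT x. inner (f x) ((u (X i) x - u 0 x) /\<^sub>R X i))
          = (LBINT x. (inner (f x) (u (X i) x) - inner (f x) (u 0 x)) / X i)"
        by (simp add: inner_diff_right divide_inverse mult.commute)
      also have "\<dots> = ((LBINT x. inner (f x) (u (X i) x)) - (LBINT x. inner (f x) (u 0 x))) / X i"
        using L2_integrable_inner[OF schwartz_L2[OF f] uL2] by simp
      finally show ?thesis by (simp add: \<phi>_def)
    qed
    ultimately show "((\<lambda>h. (\<phi> (0 + h) - \<phi> 0) / h) \<circ> X) \<longlonglongrightarrow> (LBINT x. inner (f x) (u' 0 x))"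
      by (simp add: comp_def)
  qed
  then show ?thesis
    unfolding \<phi> limit DERIV_def by simp
qed

text \<open>The value of u'(0) that the equation i u'(0) + H f = 0 prescribes.\<close>

definition generator :: "(real \<Rightarrow> complex) \<Rightarrow> L2_class" where
  "generator f = cscale \<i> (L2_abs (harmonic_op f))"

text \<open>Moving the group to the coherent state and writing the time as t - s, the claim at time
  t becomes the previous one at time 0 for a rotated coherent state; the reversal of time removes
  the minus sign.\<close>

lemma inner_oscillator_group_DERIV_coherent:
  assumes f: "f \<in> schwartz"
  shows "((\<lambda>t. inner (oscillator_group t (L2_abs f)) (coherent_state (c, z))) has_real_derivative
     inner (oscillator_group t (generator f)) (coherent_state (c, z))) (at t)"
proof -
  define p where "p = (cis (- t) * c, cis (- 2 * t) * z)"
  have p: "oscillator_group (- t) (coherent_state (c, z)) = coherent_state p"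
    by (simp add: p_def oscillator_group_coherent)
  have "((\<lambda>s. inner (L2_abs f) (oscillator_group s (coherent_state p))) has_real_derivative
      - inner (generator f) (coherent_state p)) (at 0)"
    unfolding generator_def p_def by (rule inner_coherent_evolution_DERIV_0[OF f])
  then have "((\<lambda>s. inner (L2_abs f) (oscillator_group s (coherent_state p))) has_real_derivative
      - inner (generator f) (coherent_state p)) (at (t - t))" by simp
  moreover have "((\<lambda>\<tau>. t - \<tau>) has_real_derivative -1) (at t)"
    by (auto intro!: derivative_eq_intros)
  note DERIV_chain2[where g = "\<lambda>\<tau>. t - \<tau>", OF _ this]
  ultimately  have "((\<lambda>\<tau>. inner (L2_abs f) (oscillator_group (t - \<tau>) (coherent_state p))) has_real_derivative
      inner (generator f) (coherent_state p)) (at t)"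
    by fastforce
  moreover have "inner (L2_abs f) (oscillator_group (t - \<tau>) (coherent_state p))
      = inner (oscillator_group \<tau> (L2_abs f)) (coherent_state (c, z))" for \<tau>
    by (simp add: p[symmetric] oscillator_group_add[symmetric] inner_oscillator_group_left)
  ultimately show ?thesis
    by (simp add: inner_oscillator_group_left p)
qed

lemma inner_oscillator_group_DERIV:
  assumes f: "f \<in> schwartz" and v: "v \<in> span (range coherent_state)"
  shows "((\<lambda>t. inner (oscillator_group t (L2_abs f)) v) has_real_derivative
     inner (oscillator_group t (generator f)) v) (at t)"
  using v
proof (induction rule: span_induct)
  show "subspace {v. ((\<lambda>t. inner (oscillator_group t (L2_abs f)) v) has_real_derivative
     inner (oscillator_group t (generator f)) v) (at t)}"
    by (auto intro!: subspaceI DERIV_add DERIV_cmult simp: inner_add_right)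
qed (auto intro!: inner_oscillator_group_DERIV_coherent f)

text \<open>From a weak to a norm derivative. For v in the dense span the mean value inequality
  bounds the pairing of the remainder with v by |t| (e/2) |v|; strong continuity at
  \<open>generator f\<close> makes the range of t independent of v, so the bound extends to all v by
  density.\<close>

lemma oscillator_group_derivative:
  assumes f: "f \<in> schwartz"
  shows "((\<lambda>t. norm ((oscillator_group t (L2_abs f) - L2_abs f) /\<^sub>R t - generator f)) \<longlongrightarrow> 0) (at 0)"
proof (rule tendstoI)
  fix e :: real assume e: "e > 0"
  define V where "V = oscillator_group"
  define K where "K = generator f"
  have "\<forall>\<^sub>F t in at 0. dist (V t K) K < e / 2"
    using tendstoD[OF oscillator_group_tendsto, of "e / 2" K] e by (simp add: V_def)
  then obtain d where d: "d > 0" "\<And>t. t \<noteq> 0 \<Longrightarrow> dist t 0 < d \<Longrightarrow> dist (V t K) K < e / 2"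
    by (auto simp: eventually_at)
  have d': "norm (V t K - K) \<le> e / 2" if "\<bar>t\<bar> < d" for t
    using d(2)[of t] that e by (cases "t = 0") (auto simp: V_def oscillator_group_0 dist_norm)
  have est: "norm (V t (L2_abs f) - L2_abs f - t *\<^sub>R K) \<le> \<bar>t\<bar> * (e / 2)" if t: "\<bar>t\<bar> < d" for t
  proof -
    define x where "x = V t (L2_abs f) - L2_abs f - t *\<^sub>R K"
    have "norm (inner x v) \<le> \<bar>t\<bar> * (e / 2) * norm v" if v: "v \<in> span (range coherent_state)" for v
    proof -
      have "norm (inner (V t (L2_abs f)) v - inner (V 0 (L2_abs f)) v - (t - 0) *\<^sub>R inner (V 0 K) v)
          \<le> norm (t - 0) * (e / 2 * norm v)"
      proof (rule vector_differentiable_bound_linearization[where S = "{-d<..<d}"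
            and f = "\<lambda>t. inner (V t (L2_abs f)) v" and f' = "\<lambda>t. inner (V t K) v"])
        show "((\<lambda>t. inner (V t (L2_abs f)) v) has_vector_derivative inner (V s K) v) (at s within {-d<..<d})" for s
          using inner_oscillator_group_DERIV[OF f v, of s]
          by (simp add: V_def K_def has_real_derivative_iff_has_vector_derivative has_vector_derivative_at_within)
        show "closed_segment 0 t \<subseteq> {-d<..<d}"
          using t d(1) by (intro closed_segment_subset) auto
        fix s assume "s \<in> {-d<..<d}"
        then have "norm (V s K - K) \<le> e / 2" by (intro d') auto
        then have "norm (V s K - K) * norm v \<le> e / 2 * norm v" by (rule mult_right_mono) simp
        then show "norm (inner (V s K) v - inner (V 0 K) v) \<le> e / 2 * norm v"
          using Cauchy_Schwarz_ineq2[of "V s K - K" v]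
          by (simp add: inner_diff_left[symmetric] V_def oscillator_group_0)
      qed (use d(1) in auto)
      then show ?thesis
        by (simp add: x_def V_def oscillator_group_0 inner_diff_left)
    qed
    then have "span (range coherent_state) \<subseteq> {v. norm (inner x v) \<le> \<bar>t\<bar> * (e / 2) * norm v}"
      by auto
    moreover have "closed {v. norm (inner x v) \<le> \<bar>t\<bar> * (e / 2) * norm v}"
      by (intro closed_Collect_le continuous_intros)
    ultimately have "closure (span (range coherent_state)) \<subseteq> {v. norm (inner x v) \<le> \<bar>t\<bar> * (e / 2) * norm v}"
      by (rule closure_minimal)
    \<comment> \<open>The remainder itself is now an admissible test vector, which turns the weak
      bound into a norm bound.\<close>
    then have "norm (inner x x) \<le> \<bar>t\<bar> * (e / 2) * norm x"
      unfolding coherent_state_dense by blast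
    then have "norm x * norm x \<le> \<bar>t\<bar> * (e / 2) * norm x"
      by (simp add: dot_square_norm power2_eq_square)
    then show ?thesis
      using e by (cases "norm x = 0") (auto simp: x_def[symmetric])
  qed
  show "\<forall>\<^sub>F t in at 0. dist (norm ((oscillator_group t (L2_abs f) - L2_abs f) /\<^sub>R t - generator f)) 0 < e"
    unfolding eventually_at
  proof (intro exI[of _ d] conjI ballI impI d(1))
    fix t :: real assume "t \<noteq> 0 \<and> dist t 0 < d"
    then have t: "t \<noteq> 0" "\<bar>t\<bar> < d" by auto
    have "(V t (L2_abs f) - L2_abs f) /\<^sub>R t - K = (V t (L2_abs f) - L2_abs f - t *\<^sub>R K) /\<^sub>R t"
      using t by (simp add: scaleR_diff_right)
    then have "norm ((V t (L2_abs f) - L2_abs f) /\<^sub>R t - K) = norm (V t (L2_abs f) - L2_abs f - t *\<^sub>R K) / \<bar>t\<bar>"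
      by (simp only: norm_scaleR) (simp add: divide_inverse mult.commute)
    also have "\<dots> \<le> e / 2"
      using est[OF t(2)] t by (simp add: pos_divide_le_eq mult.commute)
    finally have "norm ((V t (L2_abs f) - L2_abs f) /\<^sub>R t - K) \<le> e / 2" .
    then show "dist (norm ((oscillator_group t (L2_abs f) - L2_abs f) /\<^sub>R t - generator f)) 0 < e"
      using e by (simp add: V_def K_def)
  qed
qed

text \<open>The class of \<open>h\<close> is i times the difference quotient minus the generator,
  and multiplication by i preserves the norm.\<close>

lemma L2_norm_schroedinger_quotient:
  fixes t :: real
  assumes f: "f \<in> schwartz" and g: "g \<in> L2"
  defines "h \<equiv> (\<lambda>x. \<i> * ((g x - f x) / complex_of_real t) + harmonic_op f x)"
  shows "h \<in> L2" and "L2_norm (\<lambda>x. h x - 0) = norm ((L2_abs g - L2_abs f) /\<^sub>R t - generator f)"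
proof -
  have gf: "(\<lambda>x. g x - f x) \<in> L2" by (rule L2_diff[OF g schwartz_L2[OF f]])
  have h: "h = (\<lambda>x. (\<i> * complex_of_real (inverse t)) * (g x - f x) + harmonic_op f x)"
    by (simp add: h_def divide_inverse mult_ac)
  show hL2: "h \<in> L2"
    unfolding h by (intro L2_add L2_cmult gf harmonic_op_L2 f)
  have "L2_abs h = cscale (\<i> * complex_of_real (inverse t)) (L2_abs g - L2_abs f) + L2_abs (harmonic_op f)"
    unfolding h using gf by (simp only: L2_abs_add[symmetric] L2_abs_cscale[symmetric] L2_abs_diff[symmetric]
        L2_cmult harmonic_op_L2 f g schwartz_L2)
  also have "cscale (\<i> * complex_of_real (inverse t)) (L2_abs g - L2_abs f)
      = cscale \<i> ((L2_abs g - L2_abs f) /\<^sub>R t)"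
    by (simp only: cscale_cscale[symmetric] cscale_of_real)
  also have "L2_abs (harmonic_op f) = - cscale \<i> (generator f)"
    using cscale_of_real[of "-1" "L2_abs (harmonic_op f)"] by (simp add: generator_def cscale_cscale)
  also have "cscale \<i> ((L2_abs g - L2_abs f) /\<^sub>R t) + - cscale \<i> (generator f)
      = cscale \<i> ((L2_abs g - L2_abs f) /\<^sub>R t - generator f)"
    by (simp add: linear_diff[OF cscale_linear])
  finally show "L2_norm (\<lambda>x. h x - 0) = norm ((L2_abs g - L2_abs f) /\<^sub>R t - generator f)"
    using hL2 by (simp add: norm_L2_abs[symmetric] norm_cscale)
qed

lemma L2_tendsto_schroedinger_iff:
  assumes f: "f \<in> schwartz" and g: "\<And>t. g t \<in> L2"
  shows "L2_tendsto (\<lambda>t x. \<i> * ((g t x - f x) / complex_of_real t) + harmonic_op f x) (\<lambda>x. 0) (at 0)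
    \<longleftrightarrow> ((\<lambda>t. norm ((L2_abs (g t) - L2_abs f) /\<^sub>R t - generator f)) \<longlongrightarrow> 0) (at 0)"
  unfolding L2_tendsto_def L2_norm_schroedinger_quotient(2)[OF f g]
  using L2_norm_schroedinger_quotient(1)[OF f g] L2_zero by simp

lemma harmonic_propagator_exists: "\<exists>U. harmonic_propagator U"
proof
  define U where "U t f = L2_rep (oscillator_group t (L2_abs f))" for t f
  have U[simp]: "U t f \<in> L2" "L2_abs (U t f) = oscillator_group t (L2_abs f)" for t f
    by (simp_all add: U_def)
  have nU: "L2_norm (U t f) = L2_norm f" if "f \<in> L2" for t f
    using norm_L2_abs[of "U t f"] norm_L2_abs[OF that] by (simp add: norm_oscillator_group)
  have AE: "AE x in lborel. f x = g x" if "L2_abs f = L2_abs g" "f \<in> L2" "g \<in> L2" for f g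
    using that by (simp add: L2_abs_eq_iff)
  have "unitary_group U"
    unfolding unitary_group_def
  proof (intro conjI ballI allI)
    fix t a b f g assume [simp]: "f \<in> L2" "g \<in> L2"
    show "AE x in lborel. U t (\<lambda>y. a * f y + b * g y) x = a * U t f x + b * U t g x"
      by (rule AE) (simp_all add: L2_abs_add[symmetric] L2_abs_cscale[symmetric] L2_cmult L2_add
          linear_add[OF oscillator_group_linear] oscillator_group_cscale)
  next
    fix f assume [simp]: "f \<in> L2"
    show "AE x in lborel. U 0 f x = f x"
      by (rule AE) (simp_all add: oscillator_group_0)
    show "AE x in lborel. U (s + t) f x = U s (U t f) x" for s t
      by (rule AE) (simp_all add: oscillator_group_add)
    have "((\<lambda>t. norm (oscillator_group t (L2_abs f) - L2_abs f)) \<longlongrightarrow> 0) (at 0)"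
      using oscillator_group_tendsto[of "L2_abs f"] by (simp add: tendsto_norm_zero_iff LIM_zero_iff)
    then show "L2_tendsto (\<lambda>t. U t f) f (at 0)"
      by (simp add: L2_tendsto_def L2_norm_diff)
  qed (simp_all add: nU)
  moreover have "L2_tendsto (\<lambda>t x. \<i> * ((U t f x - f x) / complex_of_real t) + harmonic_op f x) (\<lambda>x. 0) (at 0)"
    if "f \<in> schwartz" for f
    using oscillator_group_derivative[OF that]
    by (intro iffD2[OF L2_tendsto_schroedinger_iff[OF that, of "\<lambda>t. U t f"]]) simp_all
  ultimately show "harmonic_propagator U"
    unfolding harmonic_propagator_def by blast
qed

lemma unitary_group_isometry: "unitary_group U \<Longrightarrow> L2_isometry (U t)"
  unfolding unitary_group_def L2_isometry_def by blast

lemma DERIV_zero_if_little_o: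
  fixes n :: "real \<Rightarrow> real"
  assumes "\<And>h. \<bar>n (t + h) - n t\<bar> \<le> \<bar>h\<bar> * r h" and "(r \<longlongrightarrow> 0) (at 0)"
  shows "(n has_real_derivative 0) (at t)"
  unfolding DERIV_def
proof (rule Lim_null_comparison[OF _ assms(2)])
  show "\<forall>\<^sub>F h in at 0. norm ((n (t + h) - n t) / h) \<le> r h"
    unfolding eventually_at
    using assms(1) by (intro exI[of _ 1]) (auto simp: field_simps)
qed

text \<open>With \<open>n(t)\<close> the distance between the two evolutions of a coherent state, \<open>n(t + h) - n(t)\<close> is
  at most the distance of their increments over the time \<open>h\<close> from the same (coherent) state.
  Both have the same derivative, so \<open>n' = 0\<close>.\<close>

lemma harmonic_propagator_unique:
  assumes U: "harmonic_propagator U"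
  shows "L2_lift (U t) a = oscillator_group t a"
proof -
  have ug: "unitary_group U" using U by (simp add: harmonic_propagator_def)
  have iso: "L2_isometry (U t)" for t by (rule unitary_group_isometry[OF ug])
  define T where "T t = L2_lift (U t)" for t
  define V where "V = oscillator_group"
  have T_abs: "L2_abs (U t f) = T t (L2_abs f)" if "f \<in> L2" for t f
    using L2_lift_abs[OF iso that] by (simp add: T_def)
  have T_linear: "linear (T t)" and T_norm: "norm (T t b) = norm b" for t b
    unfolding T_def by (intro L2_lift_linear norm_L2_lift iso)+
  have T_add: "T (s + t) b = T s (T t b)" for s t b
  proof -
    have "L2_abs (U (s + t) (L2_rep b)) = L2_abs (U s (U t (L2_rep b)))"
      using ug L2_isometry_in[OF iso] unfolding unitary_group_def by (subst L2_abs_eq_iff) auto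
    then show ?thesis by (simp add: T_abs L2_isometry_in[OF iso])
  qed
  have T_0: "T 0 b = b" for b
  proof -
    have "L2_abs (U 0 (L2_rep b)) = L2_abs (L2_rep b)"
      using ug L2_isometry_in[OF iso] unfolding unitary_group_def by (subst L2_abs_eq_iff) auto
    then show ?thesis by (simp add: T_abs)
  qed
  have T_deriv: "((\<lambda>t. norm ((T t (L2_abs f) - L2_abs f) /\<^sub>R t - generator f)) \<longlongrightarrow> 0) (at 0)"
    if f: "f \<in> schwartz" for f
    using U L2_tendsto_schroedinger_iff[OF f, of "\<lambda>t. U t f"] L2_isometry_in[OF iso schwartz_L2[OF f]] f
    by (simp add: harmonic_propagator_def T_abs schwartz_L2)
  have coherent: "T t (coherent_state (c, z)) = V t (coherent_state (c, z))" for c z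
  proof -
    define p where "p = coherent_state (c, z)"
    define n where "n t = norm (V t p - T t p)" for t
    have "(n has_real_derivative 0) (at t)" for t
    proof -
      define f where "f x = (cis t * c) * coherent (cis (2 * t) * z) x" for x
      have f: "f \<in> schwartz" unfolding f_def[abs_def] by (rule coherent_schwartz)
      have g: "V t p = L2_abs f"
        unfolding V_def p_def oscillator_group_coherent by (simp add: coherent_state_def f_def[abs_def])
      define rV rT where "rV h = (V h (L2_abs f) - L2_abs f) /\<^sub>R h - generator f"
        and "rT h = (T h (L2_abs f) - L2_abs f) /\<^sub>R h - generator f" for h
      show ?thesis
      proof (rule DERIV_zero_if_little_o)
        show "((\<lambda>h. norm (rV h) + norm (rT h)) \<longlongrightarrow> 0) (at 0)"
          unfolding rV_def rT_def V_def
          using tendsto_add[OF oscillator_group_derivative[OF f] T_deriv[OF f]] by simp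
        fix h
        have "V (t + h) p - T (t + h) p = V h (L2_abs f) - T h (T t p)"
          using oscillator_group_add[of h t p] T_add[of h t p] by (simp add: V_def g[unfolded V_def] add.commute)
        \<comment> \<open>Each increment from the common state is h times its remainder plus the
          generator term; the generator terms cancel. The case h = 0 is separate because the
          remainders then contain a division by zero.\<close>
        also have "\<dots> = h *\<^sub>R (rV h - rT h) + T h (V t p - T t p)"
          by (cases "h = 0") (simp_all add: rV_def rT_def scaleR_diff_right linear_diff[OF T_linear]
              g[unfolded V_def] V_def oscillator_group_0 T_0)
        finally have "\<bar>n (t + h) - norm (T h (V t p - T t p))\<bar> \<le> norm (h *\<^sub>R (rV h - rT h))"
          unfolding n_def by (metis add_diff_cancel_right' norm_triangle_ineq3)
        also have "\<dots> \<le> \<bar>h\<bar> * (norm (rV h) + norm (rT h))"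
          using norm_triangle_ineq4[of "rV h" "rT h"] by (simp add: mult_left_mono)
        finally show "\<bar>n (t + h) - n t\<bar> \<le> \<bar>h\<bar> * (norm (rV h) + norm (rT h))"
          by (simp add: T_norm n_def)
      qed
    qed
    then have "n t = n 0"
      by (intro DERIV_isconst_all) blast
    then show ?thesis by (simp add: n_def p_def V_def oscillator_group_0 T_0)
  qed
  have "bounded_linear (T t)" "bounded_linear (V t)"
    by (intro linear_isometry_bounded_linear T_linear T_norm) (simp add: V_def bounded_linear_oscillator_group)
  then have "T t a = V t a"
    using coherent by (rule bounded_linear_eq_on_coherent)
  then show ?thesis by (simp add: T_def V_def)
qed

lemma exp_itH_propagator: "harmonic_propagator exp_itH"
  unfolding exp_itH_def using harmonic_propagator_exists by (rule someI_ex)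

lemma exp_itH_isometry: "L2_isometry (exp_itH t)"
  using exp_itH_propagator by (simp add: harmonic_propagator_def unitary_group_isometry)

lemma exp_itH_L2: "f \<in> L2 \<Longrightarrow> exp_itH t f \<in> L2"
  by (rule L2_isometry_in[OF exp_itH_isometry])

text \<open>By uniqueness every propagator that the choice in \<open>exp_itH\<close> may return acts
  on classes as the explicit group. Together with \<open>exp_itH_L2\<close>, this is all that is
  used about \<open>exp_itH\<close> from here on.\<close>

lemma L2_abs_exp_itH: "f \<in> L2 \<Longrightarrow> L2_abs (exp_itH t f) = oscillator_group t (L2_abs f)"
  using L2_lift_abs[OF exp_itH_isometry, of f t] harmonic_propagator_unique[OF exp_itH_propagator] by simp

section \<open>Phase space translations and periodicity\<close>

lemma L2_shift:
  assumes "f \<in> L2"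
  shows "(\<lambda>x. f (x + a)) \<in> L2" "L2_norm (\<lambda>x. f (x + a)) = L2_norm f"
proof -
  have [measurable]: "f \<in> borel_measurable borel" using assms by (rule L2_measurable)
  show "(\<lambda>x. f (x + a)) \<in> L2"
    using lborel_integrable_real_affine[OF L2_integrable_norm_sq[OF assms], of 1 a]
    by (simp add: L2_def add.commute)
  show "L2_norm (\<lambda>x. f (x + a)) = L2_norm f"
    using lborel_integral_real_affine[of 1 "\<lambda>x. (norm (f x))\<^sup>2" a]
    by (simp add: L2_norm_def add.commute)
qed

lemma L2_reflect:
  assumes "f \<in> L2"
  shows "(\<lambda>x. f (- x)) \<in> L2" "L2_norm (\<lambda>x. f (- x)) = L2_norm f"
proof -
  have [measurable]: "f \<in> borel_measurable borel" using assms by (rule L2_measurable)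
  show "(\<lambda>x. f (- x)) \<in> L2"
    using lborel_integrable_real_affine[OF L2_integrable_norm_sq[OF assms], of "-1" 0]
    by (simp add: L2_def)
  show "L2_norm (\<lambda>x. f (- x)) = L2_norm f"
    using lborel_integral_real_affine[of "-1" "\<lambda>x. (norm (f x))\<^sup>2" 0]
    by (simp add: L2_norm_def)
qed

lemma L2_unimodular_mult:
  assumes f: "f \<in> L2" and [measurable]: "k \<in> borel_measurable borel" and k: "\<And>x. norm (k x) = 1"
  shows "(\<lambda>x. k x * f x) \<in> L2" "L2_norm (\<lambda>x. k x * f x) = L2_norm f"
  using f L2_measurable[OF f] by (simp_all add: L2_def L2_norm_def norm_mult k)

text \<open>The Weyl operators: \<open>weyl (- \<lambda>)\<close> is the translation by \<open>\<lambda>\<close> and \<open>weyl (\<i> \<lambda>)\<close> the linear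
  modulation. The constant phase makes \<open>e\<^bsup>itH\<^esup>\<close> intertwine \<open>weyl \<alpha>\<close> and \<open>weyl (e\<^bsup>2it\<^esup>\<alpha>)\<close> exactly.\<close>

definition weyl :: "complex \<Rightarrow> (real \<Rightarrow> complex) \<Rightarrow> real \<Rightarrow> complex" where
  "weyl \<alpha> f x = exp (\<i> * complex_of_real (Im \<alpha> * x - Re \<alpha> * Im \<alpha> / 2)) * f (x - Re \<alpha>)"

lemma weyl_isometry: "L2_isometry (weyl \<alpha>)"
  unfolding L2_isometry_def
proof (intro conjI ballI allI)
  fix f assume f: "f \<in> L2"
  have s: "(\<lambda>x. f (x - Re \<alpha>)) \<in> L2" "L2_norm (\<lambda>x. f (x - Re \<alpha>)) = L2_norm f"
    using L2_shift[OF f, of "- Re \<alpha>"] by simp_all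
  have "(\<lambda>x. exp (\<i> * complex_of_real (Im \<alpha> * x - Re \<alpha> * Im \<alpha> / 2))) \<in> borel_measurable borel"
    by simp
  note u = L2_unimodular_mult[OF s(1) this]
  show "weyl \<alpha> f \<in> L2" unfolding weyl_def[abs_def] by (rule u(1)) (simp only: norm_exp_i_times)
  show "L2_norm (weyl \<alpha> f) = L2_norm f"
    unfolding weyl_def[abs_def] s(2)[symmetric] by (rule u(2)) (simp only: norm_exp_i_times)
qed (simp add: weyl_def algebra_simps)

text \<open>In modulus \<open>coherent w\<close> is centred at 2 Re w, and it oscillates with
  frequency 2 Im w; hence the displacement by \<alpha> moves the parameter by \<alpha>/2.\<close>

lemma weyl_coherent:
  "weyl \<alpha> (coherent w) x = exp (- (\<alpha> * cnj \<alpha>) / 4 - cnj \<alpha> * w) * coherent (w + \<alpha> / 2) x"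
proof -
  define a b where "a = complex_of_real (Re \<alpha>)" and "b = complex_of_real (Im \<alpha>)"
  have \<alpha>: "\<alpha> = a + \<i> * b" "cnj \<alpha> = a - \<i> * b"
    by (simp_all add: a_def b_def complex_eq_iff)
  have "\<i> * (b * x - a * b / 2) + (- (x - a)\<^sup>2 / 2 + 2 * (x - a) * w - w\<^sup>2)
      = (- ((a + \<i> * b) * (a - \<i> * b)) / 4 - (a - \<i> * b) * w)
        + (- (complex_of_real x)\<^sup>2 / 2 + 2 * complex_of_real x * (w + (a + \<i> * b) / 2) - (w + (a + \<i> * b) / 2)\<^sup>2)"
    by (simp add: field_simps power2_eq_square)
  moreover have "complex_of_real (Im \<alpha> * x - Re \<alpha> * Im \<alpha> / 2) = b * x - a * b / 2"
    "complex_of_real (x - Re \<alpha>) = x - a"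
    by (simp_all add: a_def b_def)
  ultimately show ?thesis
    unfolding weyl_def coherent_def \<alpha>(2) by (simp only: exp_add[symmetric]) (simp only: \<alpha>(1))
qed

lemma L2_lift_weyl_coherent:
  "L2_lift (weyl \<alpha>) (coherent_state (c, w))
     = coherent_state (exp (- (\<alpha> * cnj \<alpha>) / 4 - cnj \<alpha> * w) * c, w + \<alpha> / 2)"
proof -
  have "L2_lift (weyl \<alpha>) (coherent_state (c, w)) = cscale c (L2_abs (weyl \<alpha> (coherent w)))"
    by (simp only: coherent_state_cscale L2_lift_cscale[OF weyl_isometry] L2_lift_abs[OF weyl_isometry coherent_L2])
  also have "weyl \<alpha> (coherent w) = (\<lambda>x. exp (- (\<alpha> * cnj \<alpha>) / 4 - cnj \<alpha> * w) * coherent (w + \<alpha> / 2) x)"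
    by (rule ext) (rule weyl_coherent)
  finally show ?thesis
    by (simp only: L2_abs_cscale[OF coherent_L2, symmetric] coherent_state_cscale cscale_cscale mult.commute[of c])
qed

text \<open>The scalar in \<open>L2_lift_weyl_coherent\<close> depends only on
  \<open>\<alpha> * cnj \<alpha>\<close> and \<open>cnj \<alpha> * w\<close>, which do not change
  when \<alpha> and w are rotated by the same angle.\<close>

lemma oscillator_group_weyl:
  "oscillator_group t (L2_lift (weyl \<alpha>) a) = L2_lift (weyl (cis (2 * t) * \<alpha>)) (oscillator_group t a)"
proof (rule bounded_linear_eq_on_coherent[where a = a])
  show "bounded_linear (\<lambda>a. oscillator_group t (L2_lift (weyl \<alpha>) a))"
    by (rule bounded_linear_compose[OF bounded_linear_oscillator_group bounded_linear_L2_lift[OF weyl_isometry]])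
  show "bounded_linear (\<lambda>a. L2_lift (weyl (cis (2 * t) * \<alpha>)) (oscillator_group t a))"
    by (rule bounded_linear_compose[OF bounded_linear_L2_lift[OF weyl_isometry] bounded_linear_oscillator_group])
  fix c z
  have cis: "cis (2 * t) * cnj (cis (2 * t)) = 1" by (simp add: cis_cnj cis_mult)
  then have "cis (2 * t) * \<alpha> * cnj (cis (2 * t) * \<alpha>) = \<alpha> * cnj \<alpha>"
    "cnj (cis (2 * t) * \<alpha>) * (cis (2 * t) * z) = cnj \<alpha> * z"
    unfolding complex_cnj_mult by algebra+
  then show "oscillator_group t (L2_lift (weyl \<alpha>) (coherent_state (c, z)))
      = L2_lift (weyl (cis (2 * t) * \<alpha>)) (oscillator_group t (coherent_state (c, z)))"
    by (simp only: L2_lift_weyl_coherent oscillator_group_coherent) (simp add: algebra_simps)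
qed

definition reflection :: "(real \<Rightarrow> complex) \<Rightarrow> real \<Rightarrow> complex" where
  "reflection f x = f (- x)"

lemma reflection_isometry: "L2_isometry reflection"
  unfolding L2_isometry_def by (auto simp: reflection_def[abs_def] L2_reflect)

text \<open>At this time the phase is i and the parameter rotates to -z, and
  \<open>coherent (- z)\<close> is the reflection of \<open>coherent z\<close>.\<close>

lemma oscillator_group_half_period:
  "oscillator_group (pi / 2) a = cscale \<i> (L2_lift reflection a)"
proof (rule bounded_linear_eq_on_coherent[where a = a])
  show "bounded_linear (\<lambda>a. cscale \<i> (L2_lift reflection a))"
    by (rule bounded_linear_compose[OF bounded_linear_cscale bounded_linear_L2_lift[OF reflection_isometry]])
  fix c z
  have "reflection (coherent z) = coherent (- z)"
    by (simp add: reflection_def[abs_def] coherent_def[abs_def])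
  then have "L2_lift reflection (coherent_state (c, z)) = coherent_state (c, - z)"
    by (simp only: coherent_state_cscale L2_lift_cscale[OF reflection_isometry]
        L2_lift_abs[OF reflection_isometry coherent_L2])
  then show "oscillator_group (pi / 2) (coherent_state (c, z)) = cscale \<i> (L2_lift reflection (coherent_state (c, z)))"
    by (simp only: oscillator_group_coherent) (simp add: coherent_state_cscale cscale_cscale)
qed (rule bounded_linear_oscillator_group)

section \<open>The quartic form of four functions at a fixed time\<close>

definition quartic :: "(real \<Rightarrow> complex) \<Rightarrow> (real \<Rightarrow> complex) \<Rightarrow> (real \<Rightarrow> complex) \<Rightarrow> (real \<Rightarrow> complex) \<Rightarrow> complex" where
  "quartic a b c d = (LBINT x. a x * b x * cnj (c x * d x))"

lemma E4_quartic:
  "E4 f1 f2 f3 f4 = complex_of_real (2 / pi) *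
     (LBINT t:{0..pi/2}. quartic (exp_itH t f1) (exp_itH t f2) (exp_itH t f3) (exp_itH t f4))"
  unfolding E4_def quartic_def ..

text \<open>Lets the form be evaluated through classes, the only data that \<open>exp_itH\<close>
  determines. Measurable integrands that agree almost everywhere have the same integral, convergent
  or not.\<close>

lemma quartic_cong:
  assumes L2: "a \<in> L2" "b \<in> L2" "c \<in> L2" "d \<in> L2" "a' \<in> L2" "b' \<in> L2" "c' \<in> L2" "d' \<in> L2"
    and eq: "L2_abs a = L2_abs a'" "L2_abs b = L2_abs b'" "L2_abs c = L2_abs c'" "L2_abs d = L2_abs d'"
  shows "quartic a b c d = quartic a' b' c' d'"
  unfolding quartic_def
proof (rule integral_cong_AE)
  have [measurable]: "a \<in> borel_measurable borel" "b \<in> borel_measurable borel" "c \<in> borel_measurable borel"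
    "d \<in> borel_measurable borel" "a' \<in> borel_measurable borel" "b' \<in> borel_measurable borel"
    "c' \<in> borel_measurable borel" "d' \<in> borel_measurable borel"
    "(\<lambda>x. cnj (c x)) \<in> borel_measurable borel" "(\<lambda>x. cnj (d x)) \<in> borel_measurable borel"
    "(\<lambda>x. cnj (c' x)) \<in> borel_measurable borel" "(\<lambda>x. cnj (d' x)) \<in> borel_measurable borel"
    using L2 by (simp_all add: L2_measurable L2_cnj)
  show "(\<lambda>x. a x * b x * cnj (c x * d x)) \<in> borel_measurable lborel"
    "(\<lambda>x. a' x * b' x * cnj (c' x * d' x)) \<in> borel_measurable lborel"
    by simp_all
  have "AE x in lborel. a x = a' x" "AE x in lborel. b x = b' x"
    "AE x in lborel. c x = c' x" "AE x in lborel. d x = d' x"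
    using L2 eq by (simp_all add: L2_abs_eq_iff)
  then show "AE x in lborel. a x * b x * cnj (c x * d x) = a' x * b' x * cnj (c' x * d' x)"
    by eventually_elim simp
qed

text \<open>Two factors stand against two conjugated ones, so the phase cancels pointwise and may
  vary with x.\<close>

lemma quartic_phase:
  assumes "\<And>x. norm (p x) = 1"
  shows "quartic (\<lambda>x. p x * a x) (\<lambda>x. p x * b x) (\<lambda>x. p x * c x) (\<lambda>x. p x * d x) = quartic a b c d"
proof -
  have p: "p x * cnj (p x) = 1" for x
    using assms[of x] by (simp add: complex_norm_square[symmetric])
  have "p x * a x * (p x * b x) * cnj (p x * c x * (p x * d x)) = a x * b x * cnj (c x * d x)" for x
    using p[of x] unfolding complex_cnj_mult by algebra
  then show ?thesis by (simp only: quartic_def)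
qed

lemma quartic_shift:
  "quartic (\<lambda>x. a (x - s)) (\<lambda>x. b (x - s)) (\<lambda>x. c (x - s)) (\<lambda>x. d (x - s)) = quartic a b c d"
  unfolding quartic_def
  using lborel_integral_real_affine[of 1 "\<lambda>x. a x * b x * cnj (c x * d x)" "- s"] by simp

lemma quartic_reflection:
  "quartic (reflection a) (reflection b) (reflection c) (reflection d) = quartic a b c d"
  unfolding quartic_def reflection_def
  using lborel_integral_real_affine[of "-1" "\<lambda>x. a x * b x * cnj (c x * d x)" 0] by simp

lemma quartic_weyl: "quartic (weyl \<alpha> a) (weyl \<alpha> b) (weyl \<alpha> c) (weyl \<alpha> d) = quartic a b c d"
  unfolding weyl_def[abs_def] by (subst quartic_phase) (simp_all only: norm_exp_i_times quartic_shift)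

lemma L2_abs_exp_itH_weyl:
  assumes "f \<in> L2"
  shows "L2_abs (exp_itH t (weyl \<alpha> f)) = L2_abs (weyl (cis (2 * t) * \<alpha>) (exp_itH t f))"
  using assms
  by (simp add: L2_abs_exp_itH L2_isometry_in[OF weyl_isometry] exp_itH_L2
      L2_lift_abs[OF weyl_isometry, symmetric] oscillator_group_weyl)

text \<open>The Weyl parameter rotates with t, but at each t it is the same in all four slots, so
  \<open>quartic_weyl\<close> applies time by time.\<close>

lemma E4_weyl:
  assumes "f1 \<in> L2" "f2 \<in> L2" "f3 \<in> L2" "f4 \<in> L2"
  shows "E4 (weyl \<alpha> f1) (weyl \<alpha> f2) (weyl \<alpha> f3) (weyl \<alpha> f4) = E4 f1 f2 f3 f4"
proof -
  have "quartic (exp_itH t (weyl \<alpha> f1)) (exp_itH t (weyl \<alpha> f2)) (exp_itH t (weyl \<alpha> f3)) (exp_itH t (weyl \<alpha> f4))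
      = quartic (exp_itH t f1) (exp_itH t f2) (exp_itH t f3) (exp_itH t f4)" for t
  proof -
    have "quartic (exp_itH t (weyl \<alpha> f1)) (exp_itH t (weyl \<alpha> f2)) (exp_itH t (weyl \<alpha> f3)) (exp_itH t (weyl \<alpha> f4))
      = quartic (weyl (cis (2 * t) * \<alpha>) (exp_itH t f1)) (weyl (cis (2 * t) * \<alpha>) (exp_itH t f2))
          (weyl (cis (2 * t) * \<alpha>) (exp_itH t f3)) (weyl (cis (2 * t) * \<alpha>) (exp_itH t f4))"
      using assms by (intro quartic_cong) (simp_all add: L2_abs_exp_itH_weyl exp_itH_L2 L2_isometry_in[OF weyl_isometry])
    then show ?thesis by (simp only: quartic_weyl)
  qed
  then show ?thesis by (simp add: E4_quartic)
qed

lemma E4_phase: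
  assumes "f1 \<in> L2" "f2 \<in> L2" "f3 \<in> L2" "f4 \<in> L2" and k: "norm k = 1"
  shows "E4 (\<lambda>x. k * f1 x) (\<lambda>x. k * f2 x) (\<lambda>x. k * f3 x) (\<lambda>x. k * f4 x) = E4 f1 f2 f3 f4"
proof -
  have "L2_abs (exp_itH t (\<lambda>x. k * f x)) = L2_abs (\<lambda>x. k * exp_itH t f x)" if "f \<in> L2" for f t
    using that by (simp add: L2_abs_exp_itH L2_cmult exp_itH_L2 L2_abs_cscale[symmetric] oscillator_group_cscale)
  then have "quartic (exp_itH t (\<lambda>x. k * f1 x)) (exp_itH t (\<lambda>x. k * f2 x)) (exp_itH t (\<lambda>x. k * f3 x)) (exp_itH t (\<lambda>x. k * f4 x))
      = quartic (\<lambda>x. k * exp_itH t f1 x) (\<lambda>x. k * exp_itH t f2 x) (\<lambda>x. k * exp_itH t f3 x) (\<lambda>x. k * exp_itH t f4 x)" for t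
    using assms by (intro quartic_cong) (simp_all add: exp_itH_L2 L2_cmult)
  then show ?thesis by (simp add: E4_quartic quartic_phase k)
qed

lemma E4_cong:
  assumes "f1 \<in> L2" "f2 \<in> L2" "f3 \<in> L2" "f4 \<in> L2" "g1 \<in> L2" "g2 \<in> L2" "g3 \<in> L2" "g4 \<in> L2"
    and "L2_abs f1 = L2_abs g1" "L2_abs f2 = L2_abs g2" "L2_abs f3 = L2_abs g3" "L2_abs f4 = L2_abs g4"
  shows "E4 f1 f2 f3 f4 = E4 g1 g2 g3 g4"
proof -
  have "quartic (exp_itH t f1) (exp_itH t f2) (exp_itH t f3) (exp_itH t f4)
      = quartic (exp_itH t g1) (exp_itH t g2) (exp_itH t g3) (exp_itH t g4)" for t
    using assms by (intro quartic_cong) (simp_all add: exp_itH_L2 L2_abs_exp_itH)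
  then show ?thesis by (simp add: E4_quartic)
qed

section \<open>Integrals over a period\<close>

lemma set_integrable_Un_iff:
  fixes f :: "real \<Rightarrow> complex"
  assumes "A \<in> sets borel" "B \<in> sets borel"
  shows "set_integrable lborel (A \<union> B) f \<longleftrightarrow> set_integrable lborel A f \<and> set_integrable lborel B f"
proof
  assume *: "set_integrable lborel (A \<union> B) f"
  show "set_integrable lborel A f \<and> set_integrable lborel B f"
    using set_integrable_subset[OF *, of A] set_integrable_subset[OF *, of B] assms by simp
qed (use assms in \<open>simp add: set_integrable_Un\<close>)

lemma set_integral_shift:
  fixes f :: "real \<Rightarrow> complex"
  shows "(LBINT t:{a..<b}. f (t + c)) = (LBINT t:{a + c..<b + c}. f t)"
    and "set_integrable lborel {a..<b} (\<lambda>t. f (t + c)) \<longleftrightarrow> set_integrable lborel {a + c..<b + c} f"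
proof -
  have ind: "indicator {a + c..<b + c} (t + c) = (indicator {a..<b} t :: real)" for t
    by (auto simp: indicator_def)
  show "(LBINT t:{a..<b}. f (t + c)) = (LBINT t:{a + c..<b + c}. f t)"
    using lborel_integral_real_affine[of 1 "\<lambda>t. indicator {a + c..<b + c} t *\<^sub>R f t" c]
    by (simp add: set_lebesgue_integral_def ind add.commute)
  show "set_integrable lborel {a..<b} (\<lambda>t. f (t + c)) \<longleftrightarrow> set_integrable lborel {a + c..<b + c} f"
    using lborel_integrable_real_affine_iff[of 1 "\<lambda>t. indicator {a + c..<b + c} t *\<^sub>R f t" c]
    by (simp add: set_integrable_def ind add.commute)
qed

text \<open>Holds for every periodic \<open>J\<close>: integrability is inherited by all translates of a period, and a
  non-integrable function has integral \<open>0\<close>.\<close>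

lemma set_integral_period:
  fixes J :: "real \<Rightarrow> complex"
  assumes T: "T > 0" and per: "\<And>t. J (t + T) = J t"
  shows "(LBINT t:{0..T}. J (t + l)) = (LBINT t:{0..T}. J t)"
proof -
  have per_nat: "J (t + real n * T) = J t" for t n
  proof (induction n)
    case (Suc n)
    then show ?case using per[of "t + real n * T"] by (simp add: algebra_simps)
  qed simp
  have per_int: "J (t + of_int k * T) = J t" for t k
  proof (cases "k \<ge> 0")
    case True
    then show ?thesis using per_nat[of t "nat k"] by simp
  next
    case False
    then show ?thesis using per_nat[of "t + of_int k * T" "nat (- k)"] by simp
  qed
  \<comment> \<open>Half-open intervals can be cut and translated without overlap. The endpoint is a
    null set, so it changes neither integrability nor the value.\<close>
  have closed: "(LBINT t:{0..T}. f t) = (LBINT t:{0..<T}. f t)" for f :: "real \<Rightarrow> complex"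
  proof -
    have U: "{0..T} = {0..<T} \<union> {T}" using T by auto
    have i: "set_integrable lborel {T} f"
    proof -
      have "(\<lambda>t. indicator {T} t *\<^sub>R f t) = (\<lambda>t. indicator {T} t *\<^sub>R f T)"
        by (auto simp: indicator_def)
      then show ?thesis unfolding set_integrable_def by simp
    qed
    have z: "(LBINT t:{T}. f t) = 0"
    proof -
      have "(\<lambda>t. indicator {T} t *\<^sub>R f t) = (\<lambda>t. indicator {T} t *\<^sub>R f T)"
        by (auto simp: indicator_def)
      then show ?thesis unfolding set_lebesgue_integral_def by simp
    qed
    show ?thesis
    proof (cases "set_integrable lborel {0..<T} f")
      case True
      then show ?thesis unfolding U by (subst set_integral_Un) (auto simp: i z)
    next
      case False
      then have "\<not> set_integrable lborel {0..T} f"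
        unfolding U by (subst set_integrable_Un_iff) auto
      with False show ?thesis
        by (simp add: set_integrable_def set_lebesgue_integral_def not_integrable_integral_eq)
    qed
  qed
  define k where "k = \<lfloor>l / T\<rfloor>"
  define r where "r = l - of_int k * T"
  have r: "0 \<le> r" "r < T"
  proof -
    have "of_int k \<le> l / T" "l / T < of_int k + 1" by (auto simp: k_def)
    then show "0 \<le> r" "r < T" using T by (simp_all add: r_def field_simps)
  qed
  have J1: "J (t + l) = J (t + r)" for t
    using per_int[of "t + r" k] by (simp add: r_def)
  have J2: "J (t + r) = J (t + (r - T))" for t
    using per[of "t + (r - T)"] by simp
  \<comment> \<open>The shift by r carries the first piece onto \<open>{r..<T}\<close>; the second
    overshoots the period and is wrapped around by \<open>J2\<close> onto
    \<open>{0..<r}\<close>.\<close>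
  have U1: "{0..<T} = {0..<T - r} \<union> {T - r..<T}" and U2: "{0..<T} = {r..<T} \<union> {0..<r}"
    using r by auto
  have A: "(LBINT t:{0..<T - r}. J (t + r)) = (LBINT t:{r..<T}. J t)"
    "set_integrable lborel {0..<T - r} (\<lambda>t. J (t + r)) \<longleftrightarrow> set_integrable lborel {r..<T} J"
    using set_integral_shift[of 0 "T - r" J r] by simp_all
  have B: "(LBINT t:{T - r..<T}. J (t + r)) = (LBINT t:{0..<r}. J t)"
    "set_integrable lborel {T - r..<T} (\<lambda>t. J (t + r)) \<longleftrightarrow> set_integrable lborel {0..<r} J"
    unfolding J2 using set_integral_shift[of "T - r" T J "r - T"] by simp_all
  have iff: "set_integrable lborel {0..<T} (\<lambda>t. J (t + r)) \<longleftrightarrow> set_integrable lborel {r..<T} J \<and> set_integrable lborel {0..<r} J"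
    by (subst U1, subst set_integrable_Un_iff) (simp_all add: A B)
  have iff': "set_integrable lborel {0..<T} J \<longleftrightarrow> set_integrable lborel {r..<T} J \<and> set_integrable lborel {0..<r} J"
    by (subst U2, subst set_integrable_Un_iff) simp_all
  have "(LBINT t:{0..<T}. J (t + r)) = (LBINT t:{0..<T}. J t)"
  proof (cases "set_integrable lborel {0..<T} J")
    case True
    then have i: "set_integrable lborel {r..<T} J" "set_integrable lborel {0..<r} J" using iff' by auto
    have "(LBINT t:{0..<T}. J (t + r)) = (LBINT t:{0..<T - r}. J (t + r)) + (LBINT t:{T - r..<T}. J (t + r))"
      by (subst U1, rule set_integral_Un) (use i A(2) B(2) in auto)
    also have "\<dots> = (LBINT t:{r..<T}. J t) + (LBINT t:{0..<r}. J t)" by (simp only: A B)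
    also have "\<dots> = (LBINT t:{0..<T}. J t)"
      by (subst U2, rule set_integral_Un[symmetric]) (use i in auto)
    finally show ?thesis .
  next
    case False
    then have "\<not> set_integrable lborel {0..<T} (\<lambda>t. J (t + r))" using iff iff' by simp
    with False show ?thesis
      by (simp add: set_integrable_def set_lebesgue_integral_def not_integrable_integral_eq)
  qed
  then show ?thesis by (simp only: closed J1)
qed

text \<open>By the group law the action only shifts the time variable of \<open>J\<close>, and the
  interval of integration is exactly one period.\<close>

lemma E4_exp_itH:
  assumes L2: "f1 \<in> L2" "f2 \<in> L2" "f3 \<in> L2" "f4 \<in> L2"
  shows "E4 (exp_itH l f1) (exp_itH l f2) (exp_itH l f3) (exp_itH l f4) = E4 f1 f2 f3 f4"
proof -
  define J where "J t = quartic (exp_itH t f1) (exp_itH t f2) (exp_itH t f3) (exp_itH t f4)" for t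
  have add: "quartic (exp_itH s (exp_itH t f1)) (exp_itH s (exp_itH t f2)) (exp_itH s (exp_itH t f3)) (exp_itH s (exp_itH t f4))
      = J (s + t)" for s t
    unfolding J_def using L2
    by (intro quartic_cong) (simp_all add: exp_itH_L2 L2_abs_exp_itH oscillator_group_add)
  have half: "L2_abs (exp_itH (pi / 2) f) = L2_abs (\<lambda>x. \<i> * reflection f x)" if "f \<in> L2" for f
    using that
    by (simp add: L2_abs_exp_itH oscillator_group_half_period L2_abs_cscale[symmetric]
        L2_isometry_in[OF reflection_isometry] L2_lift_abs[OF reflection_isometry])
  have "J (t + pi / 2) = J t" for t
  proof -
    have "J (t + pi / 2) = quartic (exp_itH (pi / 2) (exp_itH t f1)) (exp_itH (pi / 2) (exp_itH t f2))
        (exp_itH (pi / 2) (exp_itH t f3)) (exp_itH (pi / 2) (exp_itH t f4))"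
      by (simp add: add add.commute)
    also have "\<dots> = quartic (\<lambda>x. \<i> * reflection (exp_itH t f1) x) (\<lambda>x. \<i> * reflection (exp_itH t f2) x)
        (\<lambda>x. \<i> * reflection (exp_itH t f3) x) (\<lambda>x. \<i> * reflection (exp_itH t f4) x)"
      using L2 by (intro quartic_cong) (simp_all add: exp_itH_L2 half L2_cmult L2_isometry_in[OF reflection_isometry])
    also have "\<dots> = J t"
      by (simp add: quartic_phase quartic_reflection J_def)
    finally show ?thesis .
  qed
  then have "(LBINT t:{0..pi/2}. J (t + l)) = (LBINT t:{0..pi/2}. J t)"
    by (intro set_integral_period) simp_all
  then show ?thesis by (simp add: E4_quartic add) (simp add: J_def[abs_def])
qed

section \<open>The Fourier transform\<close>

definition fourier_integral :: "(real \<Rightarrow> complex) \<Rightarrow> real \<Rightarrow> complex" where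
  "fourier_integral h \<xi> = complex_of_real (1 / sqrt (2 * pi)) *
     (LBINT x. exp (- (\<i> * complex_of_real x * complex_of_real \<xi>)) * h x)"

lemma norm_fourier_kernel: "norm (exp (- (\<i> * complex_of_real x * complex_of_real y))) = 1"
proof -
  have "- (\<i> * complex_of_real x * complex_of_real y) = \<i> * complex_of_real (- (x * y))" by simp
  then show ?thesis by (simp only: norm_exp_i_times)
qed

lemma fourier_kernel_measurable [measurable]:
  "(\<lambda>(x, y). exp (- (\<i> * complex_of_real x * complex_of_real y))) \<in> borel_measurable (borel \<Otimes>\<^sub>M borel)"
  unfolding case_prod_beta by measurable

lemma fourier_integral_measurable:
  assumes "integrable lborel h"
  shows "fourier_integral h \<in> borel_measurable borel"
proof -
  have [measurable]: "h \<in> borel_measurable borel"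
    using borel_measurable_integrable[OF assms] by simp
  have "(\<lambda>\<xi>. LBINT x. exp (- (\<i> * complex_of_real x * complex_of_real \<xi>)) * h x) \<in> borel_measurable borel"
    by (rule sigma_finite_measure.borel_measurable_lebesgue_integral[OF sigma_finite_lborel])
      (simp add: case_prod_beta)
  then show ?thesis
    unfolding fourier_integral_def[abs_def] by (intro borel_measurable_times) simp_all
qed

lemma fourier_coherent:
  "(LBINT \<xi>. exp (- (\<i> * complex_of_real x * complex_of_real \<xi>)) * coherent w \<xi>)
     = complex_of_real (sqrt (2 * pi)) * coherent (- \<i> * w) x"
proof -
  have "exp (- (\<i> * complex_of_real x * complex_of_real \<xi>)) * coherent w \<xi>
      = exp (- (w\<^sup>2)) * exp (- (complex_of_real \<xi>)\<^sup>2 / 2 + (2 * w - \<i> * x) * \<xi>)" for \<xi>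
    unfolding coherent_def exp_add[symmetric] by (rule arg_cong[of _ _ exp]) (simp add: algebra_simps)
  then have "(LBINT \<xi>. exp (- (\<i> * complex_of_real x * complex_of_real \<xi>)) * coherent w \<xi>)
      = exp (- (w\<^sup>2)) * (complex_of_real (sqrt (2 * pi)) * exp ((2 * w - \<i> * x)\<^sup>2 / 2))"
    by (simp only: has_bochner_integral_integral_eq[OF has_bochner_integral_cmult[OF has_bochner_integral_gaussian]])
  also have "\<dots> = complex_of_real (sqrt (2 * pi)) * (exp (- (w\<^sup>2)) * exp ((2 * w - \<i> * x)\<^sup>2 / 2))"
    by (simp add: mult_ac)
  also have "exp (- (w\<^sup>2)) * exp ((2 * w - \<i> * x)\<^sup>2 / 2) = coherent (- \<i> * w) x"
    unfolding coherent_def exp_add[symmetric]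
    by (rule arg_cong[of _ _ exp]) (simp add: power2_eq_square field_simps)
  finally show ?thesis .
qed

text \<open>The multiplication formula, which moves the transform from h to a test function, used
  with coherent states because their transforms are explicit.\<close>

lemma fourier_integral_coherent_Fubini:
  assumes h: "integrable lborel h"
  shows "(LBINT \<xi>. fourier_integral h \<xi> * coherent w \<xi>) = (LBINT x. h x * coherent (- \<i> * w) x)"
proof -
  define k where "k x \<xi> = exp (- (\<i> * complex_of_real x * complex_of_real \<xi>))" for x \<xi> :: real
  have nk: "norm (k x \<xi>) = 1" for x \<xi> unfolding k_def by (rule norm_fourier_kernel)
  have [measurable]: "(\<lambda>z. k (fst z) (snd z)) \<in> borel_measurable (borel \<Otimes>\<^sub>M borel)"
    unfolding k_def by measurable
  have [measurable]: "h \<in> borel_measurable borel"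
    using borel_measurable_integrable[OF h] by simp
  have int: "integrable (lborel \<Otimes>\<^sub>M lborel) (\<lambda>z. k (fst z) (snd z) * h (fst z) * coherent w (snd z))"
  proof (rule lborel_pair.Fubini_integrable)
    show "(\<lambda>z. k (fst z) (snd z) * h (fst z) * coherent w (snd z)) \<in> borel_measurable (lborel \<Otimes>\<^sub>M lborel)"
      by measurable
    have "integrable lborel (\<lambda>x. norm (h x) * (LBINT \<xi>. norm (coherent w \<xi>)))"
      using h by simp
    then show "integrable lborel (\<lambda>x. LBINT y. norm (k (fst (x, y)) (snd (x, y)) * h (fst (x, y)) * coherent w (snd (x, y))))"
      by (simp add: norm_mult nk)
    show "AE x in lborel. integrable lborel (\<lambda>y. k (fst (x, y)) (snd (x, y)) * h (fst (x, y)) * coherent w (snd (x, y)))"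
    proof (rule AE_I2)
      fix x
      have "integrable lborel (\<lambda>y. norm (h x) * norm (coherent w y))"
        by (intro integrable_mult_right integrable_norm coherent_integrable)
      then show "integrable lborel (\<lambda>y. k (fst (x, y)) (snd (x, y)) * h (fst (x, y)) * coherent w (snd (x, y)))"
      proof (rule Bochner_Integration.integrable_bound)
        have "(\<lambda>y. k x y) \<in> borel_measurable borel" unfolding k_def by measurable
        then show "(\<lambda>y. k (fst (x, y)) (snd (x, y)) * h (fst (x, y)) * coherent w (snd (x, y))) \<in> borel_measurable lborel"
          by simp
      qed (simp add: norm_mult nk)
    qed
  qed
  then have "(LBINT \<xi>. LBINT x. k x \<xi> * h x * coherent w \<xi>) = (LBINT x. LBINT \<xi>. k x \<xi> * h x * coherent w \<xi>)"
    by (intro lborel_pair.Fubini_integral) (simp add: case_prod_unfold)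
  moreover have "(LBINT x. k x \<xi> * h x * coherent w \<xi>) = complex_of_real (sqrt (2 * pi)) * (fourier_integral h \<xi> * coherent w \<xi>)" for \<xi>
    by (simp add: fourier_integral_def k_def)
  moreover have "(LBINT \<xi>. k x \<xi> * h x * coherent w \<xi>) = complex_of_real (sqrt (2 * pi)) * (h x * coherent (- \<i> * w) x)" for x
  proof -
    have "(LBINT \<xi>. k x \<xi> * h x * coherent w \<xi>) = (LBINT \<xi>. h x * (k x \<xi> * coherent w \<xi>))"
      by (simp add: mult_ac)
    then show ?thesis by (simp add: k_def fourier_coherent)
  qed
  ultimately have "complex_of_real (sqrt (2 * pi)) * (LBINT \<xi>. fourier_integral h \<xi> * coherent w \<xi>)
      = complex_of_real (sqrt (2 * pi)) * (LBINT x. h x * coherent (- \<i> * w) x)"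
    by (simp only: integral_mult_right_zero)
  then show ?thesis by simp
qed

lemma norm_fourier_integral_le:
  "norm (fourier_integral h \<xi>) \<le> 1 / sqrt (2 * pi) * (LBINT x. norm (h x))"
proof -
  have "norm (LBINT x. exp (- (\<i> * complex_of_real x * complex_of_real \<xi>)) * h x) \<le> (LBINT x. norm (h x))"
    using integral_norm_bound[of lborel "\<lambda>x. exp (- (\<i> * complex_of_real x * complex_of_real \<xi>)) * h x"]
    by (simp only: norm_mult norm_fourier_kernel mult_1_left)
  then have "1 / sqrt (2 * pi) * norm (LBINT x. exp (- (\<i> * complex_of_real x * complex_of_real \<xi>)) * h x)
      \<le> 1 / sqrt (2 * pi) * (LBINT x. norm (h x))"
    by (intro mult_left_mono) simp_all
  then show ?thesis by (simp add: fourier_integral_def norm_mult norm_divide)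
qed

text \<open>The Fourier transform is \<open>e\<^bsup>i\<pi>/4\<^esup> e\<^bsup>-i(\<pi>/4)H\<^esup>\<close>, since it maps \<open>coherent z\<close> to \<open>coherent (- \<i> z)\<close>.\<close>

definition plancherel :: "L2_class \<Rightarrow> L2_class" where
  "plancherel a = cscale (cis (pi / 4)) (oscillator_group (- (pi / 4)) a)"

lemma plancherel_linear: "linear (plancherel)"
  unfolding plancherel_def[abs_def]
  using linear_compose[OF oscillator_group_linear cscale_linear] by (simp add: comp_def)

lemma norm_plancherel: "norm (plancherel a) = norm a"
  by (simp add: plancherel_def norm_cscale norm_oscillator_group)

text \<open>The constant \<open>cis (pi / 4)\<close> cancels the phase of the group at time -pi/4;
  only the rotation of z by -i remains.\<close>

lemma plancherel_coherent: "plancherel (coherent_state (c, z)) = coherent_state (c, - \<i> * z)"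
proof -
  have "cis (- (pi / 2)) = - \<i>" by (simp add: cis.ctr complex_eq_iff)
  then show ?thesis
    unfolding plancherel_def oscillator_group_coherent
    by (simp add: coherent_state_cscale cscale_cscale mult.assoc[symmetric] cis_mult)
qed

text \<open>The concrete transform is bounded, so its products with coherent states are integrable,
  and they have the same integrals as those of the abstract image \<open>q\<close>. The two
  functions therefore agree almost everywhere, and square integrability of the concrete one is a
  consequence.\<close>

lemma L2_abs_fourier_integral:
  assumes L2: "h \<in> L2" and int: "integrable lborel h"
  shows "fourier_integral h \<in> L2 \<and> L2_abs (fourier_integral h) = plancherel (L2_abs h)"
proof -
  define q where "q = L2_rep (plancherel (L2_abs h))"
  have q: "q \<in> L2" by (simp add: q_def)
  have [measurable]: "q \<in> borel_measurable borel" "fourier_integral h \<in> borel_measurable borel"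
    using L2_measurable[OF q] fourier_integral_measurable[OF int] by auto
  have i1: "integrable lborel (\<lambda>x. q x * coherent z x)" for z
    by (intro L2_integrable_mult q coherent_L2)
  have i2: "integrable lborel (\<lambda>x. fourier_integral h x * coherent z x)" for z
  proof (rule Bochner_Integration.integrable_bound)
    define C where "C = 1 / sqrt (2 * pi) * (LBINT x. norm (h x))"
    show "integrable lborel (\<lambda>x. C * norm (coherent z x))"
      by (intro integrable_mult_right integrable_norm coherent_integrable)
    have "norm (fourier_integral h x) * norm (coherent z x) \<le> \<bar>C\<bar> * norm (coherent z x)" for x
      using norm_fourier_integral_le[of h x] by (intro mult_right_mono) (auto simp: C_def)
    then show "AE x in lborel. norm (fourier_integral h x * coherent z x) \<le> norm (C * norm (coherent z x))"
      by (simp add: norm_mult abs_mult)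
  qed simp
  have "AE x in lborel. q x - fourier_integral h x = 0"
  proof (rule AE_zero_if_orthogonal_coherent)
    show "integrable lborel (\<lambda>x. (q x - fourier_integral h x) * coherent 0 x)"
      using i1 i2 by (simp add: left_diff_distrib)
    fix z
    \<comment> \<open>The test function is the \<open>plancherel\<close> image of the coherent state
      at \<open>\<i> * z\<close>, since -i times i z is z; the isometry then removes the transform
      from both sides.\<close>
    have "(LBINT x. q x * cnj (coherent z x)) = (LBINT x. h x * cnj (coherent (\<i> * z) x))"
    proof (rule integral_mult_cnj_eq_if_inner_eq)
      fix c
      have "inner (plancherel (L2_abs h)) (plancherel (coherent_state (c, \<i> * z))) = inner (L2_abs h) (coherent_state (c, \<i> * z))"
        by (intro linear_isometry_inner plancherel_linear norm_plancherel)
      then show "inner (L2_abs q) (cscale c (L2_abs (coherent z))) = inner (L2_abs h) (cscale c (L2_abs (coherent (\<i> * z))))"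
        unfolding plancherel_coherent by (simp add: q_def coherent_state_cscale mult.assoc[symmetric])
    qed (simp_all add: q L2 coherent_L2)
    also have "\<dots> = (LBINT x. fourier_integral h x * cnj (coherent z x))"
      using fourier_integral_coherent_Fubini[OF int, of "cnj z"] by (simp add: cnj_coherent)
    finally show "(LBINT x. (q x - fourier_integral h x) * cnj (coherent z x)) = 0"
      using i1[of "cnj z"] i2[of "cnj z"] by (simp add: cnj_coherent left_diff_distrib)
  qed
  then have ae: "AE x in lborel. q x = fourier_integral h x" by simp
  have "integrable lborel (\<lambda>x. (norm (fourier_integral h x))\<^sup>2)"
  proof (rule integrable_cong_AE_imp[OF L2_integrable_norm_sq[OF q]])
    show "AE x in lborel. (norm (q x))\<^sup>2 = (norm (fourier_integral h x))\<^sup>2"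
      using ae by eventually_elim simp
  qed simp
  then have F: "fourier_integral h \<in> L2" by (simp add: L2_def)
  moreover have "L2_abs (fourier_integral h) = L2_abs q"
    using ae by (subst eq_commute) (simp add: L2_abs_eq_iff F q)
  ultimately show ?thesis by (simp add: q_def)
qed

lemma L2_truncate:
  assumes f: "f \<in> L2"
  defines "tr \<equiv> (\<lambda>R x. indicator {- R..R} x *\<^sub>R f x)"
  shows "tr R \<in> L2" "integrable lborel (tr R)" "((\<lambda>R. L2_abs (tr R)) \<longlongrightarrow> L2_abs f) at_top"
proof -
  have [measurable]: "f \<in> borel_measurable borel" using f by (rule L2_measurable)
  show trL2: "tr R \<in> L2" for R
  proof -
    have "integrable lborel (\<lambda>x. (norm (tr R x))\<^sup>2)"
      by (rule Bochner_Integration.integrable_bound[OF L2_integrable_norm_sq[OF f]])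
        (auto simp: tr_def indicator_def)
    then show ?thesis by (simp add: L2_def tr_def)
  qed
  show "integrable lborel (tr R)"
  proof -
    have "integrable lborel (\<lambda>x. (norm (complex_of_real (indicator {- R..R} x)))\<^sup>2)"
    proof -
      have "(\<lambda>x. (norm (complex_of_real (indicator {- R..R} x)))\<^sup>2) = (indicator {- R..R} :: real \<Rightarrow> real)"
        by (auto simp: indicator_def)
      moreover have "integrable lborel (indicator {- R..R} :: real \<Rightarrow> real)"
        by (rule integrable_real_indicator) (simp_all add: emeasure_lborel_Icc_eq)
      ultimately show ?thesis by simp
    qed
    then have "(\<lambda>x. complex_of_real (indicator {- R..R} x)) \<in> L2"
      by (simp add: L2_def)
    from L2_integrable_mult[OF this f] show ?thesis
      by (simp add: tr_def scaleR_conv_of_real)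
  qed
  have "((\<lambda>R. LBINT x. (norm (tr R x - f x))\<^sup>2) \<longlongrightarrow> integral\<^sup>L lborel (\<lambda>x::real. 0::real)) at_top"
  proof (rule integral_dominated_convergence_at_top[where w = "\<lambda>x. (norm (f x))\<^sup>2"])
    show "(\<lambda>x. (norm (tr R x - f x))\<^sup>2) \<in> borel_measurable lborel" for R
      by (simp add: tr_def)
    show "\<forall>\<^sub>F R in at_top. AE x in lborel. norm ((norm (tr R x - f x))\<^sup>2) \<le> (norm (f x))\<^sup>2"
      by (auto simp: tr_def indicator_def)
    show "AE x in lborel. ((\<lambda>R. (norm (tr R x - f x))\<^sup>2) \<longlongrightarrow> 0) at_top"
    proof (rule AE_I2)
      fix x
      have "\<forall>\<^sub>F R in at_top. (norm (tr R x - f x))\<^sup>2 = 0"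
        using eventually_ge_at_top[of "\<bar>x\<bar>"] by eventually_elim (auto simp: tr_def indicator_def)
      then show "((\<lambda>R. (norm (tr R x - f x))\<^sup>2) \<longlongrightarrow> 0) at_top" by (rule tendsto_eventually)
    qed
  qed (simp_all add: L2_integrable_norm_sq f)
  then have "((\<lambda>R. L2_norm (\<lambda>x. tr R x - f x)) \<longlongrightarrow> sqrt 0) at_top"
    unfolding L2_norm_def by (intro tendsto_real_sqrt) simp
  then show "((\<lambda>R. L2_abs (tr R)) \<longlongrightarrow> L2_abs f) at_top"
    by (simp add: L2_norm_diff trL2 f tendsto_norm_zero_iff LIM_zero_iff)
qed

text \<open>The truncated integrals are the \<open>plancherel\<close> images of the truncations, and
  these converge by continuity. Uniqueness of limits then fixes the class of whatever function the
  choice in \<open>fourier_L2\<close> returns.\<close>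

lemma fourier_L2_plancherel:
  assumes f: "f \<in> L2"
  shows "fourier_L2 f \<in> L2" "L2_abs (fourier_L2 f) = plancherel (L2_abs f)"
proof -
  define tr where "tr R x = indicator {- R..R} x *\<^sub>R f x" for R x
  define G where "G R \<xi> = complex_of_real (1 / sqrt (2 * pi)) *
        (LBINT x:{-R..R}. exp (- (\<i> * complex_of_real x * complex_of_real \<xi>)) * f x)" for R \<xi>
  have G: "G R = fourier_integral (tr R)" for R
    by (simp add: G_def[abs_def] fourier_integral_def[abs_def] tr_def set_lebesgue_integral_def)
  have GL2: "G R \<in> L2" "L2_abs (G R) = plancherel (L2_abs (tr R))" for R
    using L2_abs_fourier_integral[of "tr R"] L2_truncate(1,2)[OF f, of R] by (simp_all add: G tr_def[abs_def])
  interpret P: bounded_linear plancherel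
    by (intro linear_isometry_bounded_linear plancherel_linear norm_plancherel)
  have lim: "((\<lambda>R. L2_abs (G R)) \<longlongrightarrow> plancherel (L2_abs f)) at_top"
    unfolding GL2 tr_def[abs_def] by (intro P.tendsto L2_truncate f)
  have iff: "L2_tendsto G g at_top \<longleftrightarrow> g \<in> L2 \<and> ((\<lambda>R. L2_abs (G R)) \<longlongrightarrow> L2_abs g) at_top" for g
    by (auto simp: L2_tendsto_def GL2(1) L2_norm_diff tendsto_norm_zero_iff LIM_zero_iff)
  have "L2_tendsto G (L2_rep (plancherel (L2_abs f))) at_top"
    using lim by (simp add: iff)
  then have "L2_tendsto G (SOME g. L2_tendsto G g at_top) at_top"
    by (rule someI[where P = "\<lambda>g. L2_tendsto G g at_top"])
  then have "L2_tendsto G (fourier_L2 f) at_top"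
    unfolding fourier_L2_def G_def[abs_def] .
  then show "fourier_L2 f \<in> L2" "L2_abs (fourier_L2 f) = plancherel (L2_abs f)"
    using lim tendsto_unique[OF trivial_limit_at_top_linorder] by (auto simp: iff)
qed

lemma E4_fourier:
  assumes L2: "f1 \<in> L2" "f2 \<in> L2" "f3 \<in> L2" "f4 \<in> L2"
  shows "E4 (fourier_L2 f1) (fourier_L2 f2) (fourier_L2 f3) (fourier_L2 f4) = E4 f1 f2 f3 f4"
proof -
  define k where "k = cis (pi / 4)"
  define l where "l = - (pi / 4)"
  have "L2_abs (fourier_L2 f) = L2_abs (\<lambda>x. k * exp_itH l f x)" if "f \<in> L2" for f
    using that by (simp add: fourier_L2_plancherel plancherel_def k_def l_def L2_abs_exp_itH exp_itH_L2
        L2_abs_cscale[symmetric])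
  then have "E4 (fourier_L2 f1) (fourier_L2 f2) (fourier_L2 f3) (fourier_L2 f4)
      = E4 (\<lambda>x. k * exp_itH l f1 x) (\<lambda>x. k * exp_itH l f2 x) (\<lambda>x. k * exp_itH l f3 x) (\<lambda>x. k * exp_itH l f4 x)"
    using L2 by (intro E4_cong) (simp_all add: fourier_L2_plancherel(1) L2_cmult exp_itH_L2)
  also have "\<dots> = E4 (exp_itH l f1) (exp_itH l f2) (exp_itH l f3) (exp_itH l f4)"
    by (intro E4_phase exp_itH_L2 L2) (simp add: k_def)
  also have "\<dots> = E4 f1 f2 f3 f4" by (rule E4_exp_itH[OF L2])
  finally show ?thesis .
qed

theorem theorem4p5:
  fixes f1 f2 f3 f4 :: "real \<Rightarrow> complex"
  assumes "f1 \<in> L2" and "f2 \<in> L2" and "f3 \<in> L2" and "f4 \<in> L2"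
  shows
    "E4 (fourier_L2 f1) (fourier_L2 f2) (fourier_L2 f3) (fourier_L2 f4) = E4 f1 f2 f3 f4 \<and>
     (\<forall>l::real.
       E4 (\<lambda>x. exp (\<i> * complex_of_real l) * f1 x)
          (\<lambda>x. exp (\<i> * complex_of_real l) * f2 x)
          (\<lambda>x. exp (\<i> * complex_of_real l) * f3 x)
          (\<lambda>x. exp (\<i> * complex_of_real l) * f4 x) = E4 f1 f2 f3 f4 \<and>
       E4 (\<lambda>x. exp (\<i> * complex_of_real (l * x)) * f1 x)
          (\<lambda>x. exp (\<i> * complex_of_real (l * x)) * f2 x)
          (\<lambda>x. exp (\<i> * complex_of_real (l * x)) * f3 x)
          (\<lambda>x. exp (\<i> * complex_of_real (l * x)) * f4 x) = E4 f1 f2 f3 f4 \<and>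
       E4 (\<lambda>x. f1 (x + l)) (\<lambda>x. f2 (x + l)) (\<lambda>x. f3 (x + l)) (\<lambda>x. f4 (x + l)) = E4 f1 f2 f3 f4 \<and>
       E4 (exp_itH l f1) (exp_itH l f2) (exp_itH l f3) (exp_itH l f4) = E4 f1 f2 f3 f4)"
proof (intro conjI allI)
  fix l :: real
  \<comment> \<open>For a purely imaginary or purely real parameter the constant phase in
    \<open>weyl\<close> vanishes, so both identities are exact equalities of functions.\<close>
  have modulation: "(\<lambda>x. exp (\<i> * complex_of_real (l * x)) * f x) = weyl (\<i> * complex_of_real l) f" for f
    by (simp add: weyl_def[abs_def])
  have translation: "(\<lambda>x. f (x + l)) = weyl (- complex_of_real l) f" for f
    by (simp add: weyl_def[abs_def])
  show "E4 (\<lambda>x. exp (\<i> * complex_of_real (l * x)) * f1 x)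
      (\<lambda>x. exp (\<i> * complex_of_real (l * x)) * f2 x)
      (\<lambda>x. exp (\<i> * complex_of_real (l * x)) * f3 x)
      (\<lambda>x. exp (\<i> * complex_of_real (l * x)) * f4 x) = E4 f1 f2 f3 f4"
    unfolding modulation by (rule E4_weyl[OF assms])
  show "E4 (\<lambda>x. f1 (x + l)) (\<lambda>x. f2 (x + l)) (\<lambda>x. f3 (x + l)) (\<lambda>x. f4 (x + l)) = E4 f1 f2 f3 f4"
    unfolding translation by (rule E4_weyl[OF assms])
  show "E4 (\<lambda>x. exp (\<i> * complex_of_real l) * f1 x) (\<lambda>x. exp (\<i> * complex_of_real l) * f2 x)
      (\<lambda>x. exp (\<i> * complex_of_real l) * f3 x) (\<lambda>x. exp (\<i> * complex_of_real l) * f4 x) = E4 f1 f2 f3 f4"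
    by (rule E4_phase[OF assms norm_exp_i_times])
  show "E4 (exp_itH l f1) (exp_itH l f2) (exp_itH l f3) (exp_itH l f4) = E4 f1 f2 f3 f4"
    by (rule E4_exp_itH[OF assms])
qed (rule E4_fourier[OF assms])

end
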